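(* Let $(X,d)$ be a complete and separable metric space and $I=[0,1]$. Let $\pi\in P(D(I:X))$ be concentrated on $\mathcal{BV}(I:X)\subset D(I:X)$ such that $$\int |D\gamma|(I)\,\mathrm{d}\pi(\gamma)<\infty$$ and $\mu_0:=(e_0)_\#\pi\in P_1(X)$. Then the curve $t\mapsto \mu_t:=(e_t)_\#\pi$ belongs to $\mathcal{BV}(I:P_1(X))$, and $$|D\mu|\le\int|D\gamma|\,\mathrm{d}\pi(\gamma)$$ as measures.
   Context: $I=[0,1]$. $P(\cdot)$ denotes the set of Borel probability measures. $P_1(X)$ is the set of Borel probability measures on $X$ with finite first moment, endowed with the $1$-Wasserstein distance $W_1$ (a complete separable metric space). For a complete separable metric space $(Y,d)$ (below $Y=X$ or $Y=(P_1(X),W_1)$): - $L^1(I:Y)$ is the space of maps $u:I\to Y$ with $\int_I d(u(t),\bar y)\,dt<\infty$ for some (and thus every) $\bar y\in Y$. - For $J\subset I$, $\mathrm{Var}(u;J)=\sup\{\sum_{i=0}^k d(u(t_i),u(t_{i+1})): t_0<\dots<t_{k+1},\ t_j\in J\}$ and $\mathrm{ess\,Var}(u;J)=\inf\{\mathrm{Var}(v;J): v=u \text{ a.e. on } J\}$. - $u\in L^1(I:Y)$ is a BV-curve if $\mathrm{ess\,Var}(u;I)<\infty$. - $D(I:Y)$ is the set of càdlàg curves (right-continuous with left limits), equipped with the Skorokhod metric $d_{Sk}(\gamma,\tilde\gamma)=\inf_\lambda\max\{\|\lambda\|_B,\sup_{t}d(\gamma(t),\tilde\gamma(\lambda(t)))\}$,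 the infimum over increasing homeomorphisms $\lambda:I\to I$, with $\|\lambda\|_B=\sup_{0\le s<t\le1}|\log\frac{\lambda(t)-\lambda(s)}{t-s}|$; it is complete and separable. $\mathcal{BV}(I:Y)\subset D(I:Y)$ is the set of càdlàg BV-curves. - For a BV-curve $u$, the variation measure $|Du|$ is the Lebesgue–Stieltjes measure on $I$ induced by the non-decreasing function $V(t)=\mathrm{ess\,Var}(u;(0,t))$, where the Lebesgue–Stieltjes measure $|Df|$ of a non-decreasing $f:I\to\mathbb R$ is given by $|Df|((a,b))=f(b^-)-f(a^+)$. (Since $V$ does not involve the value $u(1)$, a jump of $u$ at $t=1$ is not counted by $|Du|$.) $e_t(\gamma)=\gamma(t)$ is the evaluation map on $D(I:X)$ and $\#$ denotes push-forward. The measure $\int|D\gamma|\,\mathrm d\pi(\gamma)$ on $I$ is defined by $A\mapsto\int_{D(I:X)}|D\gamma|(A)\,\mathrm d\pi(\gamma)$ for Borel $A\subset I$.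
   Formalization: Since |Dγ| ignores a jump at t=1, μ_1 may lack a first moment (γ=c·1_{{1}}, c Cauchy). So μ∈BV(I:P_1(X)) is stated if μ_1∈P_1(X), and otherwise for μ with its value at 1 replaced by any element of P_1(X); |Dμ|≤∫|Dγ|dπ is unconditional. *)

theory Defs
  imports "HOL-Probability.Probability"
begin

text \<open>
  A metric space is given by a carrier \<open>Y\<close> and a distance \<open>d\<close>; it is instantiated both by
  \<open>UNIV\<close>, \<open>dist\<close> on a type of class \<open>polish_space\<close> (complete and second countable, equivalently
  separable) and by \<open>P1\<close>, \<open>W1\<close> below. Curves on the unit interval are extensional functions.
\<close>

abbreviation unit_interval :: "real set" (\<open>I01\<close>)
  where "I01 \<equiv> {0..1}"

definition borel_metric :: "'b set \<Rightarrow> ('b \<Rightarrow> 'b \<Rightarrow> real) \<Rightarrow> 'b measure"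
  where "borel_metric Y d = sigma Y {U. openin (Metric_space.mtopology Y d) U}"

subsection \<open>Curves of bounded variation\<close>

definition L1_curves :: "'b set \<Rightarrow> ('b \<Rightarrow> 'b \<Rightarrow> real) \<Rightarrow> (real \<Rightarrow> 'b) set"
  where "L1_curves Y d = {u \<in> measurable (lebesgue_on I01) (borel_metric Y d).
    \<exists>y\<in>Y. (\<integral>\<^sup>+t. ennreal (d (u t) y) \<partial>lebesgue_on I01) < \<infinity>}"

definition Var :: "('b \<Rightarrow> 'b \<Rightarrow> real) \<Rightarrow> (real \<Rightarrow> 'b) \<Rightarrow> real set \<Rightarrow> ennreal"
  where "Var d u J =
    (\<Squnion>(k, t) \<in> {(k::nat, t::nat \<Rightarrow> real). (\<forall>i\<le>k. t i < t (Suc i)) \<and> (\<forall>j\<le>Suc k. t j \<in> J)}.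
      \<Sum>i\<le>k. ennreal (d (u (t i)) (u (t (Suc i)))))"

definition ess_Var :: "'b set \<Rightarrow> ('b \<Rightarrow> 'b \<Rightarrow> real) \<Rightarrow> (real \<Rightarrow> 'b) \<Rightarrow> real set \<Rightarrow> ennreal"
  where "ess_Var Y d u J =
    (\<Sqinter>v \<in> {v \<in> J \<rightarrow> Y. AE t in lebesgue. t \<in> J \<longrightarrow> v t = u t}. Var d v J)"

definition BV_curve :: "'b set \<Rightarrow> ('b \<Rightarrow> 'b \<Rightarrow> real) \<Rightarrow> (real \<Rightarrow> 'b) \<Rightarrow> bool"
  where "BV_curve Y d u \<longleftrightarrow> u \<in> L1_curves Y d \<and> ess_Var Y d u I01 < \<infinity>"

definition cadlag :: "'b set \<Rightarrow> ('b \<Rightarrow> 'b \<Rightarrow> real) \<Rightarrow> (real \<Rightarrow> 'b) set"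
  where "cadlag Y d = {u \<in> I01 \<rightarrow>\<^sub>E Y.
    (\<forall>t\<in>{0..<1}. ((\<lambda>s. d (u s) (u t)) \<longlongrightarrow> 0) (at_right t)) \<and>
    (\<forall>t\<in>{0<..1}. \<exists>l\<in>Y. ((\<lambda>s. d (u s) l) \<longlongrightarrow> 0) (at_left t))}"

definition cadlag_BV :: "'b set \<Rightarrow> ('b \<Rightarrow> 'b \<Rightarrow> real) \<Rightarrow> (real \<Rightarrow> 'b) set"
  where "cadlag_BV Y d = {u \<in> cadlag Y d. BV_curve Y d u}"

subsection \<open>The Skorokhod metric\<close>

definition time_changes :: "(real \<Rightarrow> real) set"
  where "time_changes = {l. strict_mono_on I01 l \<and> (\<exists>g. homeomorphism I01 I01 l g)}"

definition billingsley_norm :: "(real \<Rightarrow> real) \<Rightarrow> ennreal"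
  where "billingsley_norm l =
    (\<Squnion>(s, t) \<in> {(s, t). 0 \<le> s \<and> s < t \<and> t \<le> 1}. ennreal \<bar>ln ((l t - l s) / (t - s))\<bar>)"

definition d_Sk :: "('b \<Rightarrow> 'b \<Rightarrow> real) \<Rightarrow> (real \<Rightarrow> 'b) \<Rightarrow> (real \<Rightarrow> 'b) \<Rightarrow> real"
  where "d_Sk d u v = enn2real (\<Sqinter>l \<in> time_changes.
    max (billingsley_norm l) (\<Squnion>t\<in>I01. ennreal (d (u t) (v (l t)))))"

abbreviation skorokhod_borel :: "'b set \<Rightarrow> ('b \<Rightarrow> 'b \<Rightarrow> real) \<Rightarrow> (real \<Rightarrow> 'b) measure"
  where "skorokhod_borel Y d \<equiv> borel_metric (cadlag Y d) (d_Sk d)"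

subsection \<open>The 1-Wasserstein space\<close>

definition P1 :: "'a::polish_space measure set"
  where "P1 = {\<mu> \<in> space (prob_algebra borel). \<exists>x0. integrable \<mu> (\<lambda>x. dist x x0)}"

definition couplings ::
    "'a::polish_space measure \<Rightarrow> 'a measure \<Rightarrow> ('a \<times> 'a) measure set"
  where "couplings \<mu> \<nu> = {\<sigma> \<in> space (prob_algebra (borel \<Otimes>\<^sub>M borel)).
    distr \<sigma> borel fst = \<mu> \<and> distr \<sigma> borel snd = \<nu>}"

definition W1 :: "'a::polish_space measure \<Rightarrow> 'a measure \<Rightarrow> real"
  where "W1 \<mu> \<nu> = enn2real (\<Sqinter>\<sigma> \<in> couplings \<mu> \<nu>. \<integral>\<^sup>+(x, y). ennreal (dist x y) \<partial>\<sigma>)"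

subsection \<open>Variation measures\<close>

text \<open>
  For non-decreasing \<open>f\<close> on the unit interval, \<open>interval_measure\<close> is applied to the
  right-continuous version of the constant extension of \<open>f\<close>; lemma \<open>emeasure_LS_measure\<close> below
  gives the value \<open>f(b-) - f(a+)\<close> on \<open>(a,b)\<close>. The mass of the end point 0 is \<open>f(0+) - f(0)\<close>
  and that of 1 is \<open>f(1) - f(1-)\<close>; both vanish for \<open>f(t) = ess_Var Y d u {0<..<t}\<close> when \<open>u\<close>
  is a BV-curve.
\<close>

definition LS_measure :: "(real \<Rightarrow> real) \<Rightarrow> real measure"
  where "LS_measure f = restrict_space
    (interval_measure (\<lambda>t. Lim (at_right t) (\<lambda>s. f (max 0 (min 1 s))))) I01"

definition variation_measure ::
    "'b set \<Rightarrow> ('b \<Rightarrow> 'b \<Rightarrow> real) \<Rightarrow> (real \<Rightarrow> 'b) \<Rightarrow> real measure"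
  where "variation_measure Y d u = LS_measure (\<lambda>t. enn2real (ess_Var Y d u {0<..<t}))"

definition mean_variation_measure ::
    "'b set \<Rightarrow> ('b \<Rightarrow> 'b \<Rightarrow> real) \<Rightarrow> (real \<Rightarrow> 'b) measure \<Rightarrow> real measure"
  where "mean_variation_measure Y d \<pi> = measure_of I01 (sets (restrict_space borel I01))
    (\<lambda>A. \<integral>\<^sup>+\<gamma>. emeasure (variation_measure Y d \<gamma>) A \<partial>\<pi>)"

text \<open>
  The curve of marginals. The variation of a curve on \<open>(0,1)\<close> does not control its jump at
  time 1, so the marginal at time 1 can fail to lie in \<open>P1\<close>: take \<open>\<gamma> = c * indicator {1}\<close> on the
  real line with a random \<open>c\<close> that is not integrable. Its value at 1 is therefore only constrained
  where it lies in \<open>P1\<close>; neither \<open>ess_Var\<close> nor \<open>variation_measure\<close> depends on it.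
\<close>

definition marginals :: "(real \<Rightarrow> 'a::polish_space) measure \<Rightarrow> real \<Rightarrow> 'a measure"
  where "marginals \<pi> = (\<lambda>t\<in>I01. distr \<pi> borel (\<lambda>\<gamma>. \<gamma> t))"

subsection \<open>Consistency of the definitions\<close>

lemma borel_metric_UNIV_dist: "sets (borel_metric UNIV dist) = sets (borel :: 'a::metric_space measure)"
  by (simp add: borel_metric_def borel_def)

lemma space_variation_measure: "space (variation_measure Y d u) = I01"
  by (simp add: variation_measure_def LS_measure_def space_restrict_space)

lemma sets_variation_measure: "sets (variation_measure Y d u) = sets (restrict_space borel I01)"
  by (simp add: variation_measure_def LS_measure_def sets_restrict_space)

lemma sets_mean_variation_measure:
  "sets (mean_variation_measure Y d \<pi>) = sets (restrict_space borel I01)"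
proof -
  have "sigma_algebra I01 (sets (restrict_space borel I01))"
    using sets.sigma_algebra_axioms[of "restrict_space borel I01"] by (simp add: space_restrict_space)
  then show ?thesis
    unfolding mean_variation_measure_def
    by (simp add: sigma_algebra.sets_measure_of_eq)
qed

lemma mono_tendsto_at_right:
  fixes g :: "real \<Rightarrow> real"
  assumes monog: "mono g"
  shows "(g \<longlongrightarrow> (INF s\<in>{t<..}. g s)) (at_right t)"
proof (rule order_tendstoI)
  have bdd: "bdd_below (g ` {t<..})"
    using monog by (intro bdd_belowI[of _ "g t"]) (auto simp: mono_def)
  show "eventually (\<lambda>s. c < g s) (at_right t)" if "c < (INF s\<in>{t<..}. g s)" for c
    using eventually_at_right_less[of t]
    by eventually_elim (use that bdd in \<open>auto intro: less_le_trans cINF_lower\<close>)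
  show "eventually (\<lambda>s. g s < c) (at_right t)" if c: "(INF s\<in>{t<..}. g s) < c" for c
  proof -
    obtain s where s: "t < s" "g s < c"
      using c cINF_less_iff[OF _ bdd] by auto
    have "eventually (\<lambda>x. x \<in> {t<..<s}) (at_right t)"
      using s(1) by (rule eventually_at_right_real)
    then show ?thesis
      by eventually_elim (use s(2) monog in \<open>auto simp: mono_def intro: le_less_trans[of _ "g s"]\<close>)
  qed
qed

lemma emeasure_LS_measure:
  assumes mono: "mono_on I01 f" and ab: "0 \<le> a" "a < b" "b \<le> 1"
  shows "emeasure (LS_measure f) {a<..<b} = ennreal (Lim (at_left b) f - Lim (at_right a) f)"
proof -
  define g where "g = (\<lambda>s::real. f (max 0 (min 1 s)))"
  define F where "F = (\<lambda>t. Lim (at_right t) g)"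
  have monog: "mono g"
    unfolding g_def by (intro monoI mono_onD[OF mono]) auto
  have gF: "(g \<longlongrightarrow> F t) (at_right t)" for t
    using mono_tendsto_at_right[OF monog, of t] unfolding F_def by (simp add: tendsto_Lim)
  have g_le_F: "g t \<le> F t" for t
  proof (rule tendsto_lowerbound[OF gF])
    show "eventually (\<lambda>x. g t \<le> g x) (at_right t)"
      using eventually_at_right_less[of t] by eventually_elim (use monog in \<open>auto simp: mono_def\<close>)
  qed simp
  have F_le_g: "F t \<le> g s" if "t < s" for s t
  proof (rule tendsto_upperbound[OF gF])
    show "eventually (\<lambda>x. g x \<le> g s) (at_right t)"
      using eventually_at_right_real[OF that] by eventually_elim (use monog in \<open>auto simp: mono_def\<close>)
  qed simp
  have monoF: "F x \<le> F y" if "x \<le> y" for x y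
    using that F_le_g[of x y] g_le_F[of y] by (cases "x = y") auto
  have contF: "continuous (at_right t) F" for t
    unfolding continuous_within
  proof (rule tendsto_sandwich)
    show "eventually (\<lambda>s. F t \<le> F s) (at_right t)"
      using eventually_at_right_less[of t] by eventually_elim (auto intro: monoF)
    show "eventually (\<lambda>s. F s \<le> g (2 * s - t)) (at_right t)"
      using eventually_at_right_less[of t] by eventually_elim (auto intro: F_le_g)
    show "((\<lambda>s. g (2 * s - t)) \<longlongrightarrow> F t) (at_right t)"
    proof (rule filterlim_compose[OF gF])
      have "((\<lambda>s. 2 * s - t) \<longlongrightarrow> t) (at_right t)"
        by (auto intro!: tendsto_eq_intros)
      moreover have "eventually (\<lambda>s. 2 * s - t \<in> {t<..} \<and> 2 * s - t \<noteq> t) (at_right t)"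
        using eventually_at_right_less[of t] by eventually_elim auto
      ultimately show "filterlim (\<lambda>s. 2 * s - t) (at_right t) (at_right t)"
        by (simp add: filterlim_at)
    qed
  qed auto
  define X where "X = (\<lambda>n::nat. b - (b - a) * inverse (real (Suc n)))"
  have X: "a \<le> X n" "X n < b" "X n \<le> X (Suc n)" for n
    using ab by (auto simp: X_def field_simps intro!: mult_right_mono)
  have Xlim: "X \<longlonglongrightarrow> b"
    using tendsto_diff[OF tendsto_const[of b] tendsto_mult[OF tendsto_const[of "b - a"] LIMSEQ_inverse_real_of_nat]]
    unfolding X_def by simp
  have Xat: "filterlim X (at_left b) sequentially"
    using Xlim X(2) by (simp add: filterlim_at less_imp_neq)
  have "\<exists>l. (g \<longlongrightarrow> l) (at_left b)"
  proof -
    have "mono (\<lambda>s. - g (- s))" using monog by (auto simp: mono_def)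
    note mono_tendsto_at_right[OF this, of "- b"]
    from tendsto_minus[OF this] show ?thesis
      by (auto simp: at_left_minus[of b] filterlim_filtermap)
  qed
  then obtain l where l: "(g \<longlongrightarrow> l) (at_left b)" by blast
  have FX: "(\<lambda>n. F (X n)) \<longlonglongrightarrow> l"
  proof (rule tendsto_sandwich)
    show "eventually (\<lambda>n. g (X n) \<le> F (X n)) sequentially" by (simp add: g_le_F)
    show "eventually (\<lambda>n. F (X n) \<le> g ((X n + b) / 2)) sequentially"
      using X(2) by (intro always_eventually allI F_le_g) (simp add: field_simps)
    show "(\<lambda>n. g (X n)) \<longlonglongrightarrow> l" by (rule filterlim_compose[OF l Xat])
    have "(\<lambda>n. (X n + b) / 2) \<longlonglongrightarrow> b" using Xlim by (auto intro!: tendsto_eq_intros)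
    then have "filterlim (\<lambda>n. (X n + b) / 2) (at_left b) sequentially"
      using X(2) by (auto simp: filterlim_at field_simps less_imp_neq)
    then show "(\<lambda>n. g ((X n + b) / 2)) \<longlonglongrightarrow> l" by (rule filterlim_compose[OF l])
  qed
  have cov: "(\<Union>n. {a<..X n}) = {a<..<b}"
  proof (intro equalityI subsetI)
    fix x assume x: "x \<in> {a<..<b}"
    then have "eventually (\<lambda>n. x < X n) sequentially"
      using order_tendstoD(1)[OF Xlim] by auto
    then obtain n where "x < X n" by (auto simp: eventually_sequentially)
    with x show "x \<in> (\<Union>n. {a<..X n})" by (auto intro!: exI[of _ n])
  qed (use X(2) in \<open>auto intro: le_less_trans\<close>)
  have "incseq X" using X(3) by (rule incseq_SucI)
  then have "incseq (\<lambda>n. {a<..X n})"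
    by (fastforce simp: incseq_def intro: order_trans)
  then have "(\<lambda>n. emeasure (interval_measure F) {a<..X n}) \<longlonglongrightarrow> emeasure (interval_measure F) {a<..<b}"
    using Lim_emeasure_incseq[of "\<lambda>n. {a<..X n}" "interval_measure F"] by (simp add: cov image_subset_iff)
  moreover have "(\<lambda>n. emeasure (interval_measure F) {a<..X n}) \<longlonglongrightarrow> ennreal (l - F a)"
    using X(1) by (simp add: emeasure_interval_measure_Ioc monoF contF)
      (intro tendsto_ennrealI tendsto_diff FX tendsto_const)
  ultimately have "emeasure (interval_measure F) {a<..<b} = ennreal (l - F a)"
    by (rule LIMSEQ_unique)
  moreover have "l = Lim (at_left b) f"
  proof -
    have "eventually (\<lambda>s. g s = f s) (at_left b)"
      using eventually_at_left_real[OF ab(2)] by eventually_elim (use ab in \<open>auto simp: g_def\<close>)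
    with l show ?thesis by (auto simp: tendsto_cong intro!: tendsto_Lim[symmetric])
  qed
  moreover have "F a = Lim (at_right a) f"
  proof -
    have "eventually (\<lambda>s. g s = f s) (at_right a)"
      using eventually_at_right_real[OF ab(2)] by eventually_elim (use ab in \<open>auto simp: g_def\<close>)
    with gF[of a] show ?thesis by (auto simp: tendsto_cong intro!: tendsto_Lim[symmetric])
  qed
  moreover have "emeasure (LS_measure f) {a<..<b} = emeasure (interval_measure F) {a<..<b}"
    unfolding LS_measure_def F_def g_def
    by (subst emeasure_restrict_space) (use ab in auto)
  ultimately show ?thesis by simp
qed

end

theory Submission
  imports Defs
begin

text \<open>
  Along a cadlag BV curve \<open>\<gamma>\<close> one has \<open>d(\<gamma> s, \<gamma> t) \<le> |D\<gamma>|((s,t])\<close> for \<open>s < t < 1\<close>. Coupling \<open>\<mu>\<^sub>s\<close> and \<open>\<mu>\<^sub>t\<close> by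
  the joint law of \<open>(\<gamma> s, \<gamma> t)\<close> and integrating gives \<open>W1(\<mu>\<^sub>s, \<mu>\<^sub>t) \<le> \<nu>((s,t])\<close>, where \<open>\<nu>\<close> is the mean of
  the variation measures; so \<open>t \<mapsto> \<nu>([0,t])\<close> controls the increments of \<open>\<mu>\<close>, from which regularity,
  bounded variation and \<open>|D\<mu>| \<le> \<nu>\<close> follow. The left limit of \<open>\<mu>\<close> at \<open>t\<close> is the law of \<open>\<gamma>(t-)\<close>, so
  completeness of the Wasserstein space is not needed.
\<close>

section \<open>The Wasserstein metric\<close>

text \<open>The passage from increments to measures is shaped by a mismatch: \<open>|D\<mu>|\<close>
  comes from the essential variation on the open intervals \<open>{0<..<t}\<close>, which do not see
  a jump at \<open>t\<close>, while increments are controlled by \<open>\<nu>\<close> on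
  \<open>{s<..t}\<close>. Estimates are therefore made at slightly later times and passed to limits
  from the right, which explains the recurring \<open>t < 1\<close>. The essential variation is
  moreover an infimum over competitors; in place of additivity there is an explicit competitor that
  follows a given one and then switches to \<open>\<mu>\<close>. Three points about the definitions
  carry the rest. The triangle inequality for \<open>W1\<close> comes from gluing couplings up to an
  error. The mean variation measure is built by \<open>measure_of\<close>, so it has its prescribed
  values only once countable additivity, and hence measurability of \<open>|D\<gamma>|(A)\<close> in
  \<open>\<gamma>\<close>, is known. Finally, evaluations are in general discontinuous for the
  Skorokhod metric, so their measurability is derived from open conditions on whole time
  intervals.\<close>

definition transport_cost :: "'a::polish_space measure \<Rightarrow> 'a measure \<Rightarrow> ennreal"
  where "transport_cost \<mu> \<nu> = (\<Sqinter>\<sigma> \<in> couplings \<mu> \<nu>. \<integral>\<^sup>+(x, y). ennreal (dist x y) \<partial>\<sigma>)"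

text \<open>\<open>enn2real\<close> sends an infinite cost to 0, so symmetry and the triangle
  inequality are proved for \<open>transport_cost\<close> in \<open>ennreal\<close>, for arbitrary
  measures. On \<open>P1\<close> the cost is finite and \<open>ennreal_W1\<close> leads back to
  \<open>W1\<close>.\<close>

lemma W1_eq_enn2real: "W1 \<mu> \<nu> = enn2real (transport_cost \<mu> \<nu>)"
  by (simp add: W1_def transport_cost_def)

lemma couplingsD:
  assumes "\<sigma> \<in> couplings \<mu> \<nu>"
  shows "prob_space \<sigma>" "sets \<sigma> = sets (borel \<Otimes>\<^sub>M borel)" "space \<sigma> = UNIV"
    "distr \<sigma> borel fst = \<mu>" "distr \<sigma> borel snd = \<nu>"
proof -
  show *: "prob_space \<sigma>" "sets \<sigma> = sets (borel \<Otimes>\<^sub>M borel)" "distr \<sigma> borel fst = \<mu>" "distr \<sigma> borel snd = \<nu>"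
    using assms by (auto simp: couplings_def space_prob_algebra)
  show "space \<sigma> = UNIV"
    using sets_eq_imp_space_eq[OF *(2)] by (simp add: space_pair_measure)
qed

lemma couplings_measurable:
  assumes "\<sigma> \<in> couplings \<mu> \<nu>" "f \<in> measurable (borel \<Otimes>\<^sub>M borel) N"
  shows "f \<in> measurable \<sigma> N"
  using assms(2) measurable_cong_sets[OF couplingsD(2)[OF assms(1)] refl] by blast

lemma dist_pair_measurable [measurable]:
  "(\<lambda>p. ennreal (dist (fst p) (snd p :: 'a::polish_space))) \<in> borel_measurable (borel \<Otimes>\<^sub>M borel)"
  by (measurable)

lemma coupling_marginal_integral:
  assumes "\<sigma> \<in> couplings \<mu> \<nu>" "f \<in> borel_measurable borel"
  shows "(\<integral>\<^sup>+p. f (fst p) \<partial>\<sigma>) = (\<integral>\<^sup>+x. f x \<partial>\<mu>)" "(\<integral>\<^sup>+p. f (snd p) \<partial>\<sigma>) = (\<integral>\<^sup>+x. f x \<partial>\<nu>)"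
proof -
  have m: "fst \<in> measurable \<sigma> borel" "snd \<in> measurable \<sigma> borel"
    by (rule couplings_measurable[OF assms(1)], measurable)+
  show "(\<integral>\<^sup>+p. f (fst p) \<partial>\<sigma>) = (\<integral>\<^sup>+x. f x \<partial>\<mu>)"
    by (subst couplingsD(4)[OF assms(1), symmetric]) (simp add: nn_integral_distr m assms(2))
  show "(\<integral>\<^sup>+p. f (snd p) \<partial>\<sigma>) = (\<integral>\<^sup>+x. f x \<partial>\<nu>)"
    by (subst couplingsD(5)[OF assms(1), symmetric]) (simp add: nn_integral_distr m assms(2))
qed

lemma coupling_swap:
  assumes "\<sigma> \<in> couplings \<mu> \<nu>"
  shows "distr \<sigma> (borel \<Otimes>\<^sub>M borel) prod.swap \<in> couplings \<nu> \<mu>"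
    and "(\<integral>\<^sup>+(x, y). ennreal (dist x y) \<partial>distr \<sigma> (borel \<Otimes>\<^sub>M borel) prod.swap)
      = (\<integral>\<^sup>+(x, y). ennreal (dist x y) \<partial>\<sigma>)"
proof -
  have m: "prod.swap \<in> measurable \<sigma> (borel \<Otimes>\<^sub>M borel)"
    by (rule couplings_measurable[OF assms]) (simp add: prod.swap_def[abs_def])
  note c = couplingsD[OF assms]
  show "distr \<sigma> (borel \<Otimes>\<^sub>M borel) prod.swap \<in> couplings \<nu> \<mu>"
    using c m by (auto simp: couplings_def space_prob_algebra prob_space.prob_space_distr distr_distr comp_def)
  show "(\<integral>\<^sup>+(x, y). ennreal (dist x y) \<partial>distr \<sigma> (borel \<Otimes>\<^sub>M borel) prod.swap)
      = (\<integral>\<^sup>+(x, y). ennreal (dist x y) \<partial>\<sigma>)"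
    using m by (subst nn_integral_distr) (auto simp: case_prod_unfold dist_commute)
qed

lemma transport_cost_commute: "transport_cost \<mu> \<nu> = transport_cost \<nu> \<mu>"
proof -
  have "transport_cost \<mu> \<nu> \<le> transport_cost \<nu> \<mu>" for \<mu> \<nu> :: "'a measure"
    unfolding transport_cost_def
  proof (rule INF_greatest)
    fix \<sigma> assume s: "\<sigma> \<in> couplings \<nu> \<mu>"
    show "(\<Sqinter>\<sigma>\<in>couplings \<mu> \<nu>. \<integral>\<^sup>+ (x, y). ennreal (dist x y) \<partial>\<sigma>) \<le> (\<integral>\<^sup>+ (x, y). ennreal (dist x y) \<partial>\<sigma>)"
      using INF_lower[OF coupling_swap(1)[OF s]] coupling_swap(2)[OF s] by metis
  qed
  then show ?thesis by (simp add: antisym)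
qed

lemma P1D:
  assumes "\<mu> \<in> P1"
  shows "prob_space \<mu>" "sets \<mu> = sets borel" "space \<mu> = UNIV"
    "\<exists>x0. (\<integral>\<^sup>+x. ennreal (dist x x0) \<partial>\<mu>) < \<infinity>"
proof -
  show *: "prob_space \<mu>" "sets \<mu> = sets borel"
    using assms by (auto simp: P1_def space_prob_algebra)
  show "space \<mu> = UNIV" using sets_eq_imp_space_eq[OF *(2)] by simp
  obtain x0 where "integrable \<mu> (\<lambda>x. dist x x0)" using assms by (auto simp: P1_def)
  then show "\<exists>x0. (\<integral>\<^sup>+x. ennreal (dist x x0) \<partial>\<mu>) < \<infinity>"
    by (auto simp: integrable_iff_bounded)
qed

lemma P1I:
  assumes "prob_space \<mu>" "sets \<mu> = sets borel" "(\<integral>\<^sup>+x. ennreal (dist x x0) \<partial>\<mu>) < \<infinity>"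
  shows "\<mu> \<in> P1"
proof -
  have "(\<lambda>x. dist x x0) \<in> borel_measurable \<mu>"
    by (subst measurable_cong_sets[OF assms(2) refl]) measurable
  then show ?thesis
    using assms by (auto simp: P1_def space_prob_algebra integrable_iff_bounded)
qed

text \<open>
  Gluing two couplings exactly would require a disintegration with respect to the common marginal.
  For an approximate version it suffices to glue over a countable partition, given by the level
  sets of \<open>n\<close>, of the space into pieces of small diameter.
\<close>

lemma exists_small_partition:
  assumes "e > 0"
  obtains n :: "'a::polish_space \<Rightarrow> nat"
  where "n \<in> measurable borel (count_space UNIV)" "\<And>y y'. n y = n y' \<Longrightarrow> dist y y' \<le> e"
proof -
  obtain D :: "'a set" where D: "countable D" "\<And>X. open X \<Longrightarrow> X \<noteq> {} \<Longrightarrow> \<exists>d\<in>D. d \<in> X"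
    using countable_dense_setE by blast
  have "D \<noteq> {}" using D(2)[of UNIV] by auto
  define x where "x = from_nat_into D"
  have ex: "\<exists>i. dist y (x i) < e / 2" for y
  proof -
    obtain d where "d \<in> D" "d \<in> ball y (e/2)" using D(2)[of "ball y (e/2)"] assms by auto
    then show ?thesis using from_nat_into_surj[OF D(1)] unfolding x_def by (metis mem_ball)
  qed
  \<comment> \<open>The cell of \<open>y\<close> is the index of the first point of the dense
    sequence within \<open>e / 2\<close>; two points of one cell are then \<open>e\<close>-close
    through that point.\<close>
  define n where "n = (\<lambda>y. LEAST i. dist y (x i) < e / 2)"
  have "n \<in> measurable borel (count_space UNIV)"
    unfolding n_def by measurable
  moreover have "dist y y' \<le> e" if "n y = n y'" for y y'
  proof -
    have "dist y (x (n y)) < e/2" "dist y' (x (n y')) < e/2"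
      using LeastI_ex[OF ex] unfolding n_def by auto
    then show ?thesis using that dist_triangle2[of y y' "x (n y)"] by simp
  qed
  ultimately show ?thesis using that by blast
qed

text \<open>Independent pairs \<open>(x, y)\<close> from \<open>\<sigma>\<close> and
  \<open>(y', z)\<close> from \<open>\<tau>\<close> are conditioned on \<open>y\<close> and
  \<open>y'\<close> lying in the same cell, with a weight that restores both pair laws. Passing from
  \<open>y\<close> to \<open>y'\<close> on the way from \<open>x\<close> to \<open>z\<close> costs
  at most \<open>e\<close>.\<close>

lemma coupling_glue:
  fixes \<mu> \<nu> \<rho> :: "'a::polish_space measure"
  assumes s: "\<sigma> \<in> couplings \<mu> \<nu>" and t: "\<tau> \<in> couplings \<nu> \<rho>" and e: "e > 0"
  shows "\<exists>\<kappa>\<in>couplings \<mu> \<rho>. (\<integral>\<^sup>+(x, y). ennreal (dist x y) \<partial>\<kappa>)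
    \<le> (\<integral>\<^sup>+(x, y). ennreal (dist x y) \<partial>\<sigma>) + (\<integral>\<^sup>+(x, y). ennreal (dist x y) \<partial>\<tau>) + ennreal e"
proof -
  obtain n :: "'a \<Rightarrow> nat" where n[measurable]: "n \<in> measurable borel (count_space UNIV)"
    and n_dist: "\<And>y y'. n y = n y' \<Longrightarrow> dist y y' \<le> e"
    using exists_small_partition[OF e] by blast
  note [measurable_cong] = couplingsD(2)[OF s] couplingsD(2)[OF t]
  interpret S: prob_space \<sigma> by (rule couplingsD[OF s])
  interpret T: prob_space \<tau> by (rule couplingsD[OF t])
  interpret ST: pair_prob_space \<sigma> \<tau> ..
  have "prob_space (distr \<tau> borel fst)"
    by (rule T.prob_space_distr) measurable
  then interpret N: prob_space \<nu> using couplingsD(4)[OF t] by simp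
  have setsN[measurable_cong]: "sets \<nu> = sets borel" using couplingsD(4)[OF t] by auto
  define w where "w = (\<lambda>i. emeasure \<nu> (n -` {i} \<inter> space \<nu>))"
  have [measurable]: "w \<in> measurable (count_space UNIV) borel" by simp
  \<comment> \<open>The weight of a matching pair is the reciprocal of the \<open>\<nu>\<close>-mass
    of the common cell, because integrating out the other pair produces exactly that mass. On a cell
    of mass zero it is infinite, which \<open>AES\<close> and \<open>AET\<close> confine to null
    sets.\<close>
  define h :: "('a \<times> 'a) \<times> ('a \<times> 'a) \<Rightarrow> ennreal"
    where "h = (\<lambda>r. if n (snd (fst r)) = n (fst (snd r)) then inverse (w (n (snd (fst r)))) else 0)"
  have h_meas[measurable]: "h \<in> borel_measurable (\<sigma> \<Otimes>\<^sub>M \<tau>)"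
  proof -
    have a[measurable]: "(\<lambda>r. n (snd (fst r))) \<in> measurable (\<sigma> \<Otimes>\<^sub>M \<tau>) (count_space UNIV)" by measurable
    have b[measurable]: "(\<lambda>r. n (fst (snd r))) \<in> measurable (\<sigma> \<Otimes>\<^sub>M \<tau>) (count_space UNIV)" by measurable
    have "(\<lambda>r. inverse (w (n (snd (fst r))))) \<in> borel_measurable (\<sigma> \<Otimes>\<^sub>M \<tau>)"
      using measurable_compose[OF a, of "\<lambda>i. inverse (w i)" borel] by simp
    moreover have "{r \<in> space (\<sigma> \<Otimes>\<^sub>M \<tau>). n (snd (fst r)) = n (fst (snd r))}
      = (\<Union>i. {r \<in> space (\<sigma> \<Otimes>\<^sub>M \<tau>). n (snd (fst r)) = i} \<inter> {r \<in> space (\<sigma> \<Otimes>\<^sub>M \<tau>). n (fst (snd r)) = i})"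
      by auto
    then have "{r \<in> space (\<sigma> \<Otimes>\<^sub>M \<tau>). n (snd (fst r)) = n (fst (snd r))} \<in> sets (\<sigma> \<Otimes>\<^sub>M \<tau>)"
      by simp
    ultimately show ?thesis unfolding h_def by (intro measurable_If) simp_all
  qed
  have w_eq: "(\<integral>\<^sup>+y. (if n y = i then 1 else 0) \<partial>\<nu>) = w i" for i
  proof -
    have "(\<integral>\<^sup>+y. (if n y = i then 1 else 0) \<partial>\<nu>) = (\<integral>\<^sup>+y. indicator (n -` {i} \<inter> space \<nu>) y \<partial>\<nu>)"
      by (intro nn_integral_cong) (auto simp: indicator_def)
    also have "\<dots> = w i"
      unfolding w_def by (intro nn_integral_indicator) measurable
    finally show ?thesis .
  qed
  have w_fin: "w i \<noteq> \<infinity>" for i unfolding w_def by simp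
  have w_pos: "AE y in \<nu>. w (n y) \<noteq> 0"
  proof -
    \<comment> \<open>There are countably many cells, so the union of those of mass zero is
      null.\<close>
    have "AE y in \<nu>. \<forall>i. n y = i \<longrightarrow> w i \<noteq> 0"
    proof (subst AE_all_countable, intro allI)
      fix i show "AE y in \<nu>. n y = i \<longrightarrow> w i \<noteq> 0"
      proof (cases "w i = 0")
        case True
        then have "n -` {i} \<inter> space \<nu> \<in> null_sets \<nu>"
          unfolding w_def by (intro null_setsI) measurable
        then show ?thesis by (rule AE_I') auto
      next
        case False
        then show ?thesis by (intro always_eventually) blast
      qed
    qed
    then show ?thesis by simp
  qed
  have inv: "inverse (w i) * w i = 1" if "w i \<noteq> 0" for i
    using that w_fin[of i] by (metis ennreal_divide_self divide_ennreal_def mult.commute infinity_ennreal_def top.not_eq_extremum)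
  have AES: "AE p in \<sigma>. w (n (snd p)) \<noteq> 0"
  proof -
    have "AE y in distr \<sigma> borel snd. w (n y) \<noteq> 0" unfolding couplingsD(5)[OF s] by (rule w_pos)
    then show ?thesis by (subst (asm) AE_distr_iff) auto
  qed
  have AET: "AE q in \<tau>. w (n (fst q)) \<noteq> 0"
  proof -
    have "AE y in distr \<tau> borel fst. w (n y) \<noteq> 0" unfolding couplingsD(4)[OF t] by (rule w_pos)
    then show ?thesis by (subst (asm) AE_distr_iff) auto
  qed
  have int_T: "(\<integral>\<^sup>+q. h (p, q) \<partial>\<tau>) = inverse (w (n (snd p))) * w (n (snd p))" for p
  proof -
    have "(\<integral>\<^sup>+q. h (p, q) \<partial>\<tau>) = (\<integral>\<^sup>+q. inverse (w (n (snd p))) * (if n (fst q) = n (snd p) then 1 else 0) \<partial>\<tau>)"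
      by (intro nn_integral_cong) (auto simp: h_def)
    also have "\<dots> = inverse (w (n (snd p))) * (\<integral>\<^sup>+q. (if n (fst q) = n (snd p) then 1 else 0) \<partial>\<tau>)"
      by (intro nn_integral_cmult) measurable
    also have "(\<integral>\<^sup>+q. (if n (fst q) = n (snd p) then 1 else 0) \<partial>\<tau>) = w (n (snd p))"
      by (subst coupling_marginal_integral(1)[OF t]) (auto simp: w_eq)
    finally show ?thesis .
  qed
  have int_S: "(\<integral>\<^sup>+p. h (p, q) \<partial>\<sigma>) = inverse (w (n (fst q))) * w (n (fst q))" for q
  proof -
    have "(\<integral>\<^sup>+p. h (p, q) \<partial>\<sigma>) = (\<integral>\<^sup>+p. inverse (w (n (fst q))) * (if n (snd p) = n (fst q) then 1 else 0) \<partial>\<sigma>)"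
      by (intro nn_integral_cong) (auto simp: h_def)
    also have "\<dots> = inverse (w (n (fst q))) * (\<integral>\<^sup>+p. (if n (snd p) = n (fst q) then 1 else 0) \<partial>\<sigma>)"
      by (intro nn_integral_cmult) measurable
    also have "(\<integral>\<^sup>+p. (if n (snd p) = n (fst q) then 1 else 0) \<partial>\<sigma>) = w (n (fst q))"
      by (subst coupling_marginal_integral(2)[OF s]) (auto simp: w_eq)
    finally show ?thesis .
  qed
  have marg_S: "(\<integral>\<^sup>+r. f (fst r) * h r \<partial>(\<sigma> \<Otimes>\<^sub>M \<tau>)) = (\<integral>\<^sup>+p. f p \<partial>\<sigma>)"
    if [measurable]: "f \<in> borel_measurable \<sigma>" for f
  proof -
    have "(\<integral>\<^sup>+r. f (fst r) * h r \<partial>(\<sigma> \<Otimes>\<^sub>M \<tau>)) = (\<integral>\<^sup>+p. \<integral>\<^sup>+q. f p * h (p, q) \<partial>\<tau> \<partial>\<sigma>)"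
      by (subst T.nn_integral_fst[symmetric]) auto
    also have "\<dots> = (\<integral>\<^sup>+p. f p * (\<integral>\<^sup>+q. h (p, q) \<partial>\<tau>) \<partial>\<sigma>)"
      by (intro nn_integral_cong nn_integral_cmult) measurable
    also have "\<dots> = (\<integral>\<^sup>+p. f p \<partial>\<sigma>)"
      by (intro nn_integral_cong_AE, use AES in eventually_elim) (simp add: int_T inv)
    finally show ?thesis .
  qed
  have marg_T: "(\<integral>\<^sup>+r. f (snd r) * h r \<partial>(\<sigma> \<Otimes>\<^sub>M \<tau>)) = (\<integral>\<^sup>+q. f q \<partial>\<tau>)"
    if [measurable]: "f \<in> borel_measurable \<tau>" for f
  proof -
    have "(\<integral>\<^sup>+r. f (snd r) * h r \<partial>(\<sigma> \<Otimes>\<^sub>M \<tau>)) = (\<integral>\<^sup>+q. \<integral>\<^sup>+p. f q * h (p, q) \<partial>\<sigma> \<partial>\<tau>)"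
      by (subst ST.nn_integral_snd[symmetric]) auto
    also have "\<dots> = (\<integral>\<^sup>+q. f q * (\<integral>\<^sup>+p. h (p, q) \<partial>\<sigma>) \<partial>\<tau>)"
      by (intro nn_integral_cong nn_integral_cmult) measurable
    also have "\<dots> = (\<integral>\<^sup>+q. f q \<partial>\<tau>)"
      by (intro nn_integral_cong_AE, use AET in eventually_elim) (simp add: int_S inv)
    finally show ?thesis .
  qed
  \<comment> \<open>The conditioned law of the two pairs; keeping \<open>x\<close> and
    \<open>z\<close> gives the glued coupling.\<close>
  define \<pi> where "\<pi> = density (\<sigma> \<Otimes>\<^sub>M \<tau>) h"
  define g :: "('a \<times> 'a) \<times> ('a \<times> 'a) \<Rightarrow> 'a \<times> 'a" where "g = (\<lambda>r. (fst (fst r), snd (snd r)))"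
  have g[measurable]: "g \<in> measurable \<pi> (borel \<Otimes>\<^sub>M borel)" unfolding g_def \<pi>_def by measurable
  have sp: "sets \<pi> = sets (\<sigma> \<Otimes>\<^sub>M \<tau>)" "space \<pi> = space (\<sigma> \<Otimes>\<^sub>M \<tau>)" by (simp_all add: \<pi>_def)
  have pi_int: "(\<integral>\<^sup>+r. f r \<partial>\<pi>) = (\<integral>\<^sup>+r. f r * h r \<partial>(\<sigma> \<Otimes>\<^sub>M \<tau>))"
    if "f \<in> borel_measurable (\<sigma> \<Otimes>\<^sub>M \<tau>)" for f
    unfolding \<pi>_def using that by (subst nn_integral_density) (auto simp: mult.commute)
  have dist_fst: "distr \<pi> borel (\<lambda>r. fst (fst r)) = \<mu>"
  proof (rule measure_eqI)
    show "sets (distr \<pi> borel (\<lambda>r. fst (fst r))) = sets \<mu>" using couplingsD(4)[OF s] by auto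
    fix B :: "'a set" assume "B \<in> sets (distr \<pi> borel (\<lambda>r. fst (fst r)))"
    then have B[measurable]: "B \<in> sets borel" by simp
    have "emeasure (distr \<pi> borel (\<lambda>r. fst (fst r))) B = (\<integral>\<^sup>+x. indicator B x \<partial>distr \<pi> borel (\<lambda>r. fst (fst r)))"
      by simp
    also have "\<dots> = (\<integral>\<^sup>+r. indicator B (fst (fst r)) \<partial>\<pi>)"
      by (subst nn_integral_distr) (auto simp: \<pi>_def)
    also have "\<dots> = (\<integral>\<^sup>+p. indicator B (fst p) \<partial>\<sigma>)"
      using marg_S[of "\<lambda>p. indicator B (fst p)"] by (subst pi_int) auto
    also have "\<dots> = (\<integral>\<^sup>+x. indicator B x \<partial>\<mu>)"
      by (rule coupling_marginal_integral(1)[OF s]) measurable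
    also have "\<dots> = emeasure \<mu> B"
      using couplingsD(4)[OF s] B by (intro nn_integral_indicator) auto
    finally show "emeasure (distr \<pi> borel (\<lambda>r. fst (fst r))) B = emeasure \<mu> B" .
  qed
  have dist_snd: "distr \<pi> borel (\<lambda>r. snd (snd r)) = \<rho>"
  proof (rule measure_eqI)
    show "sets (distr \<pi> borel (\<lambda>r. snd (snd r))) = sets \<rho>" using couplingsD(5)[OF t] by auto
    fix B :: "'a set" assume "B \<in> sets (distr \<pi> borel (\<lambda>r. snd (snd r)))"
    then have B[measurable]: "B \<in> sets borel" by simp
    have "emeasure (distr \<pi> borel (\<lambda>r. snd (snd r))) B = (\<integral>\<^sup>+x. indicator B x \<partial>distr \<pi> borel (\<lambda>r. snd (snd r)))"
      by simp
    also have "\<dots> = (\<integral>\<^sup>+r. indicator B (snd (snd r)) \<partial>\<pi>)"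
      by (subst nn_integral_distr) (auto simp: \<pi>_def)
    also have "\<dots> = (\<integral>\<^sup>+p. indicator B (snd p) \<partial>\<tau>)"
      using marg_T[of "\<lambda>p. indicator B (snd p)"] by (subst pi_int) auto
    also have "\<dots> = (\<integral>\<^sup>+x. indicator B x \<partial>\<rho>)"
      by (rule coupling_marginal_integral(2)[OF t]) measurable
    also have "\<dots> = emeasure \<rho> B"
      using couplingsD(5)[OF t] B by (intro nn_integral_indicator) auto
    finally show "emeasure (distr \<pi> borel (\<lambda>r. snd (snd r))) B = emeasure \<rho> B" .
  qed
  have one: "(\<integral>\<^sup>+r. h r \<partial>(\<sigma> \<Otimes>\<^sub>M \<tau>)) = 1"
    using marg_S[of "\<lambda>_. 1"] S.emeasure_space_1 by simp
  have "prob_space \<pi>"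
    by (rule prob_spaceI) (use one in \<open>simp add: \<pi>_def emeasure_density\<close>)
  then have "prob_space (distr \<pi> (borel \<Otimes>\<^sub>M borel) g)" by (rule prob_space.prob_space_distr) measurable
  then have c: "distr \<pi> (borel \<Otimes>\<^sub>M borel) g \<in> couplings \<mu> \<rho>"
    using dist_fst dist_snd g by (simp add: couplings_def space_prob_algebra distr_distr comp_def g_def)
  have "(\<integral>\<^sup>+(x, y). ennreal (dist x y) \<partial>distr \<pi> (borel \<Otimes>\<^sub>M borel) g)
      \<le> (\<integral>\<^sup>+(x, y). ennreal (dist x y) \<partial>\<sigma>) + (\<integral>\<^sup>+(x, y). ennreal (dist x y) \<partial>\<tau>) + ennreal e"
  proof -
    define d where "d = (\<lambda>p::'a \<times> 'a. ennreal (dist (fst p) (snd p)))"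
    have dS[measurable]: "d \<in> borel_measurable \<sigma>" unfolding d_def by measurable
    have dT[measurable]: "d \<in> borel_measurable \<tau>" unfolding d_def by measurable
    have "(\<integral>\<^sup>+p. d p \<partial>distr \<pi> (borel \<Otimes>\<^sub>M borel) g) = (\<integral>\<^sup>+r. d (g r) \<partial>\<pi>)"
      by (rule nn_integral_distr) (auto simp: d_def)
    also have "\<dots> = (\<integral>\<^sup>+r. d (g r) * h r \<partial>(\<sigma> \<Otimes>\<^sub>M \<tau>))"
      by (rule pi_int) (simp add: d_def g_def)
    also have "\<dots> \<le> (\<integral>\<^sup>+r. (d (fst r) * h r + d (snd r) * h r) + ennreal e * h r \<partial>(\<sigma> \<Otimes>\<^sub>M \<tau>))"
    \<comment> \<open>Where the cells differ \<open>h\<close> vanishes; where they agree, the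
      triangle inequality passes through \<open>y\<close> and \<open>y'\<close>.\<close>
    proof (rule nn_integral_mono)
      fix r :: "('a \<times> 'a) \<times> ('a \<times> 'a)"
      obtain x y y' z where r: "r = ((x, y), (y', z))" by (metis surj_pair)
      show "d (g r) * h r \<le> (d (fst r) * h r + d (snd r) * h r) + ennreal e * h r"
      proof (cases "n y = n y'")
        case True
        have "dist x z \<le> dist x y + dist y' z + e"
          using n_dist[OF True] dist_triangle[of x z y] dist_triangle[of y z y'] by simp
        then have "d (g r) \<le> d (fst r) + d (snd r) + ennreal e"
          using e by (simp add: r d_def g_def ennreal_plus[symmetric] ennreal_leI del: ennreal_plus)
        then have "d (g r) * h r \<le> (d (fst r) + d (snd r) + ennreal e) * h r"
          by (rule mult_right_mono) simp
        then show ?thesis by (simp add: distrib_right)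
      next
        case False
        then have "h r = 0" by (simp only: h_def r fst_conv snd_conv if_False)
        then show ?thesis by (simp only: mult_zero_right zero_le)
      qed
    qed
    also have "\<dots> = (\<integral>\<^sup>+p. d p \<partial>\<sigma>) + (\<integral>\<^sup>+p. d p \<partial>\<tau>) + ennreal e"
    proof -
      have m: "(\<lambda>r. d (fst r) * h r) \<in> borel_measurable (\<sigma> \<Otimes>\<^sub>M \<tau>)"
        "(\<lambda>r. d (snd r) * h r) \<in> borel_measurable (\<sigma> \<Otimes>\<^sub>M \<tau>)"
        "(\<lambda>r. ennreal e * h r) \<in> borel_measurable (\<sigma> \<Otimes>\<^sub>M \<tau>)"
        by (intro borel_measurable_times_ennreal h_meas measurable_compose[OF measurable_fst dS]
            measurable_compose[OF measurable_snd dT] borel_measurable_const)+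
      have "(\<integral>\<^sup>+r. ennreal e * h r \<partial>(\<sigma> \<Otimes>\<^sub>M \<tau>)) = ennreal e"
        by (subst nn_integral_cmult[OF h_meas]) (simp only: one mult_1_right)
      then show ?thesis
        by (simp only: nn_integral_add[OF borel_measurable_add[OF m(1,2)] m(3)]
            nn_integral_add[OF m(1,2)] marg_S[OF dS] marg_T[OF dT])
    qed
    finally show ?thesis by (simp only: d_def case_prod_unfold)
  qed
  then show ?thesis by (rule bexI[OF _ c])
qed

text \<open>Near-optimal couplings are glued; the error \<open>e\<close> is split in three, for the
  two couplings and for the gluing.\<close>

lemma transport_cost_triangle:
  "transport_cost \<mu> \<rho> \<le> transport_cost \<mu> \<nu> + transport_cost \<nu> \<rho>"
proof (cases "transport_cost \<mu> \<nu> + transport_cost \<nu> \<rho> = \<infinity>")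
  case False
  then have fin: "transport_cost \<mu> \<nu> < \<infinity>" "transport_cost \<nu> \<rho> < \<infinity>"
    by (auto simp: less_top)
  show ?thesis
  proof (rule ennreal_le_epsilon)
    fix e :: real assume e: "0 < e"
    have less: "x < x + ennreal (e/3)" if "x < \<infinity>" for x
      using that e by (cases x) (auto simp: ennreal_plus[symmetric] ennreal_less_iff simp del: ennreal_plus)
    have "transport_cost \<mu> \<nu> < transport_cost \<mu> \<nu> + ennreal (e/3)" "transport_cost \<nu> \<rho> < transport_cost \<nu> \<rho> + ennreal (e/3)"
      by (rule less[OF fin(1)], rule less[OF fin(2)])
    then obtain \<sigma> \<tau> where s: "\<sigma> \<in> couplings \<mu> \<nu>" "(\<integral>\<^sup>+(x, y). ennreal (dist x y) \<partial>\<sigma>) < transport_cost \<mu> \<nu> + ennreal (e/3)"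
      and t: "\<tau> \<in> couplings \<nu> \<rho>" "(\<integral>\<^sup>+(x, y). ennreal (dist x y) \<partial>\<tau>) < transport_cost \<nu> \<rho> + ennreal (e/3)"
      unfolding transport_cost_def INF_less_iff by blast
    obtain \<kappa> where k: "\<kappa> \<in> couplings \<mu> \<rho>" "(\<integral>\<^sup>+(x, y). ennreal (dist x y) \<partial>\<kappa>)
      \<le> (\<integral>\<^sup>+(x, y). ennreal (dist x y) \<partial>\<sigma>) + (\<integral>\<^sup>+(x, y). ennreal (dist x y) \<partial>\<tau>) + ennreal (e/3)"
      using coupling_glue[OF s(1) t(1), of "e/3"] e by auto
    have "transport_cost \<mu> \<rho> \<le> (\<integral>\<^sup>+(x, y). ennreal (dist x y) \<partial>\<kappa>)"
      unfolding transport_cost_def by (rule INF_lower[OF k(1)])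
    also note k(2)
    also have "(\<integral>\<^sup>+(x, y). ennreal (dist x y) \<partial>\<sigma>) + (\<integral>\<^sup>+(x, y). ennreal (dist x y) \<partial>\<tau>) + ennreal (e/3)
      \<le> (transport_cost \<mu> \<nu> + ennreal (e/3)) + (transport_cost \<nu> \<rho> + ennreal (e/3)) + ennreal (e/3)"
      using s(2) t(2) by (intro add_mono) auto
    also have "\<dots> = transport_cost \<mu> \<nu> + transport_cost \<nu> \<rho> + (ennreal (e/3) + ennreal (e/3) + ennreal (e/3))"
      by (simp add: ac_simps)
    also have "ennreal (e/3) + ennreal (e/3) + ennreal (e/3) = ennreal e"
      using e by (simp add: ennreal_plus[symmetric] del: ennreal_plus)
    finally show "transport_cost \<mu> \<rho> \<le> transport_cost \<mu> \<nu> + transport_cost \<nu> \<rho> + ennreal e" .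
  qed
qed (auto simp: top_unique)

text \<open>The product measure is a coupling, and its cost is bounded by the two first moments plus
  the distance of their base points.\<close>

lemma transport_cost_finite:
  assumes "\<mu> \<in> P1" "\<nu> \<in> P1"
  shows "transport_cost \<mu> \<nu> < \<infinity>"
proof -
  note m = P1D[OF assms(1)] and n = P1D[OF assms(2)]
  interpret M: prob_space \<mu> by fact
  interpret N: prob_space \<nu> by fact
  interpret pair_prob_space \<mu> \<nu> ..
  note [measurable_cong] = m(2) n(2)
  obtain x0 y0 where xy: "(\<integral>\<^sup>+x. ennreal (dist x x0) \<partial>\<mu>) < \<infinity>" "(\<integral>\<^sup>+x. ennreal (dist x y0) \<partial>\<nu>) < \<infinity>"
    using m(4) n(4) by blast
  have "sets (\<mu> \<Otimes>\<^sub>M \<nu>) = sets (borel \<Otimes>\<^sub>M borel)"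
    using m(2) n(2) by (rule sets_pair_measure_cong)
  moreover have "distr (\<mu> \<Otimes>\<^sub>M \<nu>) borel fst = \<mu>"
    using N.distr_pair_fst[of \<mu>] distr_cong[of "\<mu> \<Otimes>\<^sub>M \<nu>" "\<mu> \<Otimes>\<^sub>M \<nu>" \<mu> borel fst fst] m(2) by simp
  moreover have "distr (\<mu> \<Otimes>\<^sub>M \<nu>) borel snd = \<nu>"
  proof (rule measure_eqI)
    fix B assume "B \<in> sets (distr (\<mu> \<Otimes>\<^sub>M \<nu>) borel snd)"
    then have B: "B \<in> sets borel" by simp
    have "emeasure (distr (\<mu> \<Otimes>\<^sub>M \<nu>) borel snd) B = emeasure (\<mu> \<Otimes>\<^sub>M \<nu>) (space \<mu> \<times> B)"
      using B by (subst emeasure_distr) (auto simp: space_pair_measure m(3) n(3) intro!: arg_cong2[where f=emeasure])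
    also have "\<dots> = emeasure \<nu> B"
      using B n(2) by (subst N.emeasure_pair_measure_Times) (auto simp: M.emeasure_space_1)
    finally show "emeasure (distr (\<mu> \<Otimes>\<^sub>M \<nu>) borel snd) B = emeasure \<nu> B" .
  qed (simp add: n(2))
  ultimately have c: "\<mu> \<Otimes>\<^sub>M \<nu> \<in> couplings \<mu> \<nu>"
    by (simp add: couplings_def space_prob_algebra prob_space_axioms)
  have "transport_cost \<mu> \<nu> \<le> (\<integral>\<^sup>+p. ennreal (dist (fst p) (snd p)) \<partial>(\<mu> \<Otimes>\<^sub>M \<nu>))"
    unfolding transport_cost_def using INF_lower[OF c] by (simp add: case_prod_unfold)
  also have "\<dots> \<le> (\<integral>\<^sup>+p. (ennreal (dist (fst p) x0) + ennreal (dist (snd p) y0)) + ennreal (dist x0 y0) \<partial>(\<mu> \<Otimes>\<^sub>M \<nu>))"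
  proof (rule nn_integral_mono)
    fix p :: "'a \<times> 'a"
    have "dist (fst p) (snd p) \<le> dist (fst p) x0 + dist (snd p) y0 + dist x0 y0"
      using dist_triangle[of "fst p" "snd p" x0] dist_triangle[of x0 "snd p" y0] by (simp add: dist_commute)
    then show "ennreal (dist (fst p) (snd p)) \<le> (ennreal (dist (fst p) x0) + ennreal (dist (snd p) y0)) + ennreal (dist x0 y0)"
      by (simp add: ennreal_plus[symmetric] ennreal_leI del: ennreal_plus)
  qed
  also have "\<dots> = (\<integral>\<^sup>+p. ennreal (dist (fst p) x0) \<partial>(\<mu> \<Otimes>\<^sub>M \<nu>)) + (\<integral>\<^sup>+p. ennreal (dist (snd p) y0) \<partial>(\<mu> \<Otimes>\<^sub>M \<nu>)) + ennreal (dist x0 y0)"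
    by (simp add: nn_integral_add emeasure_space_1)
  also have "\<dots> < \<infinity>"
    using xy coupling_marginal_integral[OF c, of "\<lambda>x. ennreal (dist x x0)"]
      coupling_marginal_integral[OF c, of "\<lambda>x. ennreal (dist x y0)"] by (simp add: less_top)
  finally show ?thesis .
qed

lemma ennreal_W1:
  assumes "\<mu> \<in> P1" "\<nu> \<in> P1"
  shows "ennreal (W1 \<mu> \<nu>) = transport_cost \<mu> \<nu>"
  using transport_cost_finite[OF assms] by (simp add: W1_eq_enn2real)

lemma transport_cost_self:
  assumes "prob_space \<mu>" "sets \<mu> = sets borel"
  shows "transport_cost \<mu> \<mu> = 0"
proof -
  interpret prob_space \<mu> by fact
  note [measurable_cong] = assms(2)
  let ?D = "distr \<mu> (borel \<Otimes>\<^sub>M borel) (\<lambda>x. (x, x))"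
  have "prob_space ?D" by (rule prob_space_distr) measurable
  then have c: "?D \<in> couplings \<mu> \<mu>"
    using distr_id2[OF assms(2)[symmetric]] by (simp add: couplings_def space_prob_algebra distr_distr comp_def)
  have "(\<integral>\<^sup>+(x, y). ennreal (dist x y) \<partial>?D) = 0"
    by (subst nn_integral_distr) (auto simp: case_prod_unfold)
  moreover have "transport_cost \<mu> \<mu> \<le> (\<integral>\<^sup>+(x, y). ennreal (dist x y) \<partial>?D)"
    unfolding transport_cost_def by (rule INF_lower[OF c])
  ultimately show ?thesis by simp
qed

text \<open>The test function \<open>f\<close> is Lipschitz with constant \<open>Suc k\<close>,
  equals 1 on \<open>C\<close> and vanishes outside the neighbourhood \<open>B k\<close> of radius
  \<open>1 / Suc k\<close>, so a coupling of cost below \<open>e / Suc k\<close> changes its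
  integral by at most \<open>e\<close>. The neighbourhoods decrease to \<open>C\<close> because
  \<open>C\<close> is closed. The case split reflects the convention that \<open>infdist\<close> to
  the empty set is 0.\<close>

lemma transport_cost_eq_0_closed_le:
  assumes pm: "prob_space \<mu>" "sets \<mu> = sets borel" and pn: "prob_space \<nu>" "sets \<nu> = sets borel"
    and 0: "transport_cost \<mu> \<nu> = 0" and C: "closed C"
  shows "emeasure \<mu> C \<le> emeasure \<nu> C"
proof (cases "C = {}")
  case False
  interpret N: prob_space \<nu> by fact
  note [measurable_cong] = pm(2) pn(2)
  have spN: "space \<nu> = UNIV" using sets_eq_imp_space_eq[OF pn(2)] by simp
  define B where "B = (\<lambda>k::nat. {x. infdist x C < inverse (real (Suc k))})"
  have Bopen: "open (B k)" for k
    unfolding B_def by (intro open_Collect_less continuous_intros)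
  have le: "emeasure \<mu> C \<le> emeasure \<nu> (B k)" for k
  proof (rule ennreal_le_epsilon)
    fix e :: real assume e: "0 < e"
    define f where "f = (\<lambda>x. max 0 (1 - real (Suc k) * infdist x C))"
    have [measurable]: "f \<in> borel_measurable borel"
      unfolding f_def by (intro borel_measurable_continuous_onI continuous_intros)
    have "transport_cost \<mu> \<nu> < ennreal (e / Suc k)" using 0 e by simp
    then obtain \<sigma> where s: "\<sigma> \<in> couplings \<mu> \<nu>" "(\<integral>\<^sup>+(x, y). ennreal (dist x y) \<partial>\<sigma>) < ennreal (e / Suc k)"
      unfolding transport_cost_def INF_less_iff by blast
    note [measurable_cong] = couplingsD(2)[OF s(1)]
    have lip: "f x \<le> f y + real (Suc k) * dist x y" for x y
    proof -
      have "infdist y C \<le> infdist x C + dist x y"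
        using infdist_triangle[of y C x] by (simp add: dist_commute)
      then have "real (Suc k) * infdist y C \<le> real (Suc k) * infdist x C + real (Suc k) * dist x y"
        by (metis distrib_left mult_left_mono of_nat_0_le_iff)
      moreover have "0 \<le> real (Suc k) * dist x y" by simp
      ultimately show ?thesis unfolding f_def by linarith
    qed
    have "emeasure \<mu> C = (\<integral>\<^sup>+x. indicator C x \<partial>\<mu>)"
      using C by simp
    also have "\<dots> \<le> (\<integral>\<^sup>+x. ennreal (f x) \<partial>\<mu>)"
      by (intro nn_integral_mono) (auto simp: indicator_def f_def)
    also have "\<dots> = (\<integral>\<^sup>+p. ennreal (f (fst p)) \<partial>\<sigma>)"
      by (rule coupling_marginal_integral(1)[OF s(1), symmetric]) measurable
    also have "\<dots> \<le> (\<integral>\<^sup>+p. ennreal (f (snd p)) + ennreal (real (Suc k)) * ennreal (dist (fst p) (snd p)) \<partial>\<sigma>)"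
    proof (rule nn_integral_mono)
      fix p :: "'a \<times> 'a"
      have "0 \<le> f (snd p)" by (simp add: f_def)
      then show "ennreal (f (fst p)) \<le> ennreal (f (snd p)) + ennreal (real (Suc k)) * ennreal (dist (fst p) (snd p))"
        using lip[of "fst p" "snd p"]
        by (simp add: ennreal_mult'[symmetric] ennreal_plus[symmetric] ennreal_leI del: ennreal_plus of_nat_Suc)
    qed
    also have "\<dots> = (\<integral>\<^sup>+p. ennreal (f (snd p)) \<partial>\<sigma>) + ennreal (real (Suc k)) * (\<integral>\<^sup>+p. ennreal (dist (fst p) (snd p)) \<partial>\<sigma>)"
      by (simp add: nn_integral_add nn_integral_cmult)
    also have "\<dots> \<le> (\<integral>\<^sup>+p. ennreal (f (snd p)) \<partial>\<sigma>) + ennreal (real (Suc k)) * ennreal (e / Suc k)"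
      using s(2) by (intro add_mono mult_left_mono) (auto simp: case_prod_unfold)
    also have "ennreal (real (Suc k)) * ennreal (e / Suc k) = ennreal e"
      using e by (simp add: ennreal_mult'[symmetric] del: of_nat_Suc)
    also have "(\<integral>\<^sup>+p. ennreal (f (snd p)) \<partial>\<sigma>) = (\<integral>\<^sup>+x. ennreal (f x) \<partial>\<nu>)"
      by (rule coupling_marginal_integral(2)[OF s(1)]) measurable
    also have "\<dots> \<le> (\<integral>\<^sup>+x. indicator (B k) x \<partial>\<nu>)"
      by (intro nn_integral_mono)
         (auto simp: indicator_def f_def B_def field_simps not_less ennreal_neg infdist_nonneg simp del: of_nat_Suc)
    also have "\<dots> = emeasure \<nu> (B k)" using Bopen by simp
    finally show "emeasure \<mu> C \<le> emeasure \<nu> (B k) + ennreal e" by (simp add: add_right_mono)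
  qed
  have "decseq B"
  proof (rule decseq_SucI)
    fix k show "B (Suc k) \<subseteq> B k"
    proof
      fix x assume "x \<in> B (Suc k)"
      moreover have "inverse (real (Suc (Suc k))) \<le> inverse (real (Suc k))"
        by (rule le_imp_inverse_le) auto
      ultimately show "x \<in> B k" unfolding B_def mem_Collect_eq by (rule less_le_trans)
    qed
  qed
  then have "(\<lambda>k. emeasure \<nu> (B k)) \<longlonglongrightarrow> emeasure \<nu> (\<Inter>k. B k)"
    using Bopen pn(2) by (intro Lim_emeasure_decseq) auto
  then have "emeasure \<mu> C \<le> emeasure \<nu> (\<Inter>k. B k)"
    by (rule LIMSEQ_le_const) (use le in blast)
  also have "(\<Inter>k. B k) = C"
  proof (intro equalityI subsetI)
    fix x assume x: "x \<in> (\<Inter>k. B k)"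
    have "infdist x C \<le> 0"
    proof (rule LIMSEQ_le_const[OF LIMSEQ_inverse_real_of_nat])
      show "\<exists>N. \<forall>n\<ge>N. infdist x C \<le> inverse (real (Suc n))"
        using x by (auto simp: B_def less_imp_le simp del: of_nat_Suc)
    qed
    then show "x \<in> C" using in_closed_iff_infdist_zero[OF C False] infdist_nonneg[of x C] by auto
  qed (auto simp: B_def simp del: of_nat_Suc)
  finally show ?thesis .
qed simp

text \<open>Symmetry of the cost gives equality on closed sets, which form an intersection-stable
  generator of the Borel sets.\<close>

lemma transport_cost_eq_0_imp_eq:
  assumes pm: "prob_space \<mu>" "sets \<mu> = sets borel" and pn: "prob_space \<nu>" "sets \<nu> = sets borel"
    and 0: "transport_cost \<mu> \<nu> = 0"
  shows "\<mu> = \<nu>"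
proof (rule measure_eqI_generator_eq[where E = "Collect closed" and \<Omega> = UNIV and A = "\<lambda>_. UNIV"])
  interpret M: prob_space \<mu> by fact
  show "emeasure \<mu> X = emeasure \<nu> X" if "X \<in> Collect closed" for X
    using that transport_cost_eq_0_closed_le[OF pm pn 0, of X]
      transport_cost_eq_0_closed_le[OF pn pm, of X] 0 by (simp add: transport_cost_commute antisym)
  show "sets \<mu> = sigma_sets UNIV (Collect closed)" "sets \<nu> = sigma_sets UNIV (Collect closed)"
    unfolding pm pn borel_eq_closed by auto
  show "emeasure \<mu> UNIV \<noteq> \<infinity>" by simp
qed (auto simp: Int_stable_def)

lemma Metric_space_P1: "Metric_space P1 W1"
proof
  fix \<mu> \<nu> \<rho> :: "'a measure"
  show "0 \<le> W1 \<mu> \<nu>" by (simp add: W1_def)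
  show "W1 \<mu> \<nu> = W1 \<nu> \<mu>" by (simp add: W1_eq_enn2real transport_cost_commute)
  assume m: "\<mu> \<in> P1" and n: "\<nu> \<in> P1"
  show "W1 \<mu> \<nu> = 0 \<longleftrightarrow> \<mu> = \<nu>"
  proof
    assume "W1 \<mu> \<nu> = 0"
    then have "transport_cost \<mu> \<nu> = 0" using ennreal_W1[OF m n] by simp
    then show "\<mu> = \<nu>" by (rule transport_cost_eq_0_imp_eq[OF P1D(1,2)[OF m] P1D(1,2)[OF n]])
  qed (simp add: W1_eq_enn2real transport_cost_self P1D[OF n])
  assume r: "\<rho> \<in> P1"
  have "ennreal (W1 \<mu> \<rho>) \<le> ennreal (W1 \<mu> \<nu>) + ennreal (W1 \<nu> \<rho>)"
    using transport_cost_triangle by (simp add: ennreal_W1 m n r)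
  then show "W1 \<mu> \<rho> \<le> W1 \<mu> \<nu> + W1 \<nu> \<rho>"
    by (simp add: W1_def ennreal_plus[symmetric] del: ennreal_plus)
qed

section \<open>The Skorokhod metric and measurability of evaluations\<close>

definition skorokhod_cost ::
    "('b \<Rightarrow> 'b \<Rightarrow> real) \<Rightarrow> (real \<Rightarrow> 'b) \<Rightarrow> (real \<Rightarrow> 'b) \<Rightarrow> (real \<Rightarrow> real) \<Rightarrow> ennreal"
  where "skorokhod_cost d u v l = max (billingsley_norm l) (\<Squnion>t\<in>I01. ennreal (d (u t) (v (l t))))"

lemma d_Sk_eq: "d_Sk d u v = enn2real (\<Sqinter>l\<in>time_changes. skorokhod_cost d u v l)"
  by (simp add: d_Sk_def skorokhod_cost_def)

section \<open>Time changes of the unit interval and the Skorokhod cost\<close>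

lemma time_changesD:
  assumes "l \<in> time_changes"
  shows "strict_mono_on I01 l" "l 0 = 0" "l 1 = 1"
    "\<And>t. t \<in> I01 \<Longrightarrow> l t \<in> I01" "\<And>s t. 0 \<le> s \<Longrightarrow> s < t \<Longrightarrow> t \<le> 1 \<Longrightarrow> l s < l t"
proof -
  obtain g where sm: "strict_mono_on I01 l" and g: "homeomorphism I01 I01 l g"
    using assms by (auto simp: time_changes_def)
  show "strict_mono_on I01 l" by fact
  have im: "l ` I01 = I01" using g by (auto simp: homeomorphism_def)
  show in01: "l t \<in> I01" if "t \<in> I01" for t using im that by blast
  show less: "l s < l t" if "0 \<le> s" "s < t" "t \<le> 1" for s t
    using that sm by (auto simp: strict_mono_on_def)
  \<comment> \<open>Surjectivity and monotonicity force the end points to be fixed: the point mapped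
    to 0 cannot lie to the right of 0.\<close>
  obtain x where "x \<in> I01" "l x = 0" using im by (metis atLeastAtMost_iff imageE order_refl zero_le_one)
  then show "l 0 = 0" using less[of 0 x] in01[of 0] by (cases "x = 0") auto
  obtain x where "x \<in> I01" "l x = 1" using im by (metis atLeastAtMost_iff imageE order_refl zero_le_one)
  then show "l 1 = 1" using less[of x 1] in01[of 1] by (cases "x = 1") auto
qed

lemma time_changes_id: "(\<lambda>t. t) \<in> time_changes"
  by (auto simp: time_changes_def strict_mono_on_def intro!: exI[of _ "\<lambda>t. t"] homeomorphism_ident)

lemma time_changes_comp:
  assumes "l \<in> time_changes" "m \<in> time_changes"
  shows "m \<circ> l \<in> time_changes"
proof -
  obtain g h where "homeomorphism I01 I01 l g" "homeomorphism I01 I01 m h"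
    using assms by (auto simp: time_changes_def)
  then have "homeomorphism I01 I01 (m \<circ> l) (g \<circ> h)" by (rule homeomorphism_compose)
  moreover have "strict_mono_on I01 (m \<circ> l)"
    using time_changesD[OF assms(1)] time_changesD[OF assms(2)] by (auto simp: strict_mono_on_def)
  ultimately show ?thesis by (auto simp: time_changes_def)
qed

lemma time_changes_inverse:
  assumes "l \<in> time_changes"
  obtains g where "g \<in> time_changes" "\<And>t. t \<in> I01 \<Longrightarrow> g (l t) = t" "\<And>t. t \<in> I01 \<Longrightarrow> l (g t) = t"
proof -
  obtain g where g: "homeomorphism I01 I01 l g"
    using assms by (auto simp: time_changes_def)
  have gl: "g (l t) = t" "l (g t) = t" "g t \<in> I01" if "t \<in> I01" for t
    using g that by (auto simp: homeomorphism_def)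
  have "strict_mono_on I01 g"
  proof (rule strict_mono_onI)
    fix r s assume rs: "r \<in> I01" "s \<in> I01" "r < s"
    show "g r < g s"
    proof (rule ccontr)
      assume "\<not> g r < g s"
      then have "l (g s) \<le> l (g r)"
        using time_changesD(5)[OF assms, of "g s" "g r"] gl(3)[OF rs(1)] gl(3)[OF rs(2)]
        by (cases "g s = g r") auto
      then show False using gl(2) rs by auto
    qed
  qed
  with homeomorphism_sym[THEN iffD1, OF g] have "g \<in> time_changes" by (auto simp: time_changes_def)
  then show ?thesis using gl that by blast
qed

lemma billingsley_norm_upper:
  assumes "0 \<le> s" "s < t" "t \<le> 1"
  shows "ennreal \<bar>ln ((l t - l s) / (t - s))\<bar> \<le> billingsley_norm l"
  unfolding billingsley_norm_def using assms by (intro SUP_upper2[of "(s, t)"]) auto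

text \<open>Chord slopes multiply under composition, the outer one taken between \<open>l s\<close>
  and \<open>l t\<close>, so their logarithms add.\<close>

lemma billingsley_norm_comp:
  assumes "l \<in> time_changes" "m \<in> time_changes"
  shows "billingsley_norm (m \<circ> l) \<le> billingsley_norm l + billingsley_norm m"
  unfolding billingsley_norm_def[of "m \<circ> l"]
proof (rule SUP_least, clarsimp)
  fix s t :: real assume st: "0 \<le> s" "s < t" "t \<le> 1"
  note l = time_changesD[OF assms(1)] and m = time_changesD[OF assms(2)]
  have a: "0 \<le> l s" "l s < l t" "l t \<le> 1" using l(4)[of s] l(4)[of t] l(5)[of s t] st by auto
  have b: "m (l s) < m (l t)" using m(5) a by simp
  have "ln ((m (l t) - m (l s)) / (t - s)) = ln ((m (l t) - m (l s)) / (l t - l s) * ((l t - l s) / (t - s)))"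
    using a by simp
  also have "\<dots> = ln ((m (l t) - m (l s)) / (l t - l s)) + ln ((l t - l s) / (t - s))"
    using a b st by (intro ln_mult_pos) (auto intro!: divide_pos_pos)
  finally have "\<bar>ln ((m (l t) - m (l s)) / (t - s))\<bar>
      \<le> \<bar>ln ((l t - l s) / (t - s))\<bar> + \<bar>ln ((m (l t) - m (l s)) / (l t - l s))\<bar>"
    by linarith
  then have "ennreal \<bar>ln ((m (l t) - m (l s)) / (t - s))\<bar>
      \<le> ennreal \<bar>ln ((l t - l s) / (t - s))\<bar> + ennreal \<bar>ln ((m (l t) - m (l s)) / (l t - l s))\<bar>"
    by (simp add: ennreal_plus[symmetric] ennreal_leI del: ennreal_plus)
  also have "\<dots> \<le> billingsley_norm l + billingsley_norm m"
    using st a by (intro add_mono billingsley_norm_upper)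
  finally show "ennreal \<bar>ln ((m (l t) - m (l s)) / (t - s))\<bar> \<le> billingsley_norm l + billingsley_norm m" .
qed

text \<open>A slope of the inverse is the reciprocal of a slope of \<open>l\<close>, which only
  changes the sign of the logarithm.\<close>

lemma billingsley_norm_inverse:
  assumes "l \<in> time_changes" "g \<in> time_changes" "\<And>t. t \<in> I01 \<Longrightarrow> l (g t) = t"
  shows "billingsley_norm g \<le> billingsley_norm l"
  unfolding billingsley_norm_def[of g]
proof (rule SUP_least, clarsimp)
  fix s t :: real assume st: "0 \<le> s" "s < t" "t \<le> 1"
  note g = time_changesD[OF assms(2)]
  have a: "0 \<le> g s" "g s < g t" "g t \<le> 1" using g(4)[of s] g(4)[of t] g(5)[of s t] st by auto
  have eq: "l (g s) = s" "l (g t) = t" using assms(3) st by auto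
  have "ln ((g t - g s) / (t - s)) = - ln ((l (g t) - l (g s)) / (g t - g s))"
    unfolding eq using a st by (subst ln_inverse[symmetric]) (auto simp: inverse_eq_divide)
  then show "ennreal \<bar>ln ((g t - g s) / (t - s))\<bar> \<le> billingsley_norm l"
    using billingsley_norm_upper[OF a, of l] by simp
qed

lemma skorokhod_cost_inverse:
  fixes u v :: "real \<Rightarrow> 'a::metric_space"
  assumes "l \<in> time_changes" "g \<in> time_changes" "\<And>t. t \<in> I01 \<Longrightarrow> l (g t) = t"
  shows "skorokhod_cost dist v u g \<le> skorokhod_cost dist u v l"
  unfolding skorokhod_cost_def
proof (rule max.mono)
  show "billingsley_norm g \<le> billingsley_norm l" by (rule billingsley_norm_inverse[OF assms])
  show "(\<Squnion>t\<in>I01. ennreal (dist (v t) (u (g t)))) \<le> (\<Squnion>t\<in>I01. ennreal (dist (u t) (v (l t))))"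
  proof (rule SUP_least)
    fix t :: real assume t: "t \<in> I01"
    show "ennreal (dist (v t) (u (g t))) \<le> (\<Squnion>t\<in>I01. ennreal (dist (u t) (v (l t))))"
      using time_changesD(4)[OF assms(2) t] assms(3)[OF t]
      by (intro SUP_upper2[of "g t"]) (auto simp: dist_commute)
  qed
qed

lemma d_Sk_commute:
  fixes u v :: "real \<Rightarrow> 'a::metric_space"
  shows "d_Sk dist u v = d_Sk dist v u"
proof -
  have "(\<Sqinter>l\<in>time_changes. skorokhod_cost dist u v l) \<le> (\<Sqinter>l\<in>time_changes. skorokhod_cost dist v u l)"
    for u v :: "real \<Rightarrow> 'a"
  proof (rule INF_greatest)
    fix l assume l: "l \<in> time_changes"
    then obtain g where g: "g \<in> time_changes" "\<And>t. t \<in> I01 \<Longrightarrow> l (g t) = t"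
      by (rule time_changes_inverse) blast
    show "(\<Sqinter>l\<in>time_changes. skorokhod_cost dist u v l) \<le> skorokhod_cost dist v u l"
    proof (rule order_trans)
      show "(\<Sqinter>l\<in>time_changes. skorokhod_cost dist u v l) \<le> skorokhod_cost dist u v g"
        by (rule INF_lower[OF g(1)])
      show "skorokhod_cost dist u v g \<le> skorokhod_cost dist v u l"
        by (rule skorokhod_cost_inverse[OF l g(1)]) (rule g(2))
    qed
  qed
  from antisym[OF this[of u v] this[of v u]] show ?thesis unfolding d_Sk_eq by (rule arg_cong)
qed

lemma skorokhod_cost_comp:
  fixes u v w :: "real \<Rightarrow> 'a::metric_space"
  assumes "l \<in> time_changes" "m \<in> time_changes"
  shows "skorokhod_cost dist u w (m \<circ> l) \<le> skorokhod_cost dist u v l + skorokhod_cost dist v w m"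
proof -
  have "billingsley_norm (m \<circ> l) \<le> skorokhod_cost dist u v l + skorokhod_cost dist v w m"
    by (rule order_trans[OF billingsley_norm_comp[OF assms]])
       (auto simp: skorokhod_cost_def intro!: add_mono)
  moreover have "(\<Squnion>t\<in>I01. ennreal (dist (u t) (w ((m \<circ> l) t)))) \<le> skorokhod_cost dist u v l + skorokhod_cost dist v w m"
  proof (rule SUP_least)
    fix t :: real assume t: "t \<in> I01"
    have "ennreal (dist (u t) (w ((m \<circ> l) t))) \<le> ennreal (dist (u t) (v (l t))) + ennreal (dist (v (l t)) (w (m (l t))))"
      using dist_triangle[of "u t" "w (m (l t))" "v (l t)"]
      by (simp add: ennreal_plus[symmetric] ennreal_leI del: ennreal_plus)
    also have "\<dots> \<le> (\<Squnion>t\<in>I01. ennreal (dist (u t) (v (l t)))) + (\<Squnion>t\<in>I01. ennreal (dist (v t) (w (m t))))"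
      using t time_changesD(4)[OF assms(1) t] by (intro add_mono SUP_upper2[of t] SUP_upper2[of "l t"]) auto
    also have "\<dots> \<le> skorokhod_cost dist u v l + skorokhod_cost dist v w m"
      by (auto simp: skorokhod_cost_def intro!: add_mono)
    finally show "ennreal (dist (u t) (w ((m \<circ> l) t))) \<le> skorokhod_cost dist u v l + skorokhod_cost dist v w m" .
  qed
  ultimately show ?thesis by (simp add: skorokhod_cost_def[of _ u w])
qed

lemma cadlagD:
  assumes "u \<in> cadlag UNIV dist"
  shows "u \<in> extensional I01" "\<And>t. 0 \<le> t \<Longrightarrow> t < 1 \<Longrightarrow> (u \<longlongrightarrow> u t) (at_right t)"
    "\<And>t. 0 < t \<Longrightarrow> t \<le> 1 \<Longrightarrow> \<exists>l. (u \<longlongrightarrow> l) (at_left t)"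
  using assms by (auto simp: cadlag_def PiE_def tendsto_dist_iff[symmetric])

text \<open>A one-sided limit bounds the curve on a one-sided neighbourhood, so each time has a
  neighbourhood with a bound, and compactness leaves finitely many. This makes the infimum in
  \<open>d_Sk\<close> finite, so that \<open>enn2real\<close> loses nothing.\<close>

lemma cadlag_bounded:
  fixes u :: "real \<Rightarrow> 'a::metric_space"
  assumes u: "u \<in> cadlag UNIV dist"
  obtains B where "\<And>t. t \<in> I01 \<Longrightarrow> dist (u t) y \<le> B"
proof -
  have ev: "\<forall>\<^sub>F s in F. dist (u s) y \<le> dist l y + 1" if "(u \<longlongrightarrow> l) F" for l F
  proof -
    have "\<forall>\<^sub>F s in F. dist (u s) l < 1" using that by (auto simp: tendsto_iff)
    then show ?thesis
    proof eventually_elim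
      case (elim s)
      then show ?case using dist_triangle[of "u s" y l] by simp
    qed
  qed
  have loc: "\<exists>B. \<exists>e>0. \<forall>s\<in>I01. dist s t < e \<longrightarrow> dist (u s) y \<le> B" if t: "t \<in> I01" for t
  proof -
    have "\<exists>B. \<exists>e>0. \<forall>s\<in>I01. t < s \<and> dist s t < e \<longrightarrow> dist (u s) y \<le> B"
    proof (cases "t < 1")
      case True
      then have "\<forall>\<^sub>F s in at_right t. dist (u s) y \<le> dist (u t) y + 1"
        using cadlagD(2)[OF u] t by (intro ev) auto
      then obtain e where "e > 0" "\<forall>s\<in>{t<..}. s \<noteq> t \<and> dist s t < e \<longrightarrow> dist (u s) y \<le> dist (u t) y + 1"
        unfolding eventually_at by blast
      then show ?thesis by (intro exI[of _ "dist (u t) y + 1"] exI[of _ e]) auto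
    qed (use t in \<open>auto intro!: exI[of _ 1]\<close>)
    then obtain B1 e1 where 1: "e1 > 0" "\<And>s. s \<in> I01 \<Longrightarrow> t < s \<Longrightarrow> dist s t < e1 \<Longrightarrow> dist (u s) y \<le> B1" by blast
    have "\<exists>B. \<exists>e>0. \<forall>s\<in>I01. s < t \<and> dist s t < e \<longrightarrow> dist (u s) y \<le> B"
    proof (cases "0 < t")
      case True
      then obtain l where "(u \<longlongrightarrow> l) (at_left t)" using cadlagD(3)[OF u] t by auto
      then have "\<forall>\<^sub>F s in at_left t. dist (u s) y \<le> dist l y + 1" by (rule ev)
      then obtain e where "e > 0" "\<forall>s\<in>{..<t}. s \<noteq> t \<and> dist s t < e \<longrightarrow> dist (u s) y \<le> dist l y + 1"
        unfolding eventually_at by blast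
      then show ?thesis by (intro exI[of _ "dist l y + 1"] exI[of _ e]) auto
    qed (use t in \<open>auto intro!: exI[of _ 1]\<close>)
    then obtain B2 e2 where 2: "e2 > 0" "\<And>s. s \<in> I01 \<Longrightarrow> s < t \<Longrightarrow> dist s t < e2 \<Longrightarrow> dist (u s) y \<le> B2" by blast
    have "\<forall>s\<in>I01. dist s t < min e1 e2 \<longrightarrow> dist (u s) y \<le> max (dist (u t) y) (max B1 B2)"
    proof (intro ballI impI)
      fix s assume "s \<in> I01" "dist s t < min e1 e2"
      then show "dist (u s) y \<le> max (dist (u t) y) (max B1 B2)"
        using 1(2)[of s] 2(2)[of s] by (cases s t rule: linorder_cases) auto
    qed
    then show ?thesis using 1(1) 2(1) by (intro exI[of _ "max (dist (u t) y) (max B1 B2)"] exI[of _ "min e1 e2"]) auto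
  qed
  have "\<forall>t\<in>I01. \<exists>p. snd p > 0 \<and> (\<forall>s\<in>I01. dist s t < snd p \<longrightarrow> dist (u s) y \<le> fst p)"
  proof
    fix t :: real assume "t \<in> I01"
    from loc[OF this] obtain B e where "e > 0" "\<forall>s\<in>I01. dist s t < e \<longrightarrow> dist (u s) y \<le> B" by blast
    then show "\<exists>p. snd p > 0 \<and> (\<forall>s\<in>I01. dist s t < snd p \<longrightarrow> dist (u s) y \<le> fst p)"
      by (intro exI[of _ "(B, e)"]) simp
  qed
  from bchoice[OF this] obtain p where
    p: "\<forall>t\<in>I01. snd (p t) > 0 \<and> (\<forall>s\<in>I01. dist s t < snd (p t) \<longrightarrow> dist (u s) y \<le> fst (p t))" ..
  define B e where "B = (\<lambda>t. fst (p t))" and "e = (\<lambda>t. snd (p t))"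
  have Be: "\<And>t. t \<in> I01 \<Longrightarrow> e t > 0"
    "\<And>t s. t \<in> I01 \<Longrightarrow> s \<in> I01 \<Longrightarrow> dist s t < e t \<Longrightarrow> dist (u s) y \<le> B t"
    using p by (auto simp: B_def e_def)
  have "I01 \<subseteq> (\<Union>t\<in>I01. ball t (e t))"
  proof
    fix t :: real assume "t \<in> I01"
    then show "t \<in> (\<Union>t\<in>I01. ball t (e t))" using Be(1)[of t] by (intro UN_I[of t]) simp_all
  qed
  then obtain T where T: "T \<subseteq> I01" "finite T" "I01 \<subseteq> (\<Union>t\<in>T. ball t (e t))"
    by (rule compactE_image[OF compact_Icc open_ball])
  have "dist (u s) y \<le> Max (B ` T)" if s: "s \<in> I01" for s
  proof -
    have "s \<in> (\<Union>t\<in>T. ball t (e t))" using T(3) s by blast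
    then obtain t where "t \<in> T" "dist s t < e t" by (auto simp: dist_commute)
    then have "dist (u s) y \<le> B t" using Be(2) T(1) s by blast
    also have "\<dots> \<le> Max (B ` T)" using \<open>t \<in> T\<close> T(2) by simp
    finally show ?thesis .
  qed
  then show ?thesis using that by blast
qed

text \<open>The identity is an admissible time change: its norm is 0, and two bounded curves are at
  bounded uniform distance.\<close>

lemma skorokhod_cost_finite:
  fixes u v :: "real \<Rightarrow> 'a::metric_space"
  assumes "u \<in> cadlag UNIV dist" "v \<in> cadlag UNIV dist"
  shows "(\<Sqinter>l\<in>time_changes. skorokhod_cost dist u v l) < \<infinity>"
proof -
  obtain B where B: "\<And>t. t \<in> I01 \<Longrightarrow> dist (u t) (u 0) \<le> B" using cadlag_bounded[OF assms(1)] by blast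
  obtain C where C: "\<And>t. t \<in> I01 \<Longrightarrow> dist (v t) (u 0) \<le> C" using cadlag_bounded[OF assms(2)] by blast
  have "billingsley_norm (\<lambda>t. t) \<le> ennreal (B + C)"
    unfolding billingsley_norm_def by (rule SUP_least) auto
  moreover have "(\<Squnion>t\<in>I01. ennreal (dist (u t) (v t))) \<le> ennreal (B + C)"
  proof (intro SUP_least ennreal_leI)
    fix t :: real assume "t \<in> I01"
    then show "dist (u t) (v t) \<le> B + C"
      using B[of t] C[of t] dist_triangle2[of "u t" "v t" "u 0"] by simp
  qed
  ultimately have "skorokhod_cost dist u v (\<lambda>t. t) \<le> ennreal (B + C)"
    by (simp add: skorokhod_cost_def)
  moreover have "(\<Sqinter>l\<in>time_changes. skorokhod_cost dist u v l) \<le> skorokhod_cost dist u v (\<lambda>t. t)"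
    by (rule INF_lower[OF time_changes_id])
  ultimately show ?thesis by (simp add: le_less_trans[OF _ ennreal_less_top[of "B + C"]])
qed

lemma d_Sk_lessE:
  fixes u v :: "real \<Rightarrow> 'a::metric_space"
  assumes "u \<in> cadlag UNIV dist" "v \<in> cadlag UNIV dist" "d_Sk dist u v < r"
  obtains l where "l \<in> time_changes" "billingsley_norm l < ennreal r"
    "\<And>t. t \<in> I01 \<Longrightarrow> dist (u t) (v (l t)) < r"
proof -
  have "0 \<le> d_Sk dist u v" by (simp add: d_Sk_def)
  then have r: "0 < r" using assms(3) by simp
  have "(\<Sqinter>l\<in>time_changes. skorokhod_cost dist u v l) = ennreal (d_Sk dist u v)"
    using skorokhod_cost_finite[OF assms(1,2)] by (simp add: d_Sk_eq)
  also have "\<dots> < ennreal r" using assms(3) r by (simp add: ennreal_less_iff d_Sk_def)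
  finally obtain l where l: "l \<in> time_changes" "skorokhod_cost dist u v l < ennreal r"
    by (auto simp: INF_less_iff)
  have "dist (u t) (v (l t)) < r" if "t \<in> I01" for t
  proof -
    have "ennreal (dist (u t) (v (l t))) \<le> skorokhod_cost dist u v l"
      using that by (auto simp: skorokhod_cost_def intro!: max.coboundedI2 SUP_upper2[of t])
    then have "ennreal (dist (u t) (v (l t))) < ennreal r" using l(2) by (rule le_less_trans)
    then show ?thesis by (simp add: ennreal_less_iff)
  qed
  then show ?thesis using l that by (auto simp: skorokhod_cost_def)
qed

text \<open>The chord of \<open>l\<close> from 0 to \<open>s\<close> has slope
  \<open>l s / s\<close>; a norm below \<open>r\<close> keeps it between \<open>exp (- r)\<close>
  and \<open>exp r\<close>. At \<open>s = 0\<close> the value is fixed.\<close>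

lemma time_change_close:
  assumes s: "a < s" "s < b" "0 \<le> s" "s \<le> 1"
  obtains r where "r > 0" "\<And>l. l \<in> time_changes \<Longrightarrow> billingsley_norm l < ennreal r \<Longrightarrow> l s \<in> {a<..<b}"
proof (cases "s = 0")
  case True
  have "l s \<in> {a<..<b}" if "l \<in> time_changes" for l
    using time_changesD(2)[OF that] True s by simp
  then show ?thesis by (intro that[of 1]) auto
next
  case False
  have "((\<lambda>e. s * exp e) \<longlongrightarrow> s) (at_right 0)" "((\<lambda>e. s * exp (- e)) \<longlongrightarrow> s) (at_right 0)"
    by (auto intro!: tendsto_eq_intros)
  then have "\<forall>\<^sub>F e in at_right 0. s * exp e < b" "\<forall>\<^sub>F e in at_right 0. a < s * exp (- e)"
    using s by (auto dest: order_tendstoD)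
  moreover have "\<forall>\<^sub>F e::real in at_right 0. 0 < e" by (rule eventually_at_right_less)
  ultimately have "\<forall>\<^sub>F e in at_right 0. 0 < e \<and> s * exp e < b \<and> a < s * exp (- e)"
    by eventually_elim auto
  then obtain e where e: "0 < e" "s * exp e < b" "a < s * exp (- e)"
    using eventually_happens'[OF trivial_limit_at_right_real] by blast
  have "l s \<in> {a<..<b}" if l: "l \<in> time_changes" "billingsley_norm l < ennreal e" for l
  proof -
    have p: "0 < l s" using time_changesD(2)[OF l(1)] time_changesD(5)[OF l(1), of 0 s] s False by auto
    have "ennreal \<bar>ln ((l s - l 0) / (s - 0))\<bar> < ennreal e"
      using s False by (intro le_less_trans[OF billingsley_norm_upper l(2)]) auto
    then have "\<bar>ln (l s / s)\<bar> < e" using time_changesD(2)[OF l(1)] by (simp add: ennreal_less_iff)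
    then have "ln (l s / s) < e" "- e < ln (l s / s)" by linarith+
    then have "exp (ln (l s / s)) < exp e" "exp (- e) < exp (ln (l s / s))" by simp_all
    moreover have "exp (ln (l s / s)) = l s / s"
      using p s False by (intro exp_ln divide_pos_pos) auto
    ultimately have "l s / s < exp e" "exp (- e) < l s / s" by simp_all
    then have "l s < s * exp e" "s * exp (- e) < l s"
      using s False by (auto simp: field_simps)
    then show ?thesis using e by auto
  qed
  then show ?thesis using e(1) that by blast
qed

lemma Metric_space_cadlag:
  "Metric_space (cadlag UNIV dist) (d_Sk (dist :: 'a::metric_space \<Rightarrow> 'a \<Rightarrow> real))"
proof
  fix u v w :: "real \<Rightarrow> 'a"
  show "0 \<le> d_Sk dist u v" by (simp add: d_Sk_def)
  show "d_Sk dist u v = d_Sk dist v u" by (rule d_Sk_commute)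
  assume u: "u \<in> cadlag UNIV dist" and v: "v \<in> cadlag UNIV dist"
  show "d_Sk dist u v = 0 \<longleftrightarrow> u = v"
  proof
    assume 0: "d_Sk dist u v = 0"
    have "u t = v t" if t: "t \<in> I01" for t
    proof (cases "t = 1")
      case True
      \<comment> \<open>Time changes fix 1, so the two values at 1 are compared directly.\<close>
      have "dist (u 1) (v 1) < r" if "r > 0" for r
      proof -
        have "d_Sk dist u v < r" using 0 that by simp
        then obtain l where "l \<in> time_changes" "\<And>t. t \<in> I01 \<Longrightarrow> dist (u t) (v (l t)) < r"
          by (rule d_Sk_lessE[OF u v]) blast
        then show ?thesis using time_changesD(3)[of l] by (metis atLeastAtMost_iff order_refl zero_le_one)
      qed
      then show ?thesis using True by (metis dist_le_zero_iff not_less order_less_irrefl)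
    next
      case False
      then have t': "0 \<le> t" "t < 1" using t by auto
      \<comment> \<open>At \<open>t\<close> itself a time change may move to the left, where
        \<open>v\<close> can be far from \<open>v t\<close>. The comparison is made at a later time
        \<open>s\<close> inside \<open>(t, b)\<close>, with room on both sides for
        \<open>l s\<close>. The three errors arise at \<open>s\<close>, between the two curves, and
        at \<open>l s\<close>.\<close>
      have "dist (u t) (v t) < 3 * r" if r: "r > 0" for r
      proof -
        have "\<forall>\<^sub>F s in at_right t. dist (u s) (u t) < r" "\<forall>\<^sub>F s in at_right t. dist (v s) (v t) < r"
          using cadlagD(2)[OF u t'] cadlagD(2)[OF v t'] r by (auto simp: tendsto_iff)
        moreover have "\<forall>\<^sub>F s in at_right t. s \<in> {t<..<1}" using t' by (intro eventually_at_right_real)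
        ultimately have "\<forall>\<^sub>F s in at_right t. dist (u s) (u t) < r \<and> dist (v s) (v t) < r \<and> s < 1"
          by eventually_elim auto
        then obtain b where b: "b > t" "\<And>s. t < s \<Longrightarrow> s < b \<Longrightarrow> dist (u s) (u t) < r \<and> dist (v s) (v t) < r \<and> s < 1"
          unfolding eventually_at_right_field by blast
        define s where "s = (t + b) / 2"
        have s: "t < s" "s < b" "s < 1" using b(1) b(2)[of s] by (auto simp: s_def)
        obtain r' where r': "r' > 0" "\<And>l. l \<in> time_changes \<Longrightarrow> billingsley_norm l < ennreal r' \<Longrightarrow> l s \<in> {t<..<b}"
          using time_change_close[OF s(1,2)] s t' by (metis less_imp_le order.trans)
        have "d_Sk dist u v < min r r'" using 0 r r' by simp
        then obtain l where l: "l \<in> time_changes" "billingsley_norm l < ennreal (min r r')"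
          "\<And>t. t \<in> I01 \<Longrightarrow> dist (u t) (v (l t)) < min r r'"
          by (rule d_Sk_lessE[OF u v]) blast
        have "billingsley_norm l < ennreal r'"
          using l(2) by (rule less_le_trans) (simp add: ennreal_leI)
        then have "l s \<in> {t<..<b}" using r'(2) l(1) by blast
        moreover have "dist (u s) (v (l s)) < r" using l(3)[of s] s t' by auto
        ultimately show ?thesis
          using b(2)[of s] b(2)[of "l s"] s dist_triangle[of "u t" "v t" "u s"]
            dist_triangle[of "u s" "v t" "v (l s)"] by (auto simp: dist_commute)
      qed
      from this[of "dist (u t) (v t) / 3"] show ?thesis by (cases "u t = v t") auto
    qed
    then show "u = v"
      using cadlagD(1)[OF u] cadlagD(1)[OF v] by (intro extensionalityI[of u I01 v]) auto
  next
    assume "u = v"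
    then have "skorokhod_cost dist u v (\<lambda>t. t) = 0"
      by (auto simp: skorokhod_cost_def billingsley_norm_def SUP_eq_iff bot_ennreal intro!: antisym SUP_least)
    then have "(\<Sqinter>l\<in>time_changes. skorokhod_cost dist u v l) = 0"
      using INF_lower[OF time_changes_id, of "skorokhod_cost dist u v"] by simp
    then show "d_Sk dist u v = 0" by (simp add: d_Sk_eq)
  qed
  assume w: "w \<in> cadlag UNIV dist"
  have ge0: "0 \<le> d_Sk dist u v" "0 \<le> d_Sk dist v w" by (simp_all add: d_Sk_def)
  show "d_Sk dist u w \<le> d_Sk dist u v + d_Sk dist v w"
  proof (rule field_le_epsilon)
    fix e :: real assume e: "0 < e"
    let ?I = "\<lambda>u v :: real \<Rightarrow> 'a. (\<Sqinter>l\<in>time_changes. skorokhod_cost dist u v l)"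
    have I: "?I u v = ennreal (d_Sk dist u v)" "?I v w = ennreal (d_Sk dist v w)" "?I u w = ennreal (d_Sk dist u w)"
      using skorokhod_cost_finite[OF u v] skorokhod_cost_finite[OF v w] skorokhod_cost_finite[OF u w]
      by (simp_all add: d_Sk_eq)
    have "?I u v < ennreal (d_Sk dist u v + e/2)" "?I v w < ennreal (d_Sk dist v w + e/2)"
      unfolding I using e ge0 by (auto simp: ennreal_less_iff)
    then obtain l m where l: "l \<in> time_changes" "skorokhod_cost dist u v l < ennreal (d_Sk dist u v + e/2)"
      and m: "m \<in> time_changes" "skorokhod_cost dist v w m < ennreal (d_Sk dist v w + e/2)"
      unfolding INF_less_iff by blast
    have "?I u w \<le> skorokhod_cost dist u w (m \<circ> l)"
      by (rule INF_lower[OF time_changes_comp[OF l(1) m(1)]])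
    also have "\<dots> \<le> skorokhod_cost dist u v l + skorokhod_cost dist v w m"
      by (rule skorokhod_cost_comp[OF l(1) m(1)])
    also have "\<dots> \<le> ennreal (d_Sk dist u v + e/2) + ennreal (d_Sk dist v w + e/2)"
      using l(2) m(2) by (intro add_mono) auto
    also have "\<dots> = ennreal (d_Sk dist u v + d_Sk dist v w + e)"
      using e ge0 by (simp add: ennreal_plus[symmetric] del: ennreal_plus)
    finally show "d_Sk dist u w \<le> d_Sk dist u v + d_Sk dist v w + e"
      unfolding I using e ge0 by (subst (asm) ennreal_le_iff) auto
  qed
qed

section \<open>Borel sets of the Skorokhod space\<close>

lemma sets_borel_metric:
  assumes "Metric_space Y d"
  shows "sets (borel_metric Y d) = sigma_sets Y {U. openin (Metric_space.mtopology Y d) U}"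
    "space (borel_metric Y d) = Y"
proof -
  interpret Metric_space Y d by fact
  have "{U. openin mtopology U} \<subseteq> Pow Y" using openin_subset[of mtopology] by auto
  then show "sets (borel_metric Y d) = sigma_sets Y {U. openin mtopology U}"
    "space (borel_metric Y d) = Y"
    by (simp_all add: borel_metric_def)
qed

lemma openin_mtopology_iff:
  assumes "Metric_space Y d"
  shows "openin (Metric_space.mtopology Y d) U \<longleftrightarrow>
    U \<subseteq> Y \<and> (\<forall>x\<in>U. \<exists>r>0. \<forall>y\<in>Y. d x y < r \<longrightarrow> y \<in> U)"
proof -
  interpret Metric_space Y d by fact
  have "mball x r \<subseteq> U \<longleftrightarrow> (\<forall>y\<in>Y. d x y < r \<longrightarrow> y \<in> U)" if "x \<in> Y" for x r
    using that by (auto simp: mball_def)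
  then show ?thesis unfolding openin_mtopology by (meson subsetD)
qed

text \<open>Visiting an open set during an open time interval is a stable condition, unlike being in
  it at a fixed time: a small change of \<open>u\<close> moves the time of the visit only within
  \<open>(a, b)\<close> and the value only within \<open>V\<close>.\<close>

lemma skorokhod_open_exists:
  fixes V :: "'a::metric_space set"
  assumes V: "open V" and ab: "0 \<le> a" "b \<le> 1"
  shows "{u \<in> cadlag UNIV dist. \<exists>s\<in>{a<..<b}. u s \<in> V} \<in> sets (skorokhod_borel UNIV dist)"
proof -
  let ?G = "{u \<in> cadlag UNIV dist. \<exists>s\<in>{a<..<b}. u s \<in> V}"
  have "openin (Metric_space.mtopology (cadlag UNIV dist) (d_Sk dist)) ?G"
    unfolding openin_mtopology_iff[OF Metric_space_cadlag]
  proof (intro conjI ballI)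
    fix u assume uG: "u \<in> ?G"
    then obtain s where s: "a < s" "s < b" "u s \<in> V" and u: "u \<in> cadlag UNIV dist" by auto
    obtain e where e: "e > 0" "\<And>y. dist (u s) y < e \<Longrightarrow> y \<in> V"
      using V s(3) by (metis open_dist dist_commute)
    obtain r where r: "r > 0" "\<And>l. l \<in> time_changes \<Longrightarrow> billingsley_norm l < ennreal r \<Longrightarrow> l s \<in> {a<..<b}"
      using time_change_close[OF s(1,2)] s ab by (metis less_imp_le order.trans)
    show "\<exists>r>0. \<forall>v\<in>cadlag UNIV dist. d_Sk dist u v < r \<longrightarrow> v \<in> ?G"
    proof (intro exI[of _ "min r e"] conjI ballI impI)
      fix v :: "real \<Rightarrow> 'a" assume v: "v \<in> cadlag UNIV dist" "d_Sk dist u v < min r e"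
      obtain l where l: "l \<in> time_changes" "billingsley_norm l < ennreal (min r e)"
          "\<And>t. t \<in> I01 \<Longrightarrow> dist (u t) (v (l t)) < min r e"
        by (rule d_Sk_lessE[OF u v]) blast
      have "billingsley_norm l < ennreal r"
        using l(2) by (rule less_le_trans) (simp add: ennreal_leI)
      then have "l s \<in> {a<..<b}" using r(2) l(1) by blast
      moreover have "v (l s) \<in> V" using l(3)[of s] e(2) s ab by auto
      ultimately show "v \<in> ?G" using v(1) by blast
    qed (use r e in simp)
  qed auto
  then show ?thesis
    unfolding sets_borel_metric[OF Metric_space_cadlag] by (auto intro: sigma_sets.Basic)
qed

text \<open>By right continuity \<open>u t \<in> U\<close> holds iff \<open>u\<close> stays away from the complement of \<open>U\<close> on a
  right neighbourhood of \<open>t\<close>.\<close>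

lemma evaluation_measurable:
  assumes t: "0 \<le> t" "t < 1"
  shows "(\<lambda>u. u t) \<in> measurable (skorokhod_borel UNIV dist) (borel :: 'a::metric_space measure)"
proof (rule borel_measurableI)
  fix U :: "'a set" assume U: "open U"
  let ?S = "skorokhod_borel UNIV (dist :: 'a \<Rightarrow> 'a \<Rightarrow> real)"
  have sp: "space ?S = cadlag UNIV dist" by (rule sets_borel_metric[OF Metric_space_cadlag])
  show "(\<lambda>u. u t) -` U \<inter> space ?S \<in> sets ?S"
  proof (cases "U = UNIV")
    case False
    then have ne: "- U \<noteq> {}" by auto
    \<comment> \<open>Shrinking neighbourhoods of the complement of \<open>U\<close>, which is
      nonempty here; \<open>infdist\<close> to the empty set would be 0.\<close>
    define V where "V = (\<lambda>k::nat. {x. infdist x (- U) < inverse (real (Suc k))})"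
    have Vopen: "open (V k)" for k
      unfolding V_def by (intro open_Collect_less continuous_intros)
    define b where "b = (\<lambda>n::nat. t + (1 - t) / real (Suc n))"
    have b: "t < b n" "b n \<le> 1" for n
    proof -
      show "t < b n" using t by (simp add: b_def)
      have "(1 - t) / real (Suc n) \<le> (1 - t) / 1"
        using t by (intro divide_left_mono) auto
      then show "b n \<le> 1" by (simp add: b_def)
    qed
    have b_lim: "b \<longlonglongrightarrow> t"
    proof -
      have "(\<lambda>n. t + (1 - t) * inverse (real (Suc n))) \<longlonglongrightarrow> t + (1 - t) * 0"
        by (intro tendsto_intros LIMSEQ_inverse_real_of_nat)
      then show ?thesis by (simp add: b_def divide_inverse)
    qed
    define G where "G = (\<lambda>k n. {u \<in> space ?S. \<exists>s\<in>{t<..<b n}. u s \<in> V k})"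
    have G: "G k n \<in> sets ?S" for k n
      using skorokhod_open_exists[OF Vopen t(1) b(2)] by (simp add: G_def sp)
    \<comment> \<open>\<open>u \<notin> G k n\<close> says that \<open>u\<close> keeps distance at
      least \<open>1 / Suc k\<close> from \<open>- U\<close> on \<open>(t, b n)\<close>; this
      positive distance is preserved as time decreases to \<open>t\<close>.\<close>
    have "(\<lambda>u. u t) -` U \<inter> space ?S = (\<Union>k. \<Union>n. space ?S - G k n)"
    proof (intro equalityI subsetI)
      fix u assume "u \<in> (\<lambda>u. u t) -` U \<inter> space ?S"
      then have ut: "u t \<in> U" and u: "u \<in> cadlag UNIV dist" by (auto simp: sp)
      have "0 < infdist (u t) (- U)"
        using ut U ne infdist_nonneg[of "u t" "- U"] in_closed_iff_infdist_zero[of "- U" "u t"]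
        by (auto simp: closed_def less_le)
      then obtain k where k: "inverse (real (Suc k)) < infdist (u t) (- U)"
        using reals_Archimedean by blast
      have "((\<lambda>s. infdist (u s) (- U)) \<longlongrightarrow> infdist (u t) (- U)) (at_right t)"
        using cadlagD(2)[OF u t] by (rule tendsto_infdist)
      then have "\<forall>\<^sub>F s in at_right t. inverse (real (Suc k)) < infdist (u s) (- U)"
        using k by (rule order_tendstoD)
      then obtain c where c: "c > t" "\<And>s. t < s \<Longrightarrow> s < c \<Longrightarrow> inverse (real (Suc k)) < infdist (u s) (- U)"
        unfolding eventually_at_right_field by blast
      then obtain n where "b n < c" using order_tendstoD(2)[OF b_lim c(1)] by (auto simp: eventually_sequentially)
      then have "u \<notin> G k n" using c(2) by (fastforce simp: G_def V_def simp del: of_nat_Suc)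
      then show "u \<in> (\<Union>k. \<Union>n. space ?S - G k n)" using u by (auto simp: sp)
    next
      fix u assume "u \<in> (\<Union>k. \<Union>n. space ?S - G k n)"
      then obtain k n where u: "u \<in> cadlag UNIV dist" "u \<notin> G k n" by (auto simp: sp)
      have "((\<lambda>s. infdist (u s) (- U)) \<longlongrightarrow> infdist (u t) (- U)) (at_right t)"
        using cadlagD(2)[OF u(1) t] by (rule tendsto_infdist)
      moreover have "\<forall>\<^sub>F s in at_right t. inverse (real (Suc k)) \<le> infdist (u s) (- U)"
        using eventually_at_right_real[OF b(1)[of n]]
        by eventually_elim (use u in \<open>auto simp: G_def V_def sp not_less simp del: of_nat_Suc\<close>)
      ultimately have "inverse (real (Suc k)) \<le> infdist (u t) (- U)"
        by (rule tendsto_lowerbound) simp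
      then have "0 < infdist (u t) (- U)" by (rule less_le_trans[rotated]) simp
      then have "u t \<in> U" by (cases "u t \<in> - U") auto
      then show "u \<in> (\<lambda>u. u t) -` U \<inter> space ?S" using u by (auto simp: sp)
    qed
    also have "\<dots> \<in> sets ?S" using G by (intro sets.countable_UN) auto
    finally show ?thesis .
  qed simp
qed

section \<open>Essential variation\<close>

abbreviation (input) increasing_upto :: "nat \<Rightarrow> (nat \<Rightarrow> real) \<Rightarrow> bool"
  where "increasing_upto k t \<equiv> \<forall>i\<le>k. t i < t (Suc i)"

lemma increasing_upto_less:
  assumes "increasing_upto k t" "i < j" "j \<le> Suc k"
  shows "t i < (t j :: real)"
  using assms(2,3)
proof (induction j)
  case (Suc j)
  then have "t j < t (Suc j)" using assms(1) by simp
  then show ?case using Suc by (cases "i = j") auto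
qed simp

lemma Var_upper:
  assumes "increasing_upto k t" "\<And>j. j \<le> Suc k \<Longrightarrow> t j \<in> J"
  shows "(\<Sum>i\<le>k. ennreal (d (u (t i)) (u (t (Suc i))))) \<le> Var d u J"
proof -
  have "(k, t) \<in> {(k, t). increasing_upto k t \<and> (\<forall>j\<le>Suc k. t j \<in> J)}"
    using assms by simp
  from SUP_upper[OF this, of "\<lambda>(k, t). \<Sum>i\<le>k. ennreal (d (u (t i)) (u (t (Suc i))))"]
  show ?thesis unfolding Var_def by simp
qed

lemma Var_least:
  assumes "\<And>k t. increasing_upto k t \<Longrightarrow> (\<And>j. j \<le> Suc k \<Longrightarrow> t j \<in> J) \<Longrightarrow>
    (\<Sum>i\<le>k. ennreal (d (u (t i)) (u (t (Suc i))))) \<le> C"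
  shows "Var d u J \<le> C"
  unfolding Var_def using assms by (intro SUP_least) auto

lemma Var_mono: "J \<subseteq> J' \<Longrightarrow> Var d u J \<le> Var d u J'"
  by (intro Var_least Var_upper) auto

lemma Var_cong_le:
  assumes "\<And>t. t \<in> J \<Longrightarrow> u t = v t"
  shows "Var d u J \<le> Var d v J"
proof (rule Var_least)
  fix k and t :: "nat \<Rightarrow> real" assume t: "increasing_upto k t" "\<And>j. j \<le> Suc k \<Longrightarrow> t j \<in> J"
  have "(\<Sum>i\<le>k. ennreal (d (u (t i)) (u (t (Suc i))))) = (\<Sum>i\<le>k. ennreal (d (v (t i)) (v (t (Suc i)))))"
    using t(2) by (intro sum.cong) (simp_all add: assms)
  also have "\<dots> \<le> Var d v J" using t by (rule Var_upper)
  finally show "(\<Sum>i\<le>k. ennreal (d (u (t i)) (u (t (Suc i))))) \<le> Var d v J" .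
qed

text \<open>A partition of \<open>J\<close> is prolonged by \<open>p\<close> and \<open>q\<close>.
  If it already ends at \<open>p\<close>, only \<open>q\<close> is added, since partitions are
  strictly increasing.\<close>

lemma Var_append:
  assumes J: "J \<subseteq> J'" "\<And>x. x \<in> J \<Longrightarrow> x \<le> p" and pq: "p < q" "p \<in> J'" "q \<in> J'"
  shows "Var d v J + ennreal (d (v p) (v q)) \<le> Var d v J'"
proof -
  let ?c = "ennreal (d (v p) (v q))"
  have c: "?c \<le> Var d v J'"
    using Var_upper[of 0 "\<lambda>i. if i = 0 then p else q" J' d v] pq by simp
  have step: "(\<Sum>i\<le>k. ennreal (d (v (t i)) (v (t (Suc i))))) + ?c \<le> Var d v J'"
    if t: "increasing_upto k t" "\<And>j. j \<le> Suc k \<Longrightarrow> t j \<in> J" for k t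
  proof (cases "t (Suc k) = p")
    case True
    define s where "s = (\<lambda>i. if i \<le> Suc k then t i else q)"
    have "(\<Sum>i\<le>k. ennreal (d (v (t i)) (v (t (Suc i))))) + ?c
        = (\<Sum>i\<le>Suc k. ennreal (d (v (s i)) (v (s (Suc i)))))"
      using True by (simp add: s_def)
    also have "\<dots> \<le> Var d v J'"
    proof (rule Var_upper)
      show "increasing_upto (Suc k) s"
        using t(1) True pq by (auto simp: s_def le_Suc_eq)
      show "s j \<in> J'" for j using t(2)[of j] J(1) pq by (auto simp: s_def)
    qed
    finally show ?thesis .
  next
    case False
    then have lt: "t (Suc k) < p" using J(2)[OF t(2)[of "Suc k"]] by simp
    define s where "s = (\<lambda>i. if i \<le> Suc k then t i else if i = Suc (Suc k) then p else q)"
    have "(\<Sum>i\<le>k. ennreal (d (v (t i)) (v (t (Suc i))))) + ?c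
        \<le> (\<Sum>i\<le>k. ennreal (d (v (t i)) (v (t (Suc i))))) + ennreal (d (v (t (Suc k))) (v p)) + ?c"
      by (intro add_right_mono) simp
    also have "\<dots> = (\<Sum>i\<le>Suc (Suc k). ennreal (d (v (s i)) (v (s (Suc i)))))"
      by (simp add: s_def)
    also have "\<dots> \<le> Var d v J'"
    proof (rule Var_upper)
      show "increasing_upto (Suc (Suc k)) s"
        using t(1) lt pq by (auto simp: s_def le_Suc_eq)
      show "s j \<in> J'" for j using t(2)[of j] J(1) pq by (auto simp: s_def)
    qed
    finally show ?thesis .
  qed
  \<comment> \<open>The supremum over partitions is taken with \<open>?c\<close> on the right-hand
    side; \<open>c\<close> then justifies adding it back.\<close>
  have "Var d v J \<le> Var d v J' - ?c"
    by (rule Var_least) (use step in \<open>auto simp: ennreal_le_minus_iff\<close>)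
  then have "Var d v J + ?c \<le> (Var d v J' - ?c) + ?c" by (rule add_right_mono)
  also have "\<dots> = Var d v J'" using c by (rule diff_add_cancel_ennreal)
  finally show ?thesis .
qed

text \<open>The increments of \<open>w\<close> are dominated by those of \<open>F\<close>, whose sum
  telescopes to a single increment. With \<open>F\<close> a distribution function, every increment
  estimate becomes a variation estimate.\<close>

lemma Var_telescope:
  assumes F: "\<And>x y. x \<in> J \<Longrightarrow> y \<in> J \<Longrightarrow> x < y \<Longrightarrow> 0 \<le> d (w x) (w y) \<and> d (w x) (w y) \<le> F y - F x"
    and C: "\<And>x y. x \<in> J \<Longrightarrow> y \<in> J \<Longrightarrow> x < y \<Longrightarrow> F y - F x \<le> C"
  shows "Var d w J \<le> ennreal C"
proof (rule Var_least)
  fix k and t :: "nat \<Rightarrow> real" assume t: "increasing_upto k t" "\<And>j. j \<le> Suc k \<Longrightarrow> t j \<in> J"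
  have F': "0 \<le> d (w (t i)) (w (t (Suc i))) \<and> d (w (t i)) (w (t (Suc i))) \<le> F (t (Suc i)) - F (t i)" if "i \<le> k" for i
    using that t by (intro F) auto
  have "(\<Sum>i\<le>k. ennreal (d (w (t i)) (w (t (Suc i))))) = ennreal (\<Sum>i\<le>k. d (w (t i)) (w (t (Suc i))))"
    using F' by (intro sum_ennreal) auto
  also have "\<dots> \<le> ennreal (\<Sum>i\<le>k. F (t (Suc i)) - F (t i))"
    using F' by (intro ennreal_leI sum_mono) auto
  also have "(\<Sum>i\<le>k. F (t (Suc i)) - F (t i)) = F (t (Suc k)) - F (t 0)"
    using sum_lessThan_telescope[of "\<lambda>i. F (t i)" "Suc k"] by (simp add: lessThan_Suc_atMost)
  also have "ennreal \<dots> \<le> ennreal C"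
    using t increasing_upto_less[OF t(1), of 0 "Suc k"] by (intro ennreal_leI C) auto
  finally show "(\<Sum>i\<le>k. ennreal (d (w (t i)) (w (t (Suc i))))) \<le> ennreal C" .
qed

lemma ess_Var_lower:
  assumes "v \<in> J \<rightarrow> Y" "AE t in lebesgue. t \<in> J \<longrightarrow> v t = u t"
  shows "ess_Var Y d u J \<le> Var d v J"
  unfolding ess_Var_def by (rule INF_lower) (use assms in simp)

lemma ess_Var_greatest:
  assumes "\<And>v. v \<in> J \<rightarrow> Y \<Longrightarrow> AE t in lebesgue. t \<in> J \<longrightarrow> v t = u t \<Longrightarrow> C \<le> Var d v J"
  shows "C \<le> ess_Var Y d u J"
  unfolding ess_Var_def by (rule INF_greatest) (use assms in simp)

lemma ess_Var_mono:
  assumes "J \<subseteq> J'"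
  shows "ess_Var Y d u J \<le> ess_Var Y d u J'"
proof (rule ess_Var_greatest)
  fix v assume v: "v \<in> J' \<rightarrow> Y" "AE t in lebesgue. t \<in> J' \<longrightarrow> v t = u t"
  have "ess_Var Y d u J \<le> Var d v J"
  proof (rule ess_Var_lower)
    show "v \<in> J \<rightarrow> Y" using v(1) assms by auto
    show "AE t in lebesgue. t \<in> J \<longrightarrow> v t = u t"
      using v(2) by eventually_elim (use assms in auto)
  qed
  also have "\<dots> \<le> Var d v J'" using assms by (rule Var_mono)
  finally show "ess_Var Y d u J \<le> Var d v J'" .
qed

lemma ess_Var_empty: "ess_Var Y d u {} = 0"
proof -
  have "ess_Var Y d u {} \<le> Var d u {}" by (rule ess_Var_lower) auto
  also have "Var d u {} \<le> 0" by (rule Var_least) auto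
  finally show ?thesis by simp
qed

section \<open>Variation along dense sets of times\<close>

lemma AE_lebesgue_dense:
  assumes "AE t in lebesgue. P t" "a < b"
  obtains s :: real where "a < s" "s < b" "P s"
proof -
  have "\<exists>s\<in>{a<..<b}. P s"
  proof (rule ccontr)
    assume "\<not> (\<exists>s\<in>{a<..<b}. P s)"
    then have "AE x\<in>{a<..<b} in lebesgue. x \<in> {}"
      using assms(1) by (auto elim: eventually_mono)
    from mem_closed_if_AE_lebesgue_open[OF _ _ this, of "(a + b) / 2"] assms(2) show False by simp
  qed
  then show ?thesis using that by auto
qed

text \<open>Each partition point is approached from the right by points of \<open>S\<close>, and
  right continuity carries the finite sum to the limit.\<close>

lemma Var_dense_le:
  fixes u :: "real \<Rightarrow> 'a::metric_space"
  assumes S: "\<And>x e. x \<in> J \<Longrightarrow> e > 0 \<Longrightarrow> \<exists>s\<in>S. x \<le> s \<and> s < x + e"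
    and u: "\<And>x. x \<in> J \<Longrightarrow> (u \<longlongrightarrow> u x) (at_right x)"
  shows "Var dist u J \<le> Var dist u S"
proof (rule Var_least)
  fix k and t :: "nat \<Rightarrow> real" assume t: "increasing_upto k t" "\<And>j. j \<le> Suc k \<Longrightarrow> t j \<in> J"
  \<comment> \<open>The step length tends to 0 and stays below the gap to the next partition point,
    so the perturbed partition remains increasing; the value 1 is for the last index, which has no
    next point.\<close>
  define e where "e = (\<lambda>(n::nat) i. min (inverse (real (Suc n))) (if i \<le> k then t (Suc i) - t i else 1))"
  have e: "e n i > 0" for n i using t(1) by (simp add: e_def)
  define s where "s = (\<lambda>n i. SOME x. x \<in> S \<and> t i \<le> x \<and> x < t i + e n i)"
  have s: "s n i \<in> S" "t i \<le> s n i" "s n i < t i + e n i" if "i \<le> Suc k" for n i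
  proof -
    have "\<exists>x. x \<in> S \<and> t i \<le> x \<and> x < t i + e n i" using S[OF t(2)[OF that] e] by blast
    from someI_ex[OF this] show "s n i \<in> S" "t i \<le> s n i" "s n i < t i + e n i" by (simp_all add: s_def)
  qed
  have lim: "(\<lambda>n. u (s n i)) \<longlonglongrightarrow> u (t i)" if i: "i \<le> Suc k" for i
  proof (rule tendstoI)
    fix eps :: real assume eps: "0 < eps"
    have "(\<lambda>n. s n i) \<longlonglongrightarrow> t i"
    proof (rule tendsto_sandwich)
      show "\<forall>\<^sub>F n in sequentially. t i \<le> s n i" using s(2)[OF i] by simp
      show "\<forall>\<^sub>F n in sequentially. s n i \<le> t i + inverse (real (Suc n))"
      proof (rule always_eventually, rule allI)
        fix n show "s n i \<le> t i + inverse (real (Suc n))"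
          using s(3)[OF i, of n] by (simp add: e_def)
      qed
      show "(\<lambda>n. t i + inverse (real (Suc n))) \<longlonglongrightarrow> t i"
        using tendsto_add[OF tendsto_const[of "t i"] LIMSEQ_inverse_real_of_nat] by simp
    qed simp
    moreover have "\<forall>\<^sub>F y in at_right (t i). dist (u y) (u (t i)) < eps"
      using u[OF t(2)[OF i]] eps by (auto simp: tendsto_iff)
    then obtain c where c: "c > t i" "\<And>y. t i < y \<Longrightarrow> y < c \<Longrightarrow> dist (u y) (u (t i)) < eps"
      unfolding eventually_at_right_field by blast
    ultimately have "\<forall>\<^sub>F n in sequentially. s n i < c" by (intro order_tendstoD(2))
    then show "\<forall>\<^sub>F n in sequentially. dist (u (s n i)) (u (t i)) < eps"
    proof eventually_elim
      case (elim n)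
      then show ?case using c(2)[of "s n i"] s(2)[OF i, of n] eps by (cases "s n i = t i") auto
    qed
  qed
  have "(\<lambda>n. \<Sum>i\<le>k. ennreal (dist (u (s n i)) (u (s n (Suc i)))))
      \<longlonglongrightarrow> (\<Sum>i\<le>k. ennreal (dist (u (t i)) (u (t (Suc i)))))"
    by (intro tendsto_sum tendsto_ennrealI tendsto_dist lim) auto
  moreover have "(\<Sum>i\<le>k. ennreal (dist (u (s n i)) (u (s n (Suc i))))) \<le> Var dist u S" for n
  proof (rule Var_upper)
    show "increasing_upto k (s n)"
    proof (intro allI impI)
      fix i assume i: "i \<le> k"
      then have "e n i \<le> t (Suc i) - t i" by (simp add: e_def)
      then show "s n i < s n (Suc i)" using s(3)[of i n] s(2)[of "Suc i" n] i by simp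
    qed
  qed (use s(1) in simp)
  ultimately show "(\<Sum>i\<le>k. ennreal (dist (u (t i)) (u (t (Suc i))))) \<le> Var dist u S"
    by (intro LIMSEQ_le_const2) auto
qed

text \<open>A competitor agrees with \<open>u\<close> on a dense set of times, along which
  \<open>u\<close> already realises its whole variation. So a right-continuous curve attains the
  infimum.\<close>

lemma ess_Var_eq_Var:
  fixes u :: "real \<Rightarrow> 'a::metric_space"
  assumes u: "\<And>x. a < x \<Longrightarrow> x < b \<Longrightarrow> (u \<longlongrightarrow> u x) (at_right x)"
  shows "ess_Var UNIV dist u {a<..<b} = Var dist u {a<..<b}"
proof (rule antisym)
  show "ess_Var UNIV dist u {a<..<b} \<le> Var dist u {a<..<b}" by (rule ess_Var_lower) auto
  show "Var dist u {a<..<b} \<le> ess_Var UNIV dist u {a<..<b}"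
  proof (rule ess_Var_greatest)
    fix v assume v: "AE t in lebesgue. t \<in> {a<..<b} \<longrightarrow> v t = u t"
    define S where "S = {t \<in> {a<..<b}. v t = u t}"
    have "Var dist u {a<..<b} \<le> Var dist u S"
    proof (rule Var_dense_le)
      fix x e :: real assume x: "x \<in> {a<..<b}" "e > 0"
      then have "x < min b (x + e)" by simp
      from AE_lebesgue_dense[OF v this] obtain s where "x < s" "s < min b (x + e)" "s \<in> {a<..<b} \<longrightarrow> v s = u s" .
      then show "\<exists>s\<in>S. x \<le> s \<and> s < x + e" using x by (intro bexI[of _ s]) (auto simp: S_def)
    qed (use u in auto)
    also have "\<dots> \<le> Var dist v S" by (rule Var_cong_le) (simp add: S_def)
    also have "\<dots> \<le> Var dist v {a<..<b}" by (rule Var_mono) (auto simp: S_def)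
    finally show "Var dist u {a<..<b} \<le> Var dist v {a<..<b}" .
  qed
qed

text \<open>The competitor follows the given \<open>v\<close> up to a time \<open>r\<close> at which \<open>v\<close> and \<open>u\<close> agree,
  and \<open>u\<close> afterwards.\<close>

lemma ess_Var_extend:
  assumes Y: "Metric_space Y d" and u: "\<And>x. 0 < x \<Longrightarrow> x < b \<Longrightarrow> u x \<in> Y"
    and F: "\<And>x y. 0 < x \<Longrightarrow> x < y \<Longrightarrow> y < b \<Longrightarrow> d (u x) (u y) \<le> F y - F x"
    and r0: "0 \<le> r0" "r0 < s" "s < b" and C: "\<And>r y. r0 < r \<Longrightarrow> r < y \<Longrightarrow> y < b \<Longrightarrow> F y - F r \<le> C"
  shows "ess_Var Y d u {0<..<b} \<le> ess_Var Y d u {0<..<s} + ennreal C"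
proof -
  interpret Metric_space Y d by fact
  have "ess_Var Y d u {0<..<b} \<le> Var d v {0<..<s} + ennreal C"
    if v: "v \<in> {0<..<s} \<rightarrow> Y" "AE t in lebesgue. t \<in> {0<..<s} \<longrightarrow> v t = u t" for v
  proof (cases "Var d v {0<..<s} = \<infinity>")
    case False
    then have fin: "Var d v {0<..<s} < top" by (simp add: less_top)
    \<comment> \<open>The condition \<open>r0 < r\<close> makes the bound \<open>C\<close> available
      after the switch.\<close>
    obtain r where r: "r0 < r" "r < s" "v r = u r"
      using AE_lebesgue_dense[OF v(2) r0(2)] r0 by auto
    define V where "V = (\<lambda>x. enn2real (Var d v {0<..x}))"
    define w where "w = (\<lambda>x. if x \<le> r then v x else u x)"
    \<comment> \<open>A distribution function for the competitor \<open>w\<close>: the variation of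
      \<open>v\<close> up to \<open>r\<close>, continued by the increments of
      \<open>F\<close>.\<close>
    define G where "G = (\<lambda>x. if x \<le> r then V x else V r + (F x - F r))"
    have Vfin: "ennreal (V x) = Var d v {0<..x}" if "x < s" for x
    proof -
      have "Var d v {0<..x} \<le> Var d v {0<..<s}" using that by (intro Var_mono) auto
      then show ?thesis using fin by (simp add: V_def le_less_trans)
    qed
    have V0: "0 \<le> V x" for x by (simp add: V_def)
    have Vstep: "V x + d (v x) (v y) \<le> V y" if "0 < x" "x < y" "y < s" for x y
    proof -
      have "Var d v {0<..x} + ennreal (d (v x) (v y)) \<le> Var d v {0<..y}"
        using that by (intro Var_append) auto
      then have "ennreal (V x + d (v x) (v y)) \<le> ennreal (V y)"
        using that V0[of x] by (simp add: Vfin)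
      then show ?thesis by (subst (asm) ennreal_le_iff) (simp_all add: V0)
    qed
    have Vmono: "V x \<le> V y" if "0 < x" "x \<le> y" "y < s" for x y
    proof (cases "x = y")
      case False
      then have "V x + d (v x) (v y) \<le> V y" using that by (intro Vstep) auto
      moreover have "0 \<le> d (v x) (v y)" by simp
      ultimately show ?thesis by linarith
    qed simp
    have wu: "w x \<in> Y" if "0 < x" "x < b" for x
      using v(1) u that r r0 by (auto simp: w_def)
    have Cpos: "0 \<le> C"
    proof -
      obtain y where y: "r < y" "y < b" using dense[of r b] r r0 by auto
      have "0 \<le> d (u r) (u y)" by simp
      also have "\<dots> \<le> F y - F r" using y r r0 by (intro F) auto
      also have "\<dots> \<le> C" using y r by (intro C) auto
      finally show ?thesis .
    qed
    have "ess_Var Y d u {0<..<b} \<le> Var d w {0<..<b}"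
    proof (rule ess_Var_lower)
      show "AE t in lebesgue. t \<in> {0<..<b} \<longrightarrow> w t = u t"
        using v(2) by eventually_elim (use r r0 in \<open>auto simp: w_def\<close>)
    qed (use wu in auto)
    also have "\<dots> \<le> ennreal (V r + C)"
    proof (rule Var_telescope[where F = G])
      fix x y assume xy: "x \<in> {0<..<b}" "y \<in> {0<..<b}" "x < y"
      consider "y \<le> r" | "x < r" "r < y" | "r \<le> x" by linarith
      then have "d (w x) (w y) \<le> G y - G x"
      proof cases
        case 1
        then show ?thesis using Vstep[of x y] xy r by (simp add: w_def G_def)
      next
        \<comment> \<open>Across the switch the estimate passes through the common value
          \<open>v r = u r\<close>.\<close>
        case 2
        have "d (v x) (u y) \<le> d (v x) (v r) + d (u r) (u y)"
          using triangle[of "v x" "v r" "u y"] v(1) u[of r] u[of y] xy r r0 2 by (auto simp: Pi_iff)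
        also have "\<dots> \<le> (V r - V x) + (F y - F r)"
          using Vstep[of x r] F[of r y] xy r r0 2 by auto
        finally show ?thesis using 2 by (simp add: w_def G_def)
      next
        case 3
        have "w x = u x" using 3 r by (auto simp: w_def)
        moreover have "G x = V r + (F x - F r)" using 3 by (auto simp: G_def)
        ultimately show ?thesis using 3 xy F[of x y] by (simp add: w_def G_def)
      qed
      then show "0 \<le> d (w x) (w y) \<and> d (w x) (w y) \<le> G y - G x" by simp
      have "0 \<le> G x"
      proof (cases "x \<le> r")
        case False
        then have "d (u r) (u x) \<le> F x - F r" using xy r r0 by (intro F) auto
        moreover have "0 \<le> d (u r) (u x)" by simp
        ultimately have "0 \<le> F x - F r" by linarith
        then show ?thesis using False V0[of r] by (simp add: G_def)
      qed (simp add: G_def V0)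
      moreover have "G y \<le> V r + C"
        using Vmono[of y r] C[of r y] Cpos xy r by (auto simp: G_def)
      ultimately show "G y - G x \<le> V r + C" by simp
    qed
    also have "\<dots> = Var d v {0<..r} + ennreal C"
      using V0 Cpos r by (simp add: Vfin)
    also have "\<dots> \<le> Var d v {0<..<s} + ennreal C"
      using r by (intro add_right_mono Var_mono) auto
    finally show ?thesis .
  qed simp
  \<comment> \<open>\<open>C\<close> is moved to the left-hand side so that the infimum over
    \<open>v\<close> can be taken on the right.\<close>
  then have "ess_Var Y d u {0<..<b} - ennreal C \<le> ess_Var Y d u {0<..<s}"
    by (intro ess_Var_greatest) (simp add: ennreal_minus_le_iff add.commute)
  then show ?thesis by (simp add: ennreal_minus_le_iff add.commute)
qed

text \<open>By right continuity rational partitions realise the variation, so the supremum becomes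
  one over countably many measurable functions.\<close>

lemma Var_measurable:
  fixes M :: "(real \<Rightarrow> 'a::polish_space) measure"
  assumes ev: "\<And>t. a < t \<Longrightarrow> t < b \<Longrightarrow> (\<lambda>u. u t) \<in> measurable M borel"
    and rc: "\<And>u t. u \<in> space M \<Longrightarrow> a < t \<Longrightarrow> t < b \<Longrightarrow> (u \<longlongrightarrow> u t) (at_right t)"
  shows "(\<lambda>u. Var dist u {a<..<b}) \<in> borel_measurable M"
proof -
  define S where "S = {a<..<b} \<inter> \<rat>"
  \<comment> \<open>Partitions are extensional beyond \<open>Suc k\<close>, which makes the index
    set countable.\<close>
  define I where "I = (SIGMA k:UNIV. {t \<in> {..Suc k} \<rightarrow>\<^sub>E S. increasing_upto k t})"
  define f :: "nat \<times> (nat \<Rightarrow> real) \<Rightarrow> (real \<Rightarrow> 'a) \<Rightarrow> ennreal"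
    where "f = (\<lambda>(k, t) u. \<Sum>i\<le>k. ennreal (dist (u (t i)) (u (t (Suc i)))))"
  have "countable S" unfolding S_def using countable_rat by blast
  then have "countable I"
    unfolding I_def
    by (intro countable_SIGMA countable_subset[OF _ countable_PiE[of "{..Suc _}" "\<lambda>_. S"]]) auto
  then have "(\<lambda>u. SUP p\<in>I. f p u) \<in> borel_measurable M"
  proof (rule borel_measurable_SUP)
    fix p assume "p \<in> I"
    then obtain k t where p: "p = (k, t)" "\<And>i. i \<le> Suc k \<Longrightarrow> t i \<in> S"
      by (auto simp: I_def PiE_iff)
    have "(\<lambda>u. u (t i)) \<in> measurable M borel" if "i \<le> Suc k" for i
      using p(2)[OF that] by (intro ev) (auto simp: S_def)
    then show "(\<lambda>u. f p u) \<in> borel_measurable M"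
      unfolding p f_def by (auto intro!: borel_measurable_sum)
  qed
  moreover have "Var dist u {a<..<b} = (SUP p\<in>I. f p u)" if u: "u \<in> space M" for u
  proof (rule antisym)
    have "Var dist u {a<..<b} \<le> Var dist u S"
    proof (rule Var_dense_le)
      fix x e :: real assume x: "x \<in> {a<..<b}" "e > 0"
      then have "x < min b (x + e)" by simp
      from Rats_dense_in_real[OF this] obtain s where "s \<in> \<rat>" "x < s" "s < min b (x + e)" by blast
      then show "\<exists>s\<in>S. x \<le> s \<and> s < x + e" using x by (intro bexI[of _ s]) (auto simp: S_def)
    qed (use rc[OF u] in auto)
    also have "\<dots> \<le> (SUP p\<in>I. f p u)"
    proof (rule Var_least)
      fix k and t :: "nat \<Rightarrow> real" assume t: "increasing_upto k t" "\<And>j. j \<le> Suc k \<Longrightarrow> t j \<in> S"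
      define t' where "t' = restrict t {..Suc k}"
      have "(k, t') \<in> I" using t by (auto simp: I_def t'_def)
      moreover have "f (k, t') u = (\<Sum>i\<le>k. ennreal (dist (u (t i)) (u (t (Suc i)))))"
        by (simp add: f_def t'_def)
      ultimately show "(\<Sum>i\<le>k. ennreal (dist (u (t i)) (u (t (Suc i))))) \<le> (SUP p\<in>I. f p u)"
        using SUP_upper[of "(k, t')" I "\<lambda>p. f p u"] by simp
    qed
    finally show "Var dist u {a<..<b} \<le> (SUP p\<in>I. f p u)" .
    show "(SUP p\<in>I. f p u) \<le> Var dist u {a<..<b}"
    proof (rule SUP_least)
      fix p assume "p \<in> I"
      then obtain k t where p: "p = (k, t)" "increasing_upto k t" "\<And>i. i \<le> Suc k \<Longrightarrow> t i \<in> S"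
        by (auto simp: I_def PiE_iff)
      then show "f p u \<le> Var dist u {a<..<b}"
        using Var_upper[OF p(2), of "{a<..<b}" dist u] by (auto simp: f_def S_def)
    qed
  qed
  ultimately show ?thesis by (subst measurable_cong) auto
qed

section \<open>Lebesgue-Stieltjes measures on the unit interval\<close>

text \<open>The distribution function inside \<open>LS_measure\<close>; with a name for it, masses
  of half-open intervals read \<open>right_lim f b - right_lim f a\<close>.\<close>

definition right_lim :: "(real \<Rightarrow> real) \<Rightarrow> real \<Rightarrow> real"
  where "right_lim f t = Lim (at_right t) (\<lambda>s. f (max 0 (min 1 s)))"

lemma clip_mono:
  assumes "mono_on I01 f"
  shows "mono (\<lambda>s. f (max 0 (min 1 s)))"
  by (intro monoI mono_onD[OF assms]) auto

lemma right_lim_tendsto: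
  assumes "mono_on I01 f"
  shows "((\<lambda>s. f (max 0 (min 1 s))) \<longlongrightarrow> right_lim f t) (at_right t)"
  using mono_tendsto_at_right[OF clip_mono[OF assms], of t] unfolding right_lim_def by (simp add: tendsto_Lim)

lemma right_lim_ge:
  assumes f: "mono_on I01 f"
  shows "f (max 0 (min 1 t)) \<le> right_lim f t"
proof (rule tendsto_lowerbound[OF right_lim_tendsto[OF f]])
  show "eventually (\<lambda>x. f (max 0 (min 1 t)) \<le> f (max 0 (min 1 x))) (at_right t)"
    using eventually_at_right_less[of t]
    by eventually_elim (use monoD[OF clip_mono[OF f]] in auto)
qed simp

lemma right_lim_le:
  assumes f: "mono_on I01 f" and "t < s"
  shows "right_lim f t \<le> f (max 0 (min 1 s))"
proof (rule tendsto_upperbound[OF right_lim_tendsto[OF f]])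
  show "eventually (\<lambda>x. f (max 0 (min 1 x)) \<le> f (max 0 (min 1 s))) (at_right t)"
    using eventually_at_right_real[OF assms(2)]
    by eventually_elim (use monoD[OF clip_mono[OF f]] in auto)
qed simp

lemma right_lim_mono:
  assumes "mono_on I01 f" "x \<le> y"
  shows "right_lim f x \<le> right_lim f y"
  using right_lim_le[OF assms(1), of x y] right_lim_ge[OF assms(1), of y] assms(2)
  by (cases "x = y") auto

text \<open>The constant extension beyond 1 makes the right limit at 1 the value itself.\<close>

lemma right_lim_1:
  assumes "mono_on I01 f"
  shows "right_lim f 1 = f 1"
  using right_lim_le[OF assms, of 1 2] right_lim_ge[OF assms, of 1] by simp

lemma right_lim_neg:
  assumes "mono_on I01 f" "t < 0"
  shows "right_lim f t = f 0"
  using right_lim_le[OF assms] right_lim_ge[OF assms(1), of t] assms(2) by (simp add: min_def)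

lemma right_lim_seq:
  assumes f: "mono_on I01 f"
  shows "(\<lambda>n. f (max 0 (min 1 (t + inverse (real (Suc n)))))) \<longlonglongrightarrow> right_lim f t"
proof (rule filterlim_compose[OF right_lim_tendsto[OF f]])
  have "(\<lambda>n. t + inverse (real (Suc n))) \<longlonglongrightarrow> t"
    using tendsto_add[OF tendsto_const[of t] LIMSEQ_inverse_real_of_nat] by simp
  then show "filterlim (\<lambda>n. t + inverse (real (Suc n))) (at_right t) sequentially"
    by (auto simp: filterlim_at)
qed

lemma right_lim_continuous:
  assumes f: "mono_on I01 f"
  shows "continuous (at_right t) (right_lim f)"
  unfolding continuous_within
proof (rule tendsto_sandwich)
  show "eventually (\<lambda>s. right_lim f t \<le> right_lim f s) (at_right t)"
    using eventually_at_right_less[of t] by eventually_elim (auto intro: right_lim_mono[OF f])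
  \<comment> \<open>The point \<open>2 * s - t = s + (s - t)\<close> lies strictly to the right of
    \<open>s\<close> and still tends to \<open>t\<close>.\<close>
  show "eventually (\<lambda>s. right_lim f s \<le> f (max 0 (min 1 (2 * s - t)))) (at_right t)"
    using eventually_at_right_less[of t] by eventually_elim (intro right_lim_le[OF f], simp)
  show "((\<lambda>s. f (max 0 (min 1 (2 * s - t)))) \<longlongrightarrow> right_lim f t) (at_right t)"
  proof (rule filterlim_compose[OF right_lim_tendsto[OF f]])
    have "((\<lambda>s. 2 * s - t) \<longlongrightarrow> t) (at_right t)"
      by (auto intro!: tendsto_eq_intros)
    moreover have "eventually (\<lambda>s. 2 * s - t \<in> {t<..} \<and> 2 * s - t \<noteq> t) (at_right t)"
      using eventually_at_right_less[of t] by eventually_elim auto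
    ultimately show "filterlim (\<lambda>s. 2 * s - t) (at_right t) (at_right t)"
      by (simp add: filterlim_at)
  qed
qed auto

lemma LS_measure_eq: "LS_measure f = restrict_space (interval_measure (right_lim f)) I01"
  by (simp add: LS_measure_def right_lim_def[abs_def])

lemma sets_LS_measure: "sets (LS_measure f) = sets (restrict_space borel I01)"
  by (simp add: LS_measure_eq sets_restrict_space)

lemma space_LS_measure: "space (LS_measure f) = I01"
  by (simp add: LS_measure_eq space_restrict_space)

lemma sets_borel_I01: "A \<in> sets (restrict_space borel I01) \<longleftrightarrow> A \<in> sets borel \<and> A \<subseteq> I01"
  by (subst sets_restrict_space_iff) auto

text \<open>The closed interval is the limit of the intervals from \<open>- 1 / Suc n\<close> to
  \<open>b\<close>, on all of which the measure has the same value since the extension is constant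
  left of 0. The atom at 0 is therefore \<open>right_lim f 0 - f 0\<close>.\<close>

lemma emeasure_LS_measure_interval:
  assumes f: "mono_on I01 f" and b: "0 \<le> b" "b \<le> 1"
  shows "emeasure (LS_measure f) {0..b} = ennreal (right_lim f b - f 0)"
proof -
  let ?m = "interval_measure (right_lim f)"
  define B where "B = (\<lambda>n. {- inverse (real (Suc n))<..b})"
  have "emeasure ?m (B n) = ennreal (right_lim f b - f 0)" for n
  proof -
    have "emeasure ?m (B n) = ennreal (right_lim f b - right_lim f (- inverse (real (Suc n))))"
      unfolding B_def using b
      by (intro emeasure_interval_measure_Ioc right_lim_mono[OF f] right_lim_continuous[OF f])
         (auto intro: order_trans[of _ 0] simp del: of_nat_Suc)
    also have "right_lim f (- inverse (real (Suc n))) = f 0"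
      by (rule right_lim_neg[OF f]) simp
    finally show ?thesis .
  qed
  moreover have "(\<lambda>n. emeasure ?m (B n)) \<longlonglongrightarrow> emeasure ?m (\<Inter>n. B n)"
  proof (rule Lim_emeasure_decseq)
    show "decseq B"
    proof (rule decseq_SucI)
      fix n
      have "inverse (real (Suc (Suc n))) \<le> inverse (real (Suc n))" by (rule le_imp_inverse_le) auto
      then show "B (Suc n) \<subseteq> B n"
        unfolding B_def subset_iff greaterThanAtMost_iff by (intro allI impI conjI) linarith+
    qed
  qed (use calculation in \<open>auto simp: B_def\<close>)
  ultimately have "emeasure ?m (\<Inter>n. B n) = ennreal (right_lim f b - f 0)"
    by (simp add: LIMSEQ_const_iff)
  moreover have "(\<Inter>n. B n) = {0..b}"
  proof (intro equalityI subsetI)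
    fix x assume x: "x \<in> (\<Inter>n. B n)"
    have "- x \<le> 0"
    proof (rule LIMSEQ_le_const[OF LIMSEQ_inverse_real_of_nat])
      have "- x \<le> inverse (real (Suc n))" for n
        using x by (auto simp: B_def simp del: of_nat_Suc dest!: spec[of _ n])
      then show "\<exists>N. \<forall>n\<ge>N. - x \<le> inverse (real (Suc n))" by blast
    qed
    then show "x \<in> {0..b}" using x by (auto simp: B_def)
  next
    fix x assume "x \<in> {0..b}"
    then show "x \<in> (\<Inter>n. B n)" by (auto simp: B_def intro: less_le_trans[of _ 0] simp del: of_nat_Suc)
  qed
  moreover have "emeasure (LS_measure f) {0..b} = emeasure ?m {0..b}"
    unfolding LS_measure_eq using b by (intro emeasure_restrict_space) auto
  ultimately show ?thesis by simp
qed

lemma finite_measure_LS_measure: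
  assumes "mono_on I01 f"
  shows "finite_measure (LS_measure f)"
  by (rule finite_measureI) (simp add: space_LS_measure emeasure_LS_measure_interval[OF assms])

lemma measure_LS_measure_interval:
  assumes f: "mono_on I01 f" and b: "0 \<le> b" "b \<le> 1"
  shows "measure (LS_measure f) {0..b} = right_lim f b - f 0"
proof -
  have "f 0 \<le> right_lim f b"
    using right_lim_ge[OF f, of b] mono_onD[OF f, of 0 b] b by simp
  then show ?thesis using emeasure_LS_measure_interval[OF assms] by (simp add: measure_def)
qed

section \<open>Comparison of measures through initial intervals\<close>

lemma measure_Ioc_I01:
  assumes "finite_measure M" "sets M = sets (restrict_space borel I01)" "0 \<le> a" "a \<le> b" "b \<le> 1"
  shows "measure M {a<..b} = measure M {0..b} - measure M {0..a}"
proof -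
  have "{a<..b} = {0..b} - {0..a}" using assms by auto
  then show ?thesis
    using assms by (simp add: finite_measure.finite_measure_Diff sets_borel_I01)
qed

text \<open>The traces of the rays \<open>{..a}\<close> on the unit interval are the initial
  intervals; a negative \<open>b\<close> gives the empty set.\<close>

lemma sets_borel_I01_generator: "sets (restrict_space borel I01) = sigma_sets I01 ((\<lambda>b. {0..b}) ` {..1})"
proof -
  have "I01 \<in> sets (borel :: real measure)" by simp
  then have I: "I01 \<in> sigma_sets UNIV (range (\<lambda>a::real. {..a}))"
    unfolding borel_eq_atMost by simp
  have "sets (restrict_space borel I01) = (\<inter>) I01 ` sigma_sets UNIV (range (\<lambda>a::real. {..a}))"
    unfolding sets_restrict_space borel_eq_atMost by simp
  also have "\<dots> = sigma_sets I01 ((\<inter>) I01 ` range (\<lambda>a::real. {..a}))"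
    using I by (rule sigma_sets_Int) simp
  also have "(\<inter>) I01 ` range (\<lambda>a::real. {..a}) = (\<lambda>b. {0..b}) ` {..1}"
  proof (intro equalityI subsetI)
    fix A assume "A \<in> (\<inter>) I01 ` range (\<lambda>a::real. {..a})"
    then obtain a where "A = I01 \<inter> {..a}" by blast
    then have "A = {0..min a 1}" by auto
    then show "A \<in> (\<lambda>b. {0..b}) ` {..1}" by (intro image_eqI[of _ _ "min a 1"]) auto
  next
    fix A :: "real set" assume "A \<in> (\<lambda>b. {0..b}) ` {..1}"
    then obtain b where "b \<le> 1" "A = {0..b}" by auto
    then have "A = I01 \<inter> {..b}" by auto
    then show "A \<in> (\<inter>) I01 ` range (\<lambda>a::real. {..a})" by blast
  qed
  finally show ?thesis .
qed

text \<open>Dynkin's principle for initial intervals, which are stable under intersection. It serves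
  both for identities of measures and for measurability in a parameter.\<close>

lemma borel_I01_induct [consumes 1, case_names interval empty compl union]:
  assumes A: "A \<in> sets (restrict_space borel I01)"
    and "\<And>b. 0 \<le> b \<Longrightarrow> b \<le> 1 \<Longrightarrow> P {0..b}" and "P {}"
    and "\<And>A. A \<in> sets (restrict_space borel I01) \<Longrightarrow> P A \<Longrightarrow> P (I01 - A)"
    and "\<And>A. disjoint_family A \<Longrightarrow> range A \<subseteq> sets (restrict_space borel I01) \<Longrightarrow> (\<And>i. P (A i)) \<Longrightarrow> P (\<Union>i::nat. A i)"
  shows "P A"
proof (rule sigma_sets_induct_disjoint[of "(\<lambda>b. {0..b}) ` {..1}" I01])
  show "Int_stable ((\<lambda>b. {0..b}) ` {..1::real})"
  proof (rule Int_stableI)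
    fix A B :: "real set" assume "A \<in> (\<lambda>b. {0..b}) ` {..1}" "B \<in> (\<lambda>b. {0..b}) ` {..1}"
    then obtain a b where "a \<le> 1" "b \<le> 1" "A = {0..a}" "B = {0..b}" by auto
    then have "A \<inter> B = {0..min a b}" "min a b \<le> 1" by auto
    then show "A \<inter> B \<in> (\<lambda>b. {0..b}) ` {..1}" by blast
  qed
  show "P A" if A: "A \<in> (\<lambda>b. {0..b}) ` {..1}" for A
  proof -
    obtain b where "A = {0..b}" "b \<le> 1" using A by auto
    then show ?thesis using assms(2)[of b] assms(3) by (cases "0 \<le> b") auto
  qed
qed (use assms in \<open>auto simp: sets_borel_I01_generator[symmetric]\<close>)

text \<open>The difference of the distribution functions is again a distribution function, and its
  Lebesgue-Stieltjes measure is \<open>N - M\<close>.\<close>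

lemma measure_le_I01:
  assumes fM: "finite_measure M" and fN: "finite_measure N"
    and sM: "sets M = sets (restrict_space borel I01)" and sN: "sets N = sets (restrict_space borel I01)"
    and le0: "measure M {0} \<le> measure N {0}"
    and le: "\<And>a b. 0 \<le> a \<Longrightarrow> a < b \<Longrightarrow> b \<le> 1 \<Longrightarrow> measure M {a<..b} \<le> measure N {a<..b}"
  shows "M \<le> N"
proof -
  interpret M: finite_measure M by fact
  interpret N: finite_measure N by fact
  define H where "H = (\<lambda>t. measure N {0..t} - measure M {0..t})"
  \<comment> \<open>\<open>h\<close> starts from 0 rather than from \<open>H 0\<close>, so that its
    jump at 0 becomes the atom of \<open>N - M\<close> there.\<close>
  define h where "h = (\<lambda>t::real. if t \<le> 0 then 0 else H t)"
  have H0: "0 \<le> H 0" using le0 by (simp add: H_def)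
  have H_mono: "H a \<le> H b" if "0 \<le> a" "a \<le> b" "b \<le> 1" for a b
    using le[of a b] measure_Ioc_I01[OF fM sM, of a b] measure_Ioc_I01[OF fN sN, of a b] that
    by (cases "a = b") (auto simp: H_def)
  have h: "mono_on I01 h"
  proof (rule mono_onI)
    fix r s :: real assume "r \<in> I01" "s \<in> I01" "r \<le> s"
    then show "h r \<le> h s" using H_mono[of r s] H_mono[of 0 s] H0 by (auto simp: h_def)
  qed
  \<comment> \<open>Continuity from above gives right continuity of the distribution functions of
    \<open>M\<close> and \<open>N\<close>; the minimum keeps the intervals inside the unit
    interval.\<close>
  have cont: "(\<lambda>n. measure K {0..min 1 (b + inverse (real (Suc n)))}) \<longlonglongrightarrow> measure K {0..b}"
    if K: "finite_measure K" "sets K = sets (restrict_space borel I01)" and b: "0 \<le> b" "b \<le> 1" for K and b :: real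
  proof -
    interpret K: finite_measure K by fact
    have "(\<lambda>n. measure K {0..min 1 (b + inverse (real (Suc n)))})
        \<longlonglongrightarrow> measure K (\<Inter>n. {0..min 1 (b + inverse (real (Suc n)))})"
    proof (rule K.finite_Lim_measure_decseq)
      show "decseq (\<lambda>n. {0..min 1 (b + inverse (real (Suc n)))})"
      proof (rule decseq_SucI)
        fix n
        have "inverse (real (Suc (Suc n))) \<le> inverse (real (Suc n))" by (rule le_imp_inverse_le) auto
        then show "{0..min 1 (b + inverse (real (Suc (Suc n))))} \<subseteq> {0..min 1 (b + inverse (real (Suc n)))}"
          unfolding subset_iff atLeastAtMost_iff min.bounded_iff
          by (intro allI impI conjI) linarith+
      qed
    qed (auto simp: K(2) sets_borel_I01)
    also have "(\<Inter>n. {0..min 1 (b + inverse (real (Suc n)))}) = {0..b}"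
    proof (intro equalityI subsetI)
      fix x assume x: "x \<in> (\<Inter>n. {0..min 1 (b + inverse (real (Suc n)))})"
      have "x - b \<le> 0"
      proof (rule LIMSEQ_le_const[OF LIMSEQ_inverse_real_of_nat])
        have "x - b \<le> inverse (real (Suc n))" for n
        proof -
          have "x \<in> {0..min 1 (b + inverse (real (Suc n)))}" using x by blast
          then show ?thesis by (auto simp del: of_nat_Suc)
        qed
        then show "\<exists>N. \<forall>n\<ge>N. x - b \<le> inverse (real (Suc n))" by blast
      qed
      then show "x \<in> {0..b}" using x by auto
    qed (use b in \<open>auto intro: order_trans simp del: of_nat_Suc\<close>)
    finally show ?thesis .
  qed
  have rl: "right_lim h b = H b" if b: "0 \<le> b" "b \<le> 1" for b
  proof (rule LIMSEQ_unique)
    show "(\<lambda>n. h (max 0 (min 1 (b + inverse (real (Suc n)))))) \<longlonglongrightarrow> right_lim h b"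
      by (rule right_lim_seq[OF h])
    have "h (max 0 (min 1 (b + inverse (real (Suc n))))) = H (min 1 (b + inverse (real (Suc n))))" for n
    proof -
      have "0 < min 1 (b + inverse (real (Suc n)))" using b by (simp add: add_nonneg_pos)
      then show ?thesis by (simp add: h_def del: of_nat_Suc)
    qed
    moreover have "(\<lambda>n. H (min 1 (b + inverse (real (Suc n))))) \<longlonglongrightarrow> H b"
      unfolding H_def using b by (intro tendsto_diff cont fM fN sM sN)
    ultimately show "(\<lambda>n. h (max 0 (min 1 (b + inverse (real (Suc n)))))) \<longlonglongrightarrow> H b" by simp
  qed
  let ?D = "LS_measure h"
  interpret D: finite_measure ?D by (rule finite_measure_LS_measure[OF h])
  have spM: "space M = I01" "space N = I01" "space ?D = I01"
    using sets_eq_imp_space_eq[OF sM] sets_eq_imp_space_eq[OF sN]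
    by (simp_all add: space_restrict_space space_LS_measure)
  \<comment> \<open>Complements follow by subtraction from the equal total masses, which is possible
    since all three measures are finite, and disjoint unions by summation.\<close>
  have eq: "measure ?D A + measure M A = measure N A" if "A \<in> sets (restrict_space borel I01)" for A
    using that
  proof (induction A rule: borel_I01_induct)
    case (interval b)
    then show ?case using measure_LS_measure_interval[OF h interval] rl[OF interval] by (simp add: H_def h_def)
  next
    case (compl A)
    have "I01 \<in> sets (restrict_space borel I01)" by (simp add: sets_borel_I01)
    have tot: "measure ?D I01 + measure M I01 = measure N I01"
      using measure_LS_measure_interval[OF h, of 1] rl[of 1] by (simp add: H_def h_def)
    show ?case
      using D.finite_measure_compl[of A] M.finite_measure_compl[of A] N.finite_measure_compl[of A]
        compl tot by (simp add: spM sM sN sets_LS_measure)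
  next
    case (union A)
    have "(\<lambda>i. measure ?D (A i) + measure M (A i)) sums (measure ?D (\<Union>i. A i) + measure M (\<Union>i. A i))"
      using union by (intro sums_add D.finite_measure_UNION M.finite_measure_UNION) (auto simp: sM sets_LS_measure)
    moreover have "(\<lambda>i. measure N (A i)) sums measure N (\<Union>i. A i)"
      using union by (intro N.finite_measure_UNION) (auto simp: sN)
    ultimately show ?case using union(3) by (simp add: sums_unique2)
  qed simp
  show ?thesis
  \<comment> \<open>For equal sigma-algebras the order on measures is comparison on every measurable
    set.\<close>
  proof (subst le_measure)
    show "\<forall>A\<in>sets M. emeasure M A \<le> emeasure N A"
    proof
      fix A assume "A \<in> sets M"
      then have "measure M A \<le> measure N A" using eq[of A] sM by (metis le_add_same_cancel2 measure_nonneg)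
      then show "emeasure M A \<le> emeasure N A"
        by (simp add: M.emeasure_eq_measure N.emeasure_eq_measure ennreal_leI)
    qed
  qed (simp add: sM sN)
qed

text \<open>The real-valued \<open>measure\<close> is used because finiteness turns complements into
  differences. On initial intervals the value is a limit of \<open>f x\<close> along times
  decreasing to \<open>b\<close>.\<close>

lemma LS_measure_measurable:
  assumes mono: "\<And>x. x \<in> space M \<Longrightarrow> mono_on I01 (f x)"
    and meas: "\<And>t. t \<in> I01 \<Longrightarrow> (\<lambda>x. f x t) \<in> borel_measurable M"
    and A: "A \<in> sets (restrict_space borel I01)"
  shows "(\<lambda>x. emeasure (LS_measure (f x)) A) \<in> borel_measurable M"
proof -
  have fin: "finite_measure (LS_measure (f x))" if "x \<in> space M" for x
    using finite_measure_LS_measure[OF mono[OF that]] .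
  have "(\<lambda>x. measure (LS_measure (f x)) A) \<in> borel_measurable M"
    using A
  proof (induction A rule: borel_I01_induct)
    case (interval b)
    have "(\<lambda>x. right_lim (f x) b - f x 0) \<in> borel_measurable M"
    proof (rule borel_measurable_diff)
      show "(\<lambda>x. right_lim (f x) b) \<in> borel_measurable M"
      proof (rule borel_measurable_LIMSEQ_real)
        show "(\<lambda>n. f x (max 0 (min 1 (b + inverse (real (Suc n)))))) \<longlonglongrightarrow> right_lim (f x) b"
          if "x \<in> space M" for x by (rule right_lim_seq[OF mono[OF that]])
        show "(\<lambda>x. f x (max 0 (min 1 (b + inverse (real (Suc n)))))) \<in> borel_measurable M" for n
          by (rule meas) auto
      qed
    qed (auto intro: meas)
    then show ?case
      by (subst measurable_cong) (auto simp: measure_LS_measure_interval[OF mono] interval)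
  next
    case (compl A)
    have "(\<lambda>x. measure (LS_measure (f x)) I01) \<in> borel_measurable M"
      by (subst measurable_cong[where g = "\<lambda>x. f x 1 - f x 0"])
         (auto simp: measure_LS_measure_interval[OF mono] right_lim_1[OF mono] intro!: borel_measurable_diff meas)
    then have "(\<lambda>x. measure (LS_measure (f x)) I01 - measure (LS_measure (f x)) A) \<in> borel_measurable M"
      using compl(2) by (rule borel_measurable_diff)
    then show ?case
      by (subst measurable_cong)
         (use compl(1) finite_measure.finite_measure_compl[OF fin, of _ A] in
           \<open>auto simp: sets_LS_measure space_LS_measure\<close>)
  next
    case (union A)
    have "(\<lambda>x. \<Sum>i. measure (LS_measure (f x)) (A i)) \<in> borel_measurable M"
      using union(3) by (rule borel_measurable_suminf)
    moreover have "measure (LS_measure (f x)) (\<Union>i. A i) = (\<Sum>i. measure (LS_measure (f x)) (A i))"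
      if "x \<in> space M" for x
      using union by (intro sums_unique finite_measure.finite_measure_UNION[OF fin[OF that]]) (auto simp: sets_LS_measure)
    ultimately show ?case by (subst measurable_cong) auto
  qed simp
  then have "(\<lambda>x. ennreal (measure (LS_measure (f x)) A)) \<in> borel_measurable M" by simp
  then show ?thesis
    by (subst measurable_cong) (auto simp: finite_measure.emeasure_eq_measure[OF fin])
qed

text \<open>\<open>measure_of\<close> has the prescribed values for a countably additive set
  function, and exchanging sum and integral asks for measurable integrands. Variation measures are
  well behaved only for almost every curve, so a version \<open>f\<close> that is monotone for every
  curve stands in for them.\<close>

lemma emeasure_mean_variation_measure:
  assumes mono: "\<And>\<gamma>. \<gamma> \<in> space \<pi> \<Longrightarrow> mono_on I01 (f \<gamma>)"
    and meas: "\<And>t. t \<in> I01 \<Longrightarrow> (\<lambda>\<gamma>. f \<gamma> t) \<in> borel_measurable \<pi>"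
    and AE: "AE \<gamma> in \<pi>. variation_measure Y d \<gamma> = LS_measure (f \<gamma>)"
    and A: "A \<in> sets (restrict_space borel I01)"
  shows "emeasure (mean_variation_measure Y d \<pi>) A = (\<integral>\<^sup>+\<gamma>. emeasure (variation_measure Y d \<gamma>) A \<partial>\<pi>)"
proof -
  have eq: "(\<integral>\<^sup>+\<gamma>. emeasure (variation_measure Y d \<gamma>) A \<partial>\<pi>) = (\<integral>\<^sup>+\<gamma>. emeasure (LS_measure (f \<gamma>)) A \<partial>\<pi>)" for A
    by (rule nn_integral_cong_AE) (use AE in eventually_elim, simp)
  have sa: "sigma_algebra I01 (sets (restrict_space borel I01))"
    using sets.sigma_algebra_axioms[of "restrict_space borel I01"] by (simp add: space_restrict_space)
  show ?thesis
    unfolding mean_variation_measure_def eq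
  proof (rule emeasure_measure_of_sigma[OF sa _ _ A])
    show "positive (sets (restrict_space borel I01)) (\<lambda>A. \<integral>\<^sup>+\<gamma>. emeasure (LS_measure (f \<gamma>)) A \<partial>\<pi>)"
      by (simp add: positive_def)
    show "countably_additive (sets (restrict_space borel I01)) (\<lambda>A. \<integral>\<^sup>+\<gamma>. emeasure (LS_measure (f \<gamma>)) A \<partial>\<pi>)"
    proof (rule countably_additiveI)
      fix B :: "nat \<Rightarrow> real set"
      assume B: "range B \<subseteq> sets (restrict_space borel I01)" "disjoint_family B"
      have "(\<Sum>i. \<integral>\<^sup>+\<gamma>. emeasure (LS_measure (f \<gamma>)) (B i) \<partial>\<pi>) = (\<integral>\<^sup>+\<gamma>. (\<Sum>i. emeasure (LS_measure (f \<gamma>)) (B i)) \<partial>\<pi>)"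
        using B(1) by (intro nn_integral_suminf[symmetric] LS_measure_measurable mono meas) auto
      also have "\<dots> = (\<integral>\<^sup>+\<gamma>. emeasure (LS_measure (f \<gamma>)) (\<Union>i. B i) \<partial>\<pi>)"
        using B by (intro nn_integral_cong suminf_emeasure) (auto simp: sets_LS_measure)
      finally show "(\<Sum>i. \<integral>\<^sup>+\<gamma>. emeasure (LS_measure (f \<gamma>)) (B i) \<partial>\<pi>)
        = (\<integral>\<^sup>+\<gamma>. emeasure (LS_measure (f \<gamma>)) (\<Union>i. B i) \<partial>\<pi>)" .
    qed
  qed
qed

section \<open>Curves of marginals\<close>

abbreviation var_fun :: "'b set \<Rightarrow> ('b \<Rightarrow> 'b \<Rightarrow> real) \<Rightarrow> (real \<Rightarrow> 'b) \<Rightarrow> real \<Rightarrow> real"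
  where "var_fun Y d u \<equiv> \<lambda>t. enn2real (ess_Var Y d u {0<..<t})"

lemma var_fun_mono:
  assumes "ess_Var Y d u {0<..<1} < \<infinity>"
  shows "mono_on I01 (var_fun Y d u)"
proof (rule mono_onI)
  fix r s :: real assume rs: "r \<in> I01" "s \<in> I01" "r \<le> s"
  have "ess_Var Y d u {0<..<s} \<le> ess_Var Y d u {0<..<1}" using rs by (intro ess_Var_mono) auto
  then have "ess_Var Y d u {0<..<s} < top" using assms by (simp add: le_less_trans)
  moreover have "ess_Var Y d u {0<..<r} \<le> ess_Var Y d u {0<..<s}" using rs by (intro ess_Var_mono) auto
  ultimately show "var_fun Y d u r \<le> var_fun Y d u s" by (intro enn2real_mono)
qed

lemma measure_LS_measure_Ioc:
  assumes "mono_on I01 f" "0 \<le> a" "a \<le> b" "b \<le> 1"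
  shows "measure (LS_measure f) {a<..b} = right_lim f b - right_lim f a"
  using measure_Ioc_I01[OF finite_measure_LS_measure[OF assms(1)] sets_LS_measure assms(2-4)]
    measure_LS_measure_interval[OF assms(1)] assms by simp

lemma cadlag_BV_finite:
  assumes "u \<in> cadlag_BV Y d"
  shows "ess_Var Y d u {0<..<1} < \<infinity>"
proof -
  have "ess_Var Y d u {0<..<1} \<le> ess_Var Y d u I01" by (rule ess_Var_mono) auto
  also have "\<dots> < \<infinity>" using assms by (auto simp: cadlag_BV_def BV_curve_def)
  finally show ?thesis .
qed

lemma cadlag_ess_Var_eq_Var:
  fixes u :: "real \<Rightarrow> 'a::metric_space"
  assumes "u \<in> cadlag UNIV dist" "t \<le> 1"
  shows "ess_Var UNIV dist u {0<..<t} = Var dist u {0<..<t}"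
  using assms by (intro ess_Var_eq_Var cadlagD(2)) auto

text \<open>\<open>var_fun\<close> at \<open>t'\<close> counts the variation on the open interval
  before \<open>t'\<close>, so the step from \<open>u s'\<close> to \<open>u t\<close> is seen only
  for \<open>t' > t\<close> and \<open>s' > 0\<close>. The inequality is proved for
  \<open>s < s' < t < t'\<close>; then \<open>t'\<close> decreases to \<open>t\<close>, where
  \<open>t < 1\<close> enters, and \<open>s'\<close> decreases to \<open>s\<close>.\<close>

lemma dist_le_variation_measure:
  fixes u :: "real \<Rightarrow> 'a::metric_space"
  assumes u: "u \<in> cadlag_BV UNIV dist" and st: "0 \<le> s" "s < t" "t < 1"
  shows "ennreal (dist (u s) (u t)) \<le> emeasure (variation_measure UNIV dist u) {s<..t}"
proof -
  have c: "u \<in> cadlag UNIV dist" using u by (simp add: cadlag_BV_def)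
  let ?V = "var_fun UNIV dist u"
  have V: "mono_on I01 ?V" by (rule var_fun_mono[OF cadlag_BV_finite[OF u]])
  have VV: "ennreal (?V t) = Var dist u {0<..<t}" if "t \<le> 1" for t
  proof -
    have "ess_Var UNIV dist u {0<..<t} \<le> ess_Var UNIV dist u {0<..<1}" using that by (intro ess_Var_mono) auto
    then have "ess_Var UNIV dist u {0<..<t} < top" using cadlag_BV_finite[OF u] by (simp add: le_less_trans)
    then show ?thesis using cadlag_ess_Var_eq_Var[OF c that] by simp
  qed
  have step: "?V s' + dist (u s') (u t) \<le> ?V t'" if "s < s'" "s' < t" "t < t'" "t' < 1" for s' t'
  proof -
    have "Var dist u {0<..<s'} + ennreal (dist (u s') (u t)) \<le> Var dist u {0<..<t'}"
      using that st by (intro Var_append) auto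
    then have "ennreal (?V s') + ennreal (dist (u s') (u t)) \<le> ennreal (?V t')"
      using VV[of s'] VV[of t'] that st by simp
    then have "ennreal (?V s' + dist (u s') (u t)) \<le> ennreal (?V t')"
      by (simp only: ennreal_plus[OF enn2real_nonneg zero_le_dist])
    then show ?thesis by (subst (asm) ennreal_le_iff) auto
  qed
  have "right_lim ?V s + dist (u s') (u t) \<le> right_lim ?V t" if s': "s < s'" "s' < t" for s'
  proof -
    have "?V s' + dist (u s') (u t) \<le> right_lim ?V t"
    proof (rule tendsto_lowerbound[OF right_lim_tendsto[OF V]])
      show "\<forall>\<^sub>F x in at_right t. ?V s' + dist (u s') (u t) \<le> ?V (max 0 (min 1 x))"
        using eventually_at_right_real[OF st(3)]
      proof eventually_elim
        case (elim x)
        then have "max 0 (min 1 x) = x" using st by simp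
        then show ?case using step[OF s', of x] elim by simp
      qed
    qed simp
    moreover have "right_lim ?V s \<le> ?V s'"
    proof -
      have "max 0 (min 1 s') = s'" using s' st by simp
      then show ?thesis using right_lim_le[OF V s'(1)] by simp
    qed
    ultimately show ?thesis by linarith
  qed
  then have le: "dist (u s') (u t) \<le> right_lim ?V t - right_lim ?V s" if "s < s'" "s' < t" for s'
    using that by (simp add: algebra_simps)
  have "dist (u s) (u t) \<le> right_lim ?V t - right_lim ?V s"
  proof (rule tendsto_upperbound)
    show "((\<lambda>s'. dist (u s') (u t)) \<longlongrightarrow> dist (u s) (u t)) (at_right s)"
      using st by (intro tendsto_dist cadlagD(2)[OF c] tendsto_const) auto
    show "\<forall>\<^sub>F s' in at_right s. dist (u s') (u t) \<le> right_lim ?V t - right_lim ?V s"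
      using eventually_at_right_real[OF st(2)] by eventually_elim (use le in auto)
  qed simp
  then show ?thesis
    using measure_LS_measure_Ioc[OF V, of s t] st
    by (simp add: variation_measure_def finite_measure.emeasure_eq_measure[OF finite_measure_LS_measure[OF V]] ennreal_leI)
qed

section \<open>Continuity from above and measurability of cadlag curves\<close>

lemma measure_Ioc_tendsto_0:
  assumes K: "finite_measure K" "sets K = sets (restrict_space borel I01)" and t: "0 \<le> t" "t < 1"
  shows "((\<lambda>s. measure K {t<..s}) \<longlongrightarrow> 0) (at_right t)"
proof (rule tendsto_at_right_sequentially[OF t(2)])
  interpret finite_measure K by fact
  fix S :: "nat \<Rightarrow> real"
  assume S: "\<And>n. t < S n" "\<And>n. S n < 1" "decseq S" "S \<longlonglongrightarrow> t"
  have "(\<lambda>n. measure K {t<..S n}) \<longlonglongrightarrow> measure K (\<Inter>n. {t<..S n})"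
  proof (rule finite_Lim_measure_decseq)
    show "range (\<lambda>n. {t<..S n}) \<subseteq> sets K"
      using S(2) t by (force simp: K(2) sets_borel_I01 intro: less_imp_le order_trans)
    show "decseq (\<lambda>n. {t<..S n})" using S(3) by (fastforce simp: decseq_def intro: order_trans)
  qed
  also have "(\<Inter>n. {t<..S n}) = {}"
  proof (rule ccontr)
    assume "(\<Inter>n. {t<..S n}) \<noteq> {}"
    then obtain x where x: "t < x" "\<And>n. x \<le> S n" by fastforce
    then have "x \<le> t" by (intro LIMSEQ_le_const[OF S(4)]) auto
    then show False using x by simp
  qed
  finally show "(\<lambda>n. measure K {t<..S n}) \<longlonglongrightarrow> 0" by simp
qed

lemma measure_Ioo_tendsto_0:
  assumes K: "finite_measure K" "sets K = sets (restrict_space borel I01)" and t: "0 < t" "t \<le> 1"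
  shows "((\<lambda>s. measure K {s<..<t}) \<longlongrightarrow> 0) (at_left t)"
proof (rule tendsto_at_left_sequentially[OF t(1)])
  interpret finite_measure K by fact
  fix S :: "nat \<Rightarrow> real"
  assume S: "\<And>n. S n < t" "\<And>n. 0 < S n" "incseq S" "S \<longlonglongrightarrow> t"
  have "(\<lambda>n. measure K {S n<..<t}) \<longlonglongrightarrow> measure K (\<Inter>n. {S n<..<t})"
  proof (rule finite_Lim_measure_decseq)
    show "range (\<lambda>n. {S n<..<t}) \<subseteq> sets K"
      using S(2) t by (force simp: K(2) sets_borel_I01 intro: less_imp_le order_trans less_trans)
    show "decseq (\<lambda>n. {S n<..<t})" using S(3) by (fastforce simp: incseq_def decseq_def intro: le_less_trans)
  qed
  also have "(\<Inter>n. {S n<..<t}) = {}"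
  proof (rule ccontr)
    assume "(\<Inter>n. {S n<..<t}) \<noteq> {}"
    then obtain x where x: "x < t" "\<And>n. S n < x" by fastforce
    then have "t \<le> x" by (intro LIMSEQ_le_const2[OF S(4)]) (auto intro: less_imp_le)
    then show False using x by simp
  qed
  finally show "(\<lambda>n. measure K {S n<..<t}) \<longlonglongrightarrow> 0" by simp
qed

text \<open>Consider the points of \<open>S\<close> other than 1 that are not interior. The open
  right intervals attached to them lie in the interior of \<open>S\<close>, so none contains another
  such point and they are pairwise disjoint. Hence there are countably many, and \<open>S\<close> is
  open up to a countable set.\<close>

lemma right_open_borel:
  assumes S: "S \<subseteq> I01" "\<And>t. t \<in> S \<Longrightarrow> t < 1 \<Longrightarrow> \<exists>e>0. {t..<t + e} \<subseteq> S"
  shows "S \<in> sets borel"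
proof -
  define R where "R = S - interior S - {1}"
  have "\<forall>t\<in>R. \<exists>e>0. {t..<t + e} \<subseteq> S" using S by (force simp: R_def)
  from bchoice[OF this] obtain e where e: "\<forall>t\<in>R. e t > 0 \<and> {t..<t + e t} \<subseteq> S" ..
  define J where "J = (\<lambda>t. {t<..<t + e t})"
  have J: "J t \<subseteq> interior S" if "t \<in> R" for t
    using e that by (intro interior_maximal) (auto simp: J_def subset_iff)
  have disj: "J x \<inter> J y = {}" if "x \<in> R" "y \<in> R" "x < y" for x y
  proof -
    have "y \<notin> J x" using J[OF that(1)] that(2) by (auto simp: R_def)
    then show ?thesis using that by (auto simp: J_def)
  qed
  have disj': "J x \<inter> J y = {}" if "x \<in> R" "y \<in> R" "x \<noteq> y" for x y
    using disj[of x y] disj[of y x] that by (cases "x < y") auto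
  have ne: "J x \<noteq> {}" if "x \<in> R" for x
    using e that by (auto simp: J_def)
  have "countable (J ` R)"
  proof (rule countable_disjoint_open_subsets)
    show "disjoint (J ` R)" using disj' by (auto simp: disjoint_def)
  qed (auto simp: J_def)
  moreover have "inj_on J R"
  proof (rule inj_onI)
    fix x y assume "x \<in> R" "y \<in> R" "J x = J y"
    then show "x = y" using disj'[of x y] ne[of x] by auto
  qed
  ultimately have "countable R" by (simp add: countable_image_inj_eq)
  then have "countable (S - interior S)"
    by (rule countable_subset[rotated, OF countable_insert[of _ 1]]) (auto simp: R_def)
  then have "S - interior S \<in> sets borel" by (rule sets.countable[rotated]) simp
  then have "interior S \<union> (S - interior S) \<in> sets borel" by (intro sets.Un) auto
  moreover have "interior S \<union> (S - interior S) = S" using interior_subset[of S] by auto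
  ultimately show ?thesis by simp
qed

text \<open>By right continuity the preimage of an open set contains a right interval at each of its
  points before 1, hence is Borel; the other Borel sets follow by induction over the generated
  sigma-algebra.\<close>

lemma cadlag_measurable:
  assumes Y: "Metric_space Y d" and u: "u \<in> cadlag Y d"
  shows "u \<in> measurable (lebesgue_on I01) (borel_metric Y d)"
proof (rule measurableI)
  fix x :: real assume "x \<in> space (lebesgue_on I01)"
  then show "u x \<in> space (borel_metric Y d)"
    using u by (auto simp: sets_borel_metric(2)[OF Y] cadlag_def)
next
  interpret Metric_space Y d by fact
  fix A assume A: "A \<in> sets (borel_metric Y d)"
  have uY: "u t \<in> Y" if "t \<in> I01" for t using u that by (auto simp: cadlag_def)
  have "{t \<in> I01. u t \<in> A} \<in> sets borel"
    using A unfolding sets_borel_metric(1)[OF Y]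
  proof (induction rule: sigma_sets.induct)
    case (Basic U)
    show ?case
    proof (rule right_open_borel)
      fix t assume t: "t \<in> {t \<in> I01. u t \<in> U}" "t < 1"
      then obtain r where r: "r > 0" "\<And>y. y \<in> Y \<Longrightarrow> d (u t) y < r \<Longrightarrow> y \<in> U"
        using Basic openin_mtopology_iff[OF Y, of U] by blast
      have "((\<lambda>s. d (u s) (u t)) \<longlongrightarrow> 0) (at_right t)" using u t by (auto simp: cadlag_def)
      then have "\<forall>\<^sub>F s in at_right t. d (u s) (u t) < r" using r(1) by (rule order_tendstoD)
      then have "\<forall>\<^sub>F s in at_right t. s \<in> {t<..<1} \<and> d (u t) (u s) < r"
        using eventually_at_right_real[OF t(2)] by eventually_elim (simp add: commute)
      then obtain b where b: "b > t" "\<And>s. t < s \<Longrightarrow> s < b \<Longrightarrow> s \<in> {t<..<1} \<and> d (u t) (u s) < r"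
        unfolding eventually_at_right_field by blast
      have "{t..<t + (b - t)} \<subseteq> {t \<in> I01. u t \<in> U}"
      proof
        fix s assume s: "s \<in> {t..<t + (b - t)}"
        show "s \<in> {t \<in> I01. u t \<in> U}"
        proof (cases "s = t")
          case False
          then have "t < s" "s < b" using s by auto
          then have "s \<in> I01" "d (u t) (u s) < r" using b(2)[of s] t(1) by auto
          then show ?thesis using r(2) uY by blast
        qed (use t in simp)
      qed
      then show "\<exists>e>0. {t..<t + e} \<subseteq> {t \<in> I01. u t \<in> U}" using b(1) by (intro exI[of _ "b - t"]) simp
    qed auto
  next
    case (Compl A)
    have "{t \<in> I01. u t \<in> Y - A} = I01 - {t \<in> I01. u t \<in> A}" using uY by auto
    then show ?case using Compl by simp
  next
    case (Union A)
    have "{t \<in> I01. u t \<in> (\<Union>i. A i)} = (\<Union>i. {t \<in> I01. u t \<in> A i})" by auto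
    then show ?case using Union by simp
  qed simp
  moreover have "u -` A \<inter> space (lebesgue_on I01) = {t \<in> I01. u t \<in> A}" by auto
  ultimately show "u -` A \<inter> space (lebesgue_on I01) \<in> sets (lebesgue_on I01)"
    by (auto simp: sets_restrict_space_iff)
qed

lemma transport_cost_distr_le:
  fixes X Z :: "'b \<Rightarrow> 'a::polish_space"
  assumes "prob_space M" "X \<in> measurable M borel" "Z \<in> measurable M borel"
  shows "transport_cost (distr M borel X) (distr M borel Z) \<le> (\<integral>\<^sup>+\<omega>. ennreal (dist (X \<omega>) (Z \<omega>)) \<partial>M)"
proof -
  interpret prob_space M by fact
  note [measurable] = assms(2,3)
  let ?D = "distr M (borel \<Otimes>\<^sub>M borel) (\<lambda>\<omega>. (X \<omega>, Z \<omega>))"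
  have "prob_space ?D" by (rule prob_space_distr) measurable
  then have c: "?D \<in> couplings (distr M borel X) (distr M borel Z)"
    by (simp add: couplings_def space_prob_algebra distr_distr comp_def)
  have "transport_cost (distr M borel X) (distr M borel Z) \<le> (\<integral>\<^sup>+(x, y). ennreal (dist x y) \<partial>?D)"
    unfolding transport_cost_def by (rule INF_lower[OF c])
  also have "\<dots> = (\<integral>\<^sup>+\<omega>. ennreal (dist (X \<omega>) (Z \<omega>)) \<partial>M)"
    by (subst nn_integral_distr) (simp_all add: case_prod_unfold)
  finally show ?thesis .
qed

text \<open>The finite bound \<open>c\<close> rules out an infinite cost, at which
  \<open>enn2real\<close> would fail to be monotone.\<close>

lemma W1_distr_le:
  fixes X Z :: "'b \<Rightarrow> 'a::polish_space"
  assumes "prob_space M" "X \<in> measurable M borel" "Z \<in> measurable M borel"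
    and le: "(\<integral>\<^sup>+\<omega>. ennreal (dist (X \<omega>) (Z \<omega>)) \<partial>M) \<le> ennreal c" and c: "0 \<le> c"
  shows "W1 (distr M borel X) (distr M borel Z) \<le> c"
proof -
  have "transport_cost (distr M borel X) (distr M borel Z) \<le> ennreal c"
    using transport_cost_distr_le[OF assms(1-3)] le by (rule order_trans)
  then have "W1 (distr M borel X) (distr M borel Z) \<le> enn2real (ennreal c)"
    unfolding W1_eq_enn2real by (rule enn2real_mono) simp
  then show ?thesis using c by simp
qed

text \<open>A finite mean displacement preserves finite first moments; this carries membership in
  \<open>P1\<close> from time 0 to later times and to left limits.\<close>

lemma P1_distr:
  fixes X Z :: "'b \<Rightarrow> 'a::polish_space"
  assumes "prob_space M" "X \<in> measurable M borel" "Z \<in> measurable M borel"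
    and P: "distr M borel X \<in> P1" and fin: "(\<integral>\<^sup>+\<omega>. ennreal (dist (X \<omega>) (Z \<omega>)) \<partial>M) < \<infinity>"
  shows "distr M borel Z \<in> P1"
proof -
  interpret prob_space M by fact
  note [measurable] = assms(2,3)
  obtain x0 where "(\<integral>\<^sup>+x. ennreal (dist x x0) \<partial>distr M borel X) < \<infinity>" using P1D(4)[OF P] by blast
  then have x0: "(\<integral>\<^sup>+\<omega>. ennreal (dist (X \<omega>) x0) \<partial>M) < \<infinity>"
    by (subst (asm) nn_integral_distr) simp_all
  show ?thesis
  proof (rule P1I[where ?x0.0 = x0])
    show "prob_space (distr M borel Z)" by (rule prob_space_distr) measurable
    have "(\<integral>\<^sup>+x. ennreal (dist x x0) \<partial>distr M borel Z) = (\<integral>\<^sup>+\<omega>. ennreal (dist (Z \<omega>) x0) \<partial>M)"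
      by (subst nn_integral_distr) simp_all
    also have "\<dots> \<le> (\<integral>\<^sup>+\<omega>. ennreal (dist (X \<omega>) (Z \<omega>)) + ennreal (dist (X \<omega>) x0) \<partial>M)"
    proof (rule nn_integral_mono)
      fix \<omega>
      have "dist (Z \<omega>) x0 \<le> dist (X \<omega>) (Z \<omega>) + dist (X \<omega>) x0"
        using dist_triangle[of "Z \<omega>" x0 "X \<omega>"] by (simp add: dist_commute)
      then show "ennreal (dist (Z \<omega>) x0) \<le> ennreal (dist (X \<omega>) (Z \<omega>)) + ennreal (dist (X \<omega>) x0)"
        by (simp add: ennreal_plus[symmetric] ennreal_leI del: ennreal_plus)
    qed
    also have "\<dots> = (\<integral>\<^sup>+\<omega>. ennreal (dist (X \<omega>) (Z \<omega>)) \<partial>M) + (\<integral>\<^sup>+\<omega>. ennreal (dist (X \<omega>) x0) \<partial>M)"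
      by (rule nn_integral_add) measurable
    also have "\<dots> < \<infinity>" using fin x0 by (simp add: less_top)
    finally show "(\<integral>\<^sup>+x. ennreal (dist x x0) \<partial>distr M borel Z) < \<infinity>" .
  qed simp
qed

section \<open>Marginals of a random curve of bounded variation\<close>

locale random_BV_curve =
  fixes \<pi> :: "(real \<Rightarrow> 'a::polish_space) measure"
  assumes pi: "\<pi> \<in> space (prob_algebra (skorokhod_borel UNIV dist))"
    and BV: "AE \<gamma> in \<pi>. \<gamma> \<in> cadlag_BV UNIV dist"
    and fin: "(\<integral>\<^sup>+\<gamma>. emeasure (variation_measure UNIV dist \<gamma>) I01 \<partial>\<pi>) < \<infinity>"
    and P0: "marginals \<pi> 0 \<in> P1"
begin

abbreviation "\<nu> \<equiv> mean_variation_measure UNIV dist \<pi>"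

text \<open>The distribution function of \<open>\<nu>\<close>, a common clock against which the
  increments of the marginals are measured.\<close>

definition mass :: "real \<Rightarrow> real" where "mass t = measure \<nu> {0..t}"

sublocale prob_space \<pi>
  using pi by (simp add: space_prob_algebra)

lemma sets_pi: "sets \<pi> = sets (skorokhod_borel UNIV dist)"
  using pi by (simp add: space_prob_algebra)

lemma space_pi: "space \<pi> = cadlag UNIV dist"
  using sets_eq_imp_space_eq[OF sets_pi] sets_borel_metric(2)[OF Metric_space_cadlag] by simp

lemma evaluation_measurable_pi:
  "0 \<le> t \<Longrightarrow> t < 1 \<Longrightarrow> (\<lambda>\<gamma>. \<gamma> t) \<in> measurable \<pi> borel"
  using evaluation_measurable[of t] measurable_cong_sets[OF sets_pi refl] by blast

lemma emeasure_nu: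
  assumes A: "A \<in> sets (restrict_space borel I01)"
  shows "emeasure \<nu> A = (\<integral>\<^sup>+\<gamma>. emeasure (variation_measure UNIV dist \<gamma>) A \<partial>\<pi>)"
proof -
  obtain N where N: "{\<gamma> \<in> space \<pi>. \<gamma> \<notin> cadlag_BV UNIV dist} \<subseteq> N" "N \<in> null_sets \<pi>"
    using BV by (auto simp: eventually_ae_filter)
  \<comment> \<open>On a null set containing all curves of \<open>\<pi>\<close> without bounded
    variation the function is set to 0, which makes it monotone for every
    \<open>\<gamma>\<close>.\<close>
  define f :: "(real \<Rightarrow> 'a) \<Rightarrow> real \<Rightarrow> real"
    where "f = (\<lambda>\<gamma> t. if \<gamma> \<in> N then 0 else var_fun UNIV dist \<gamma> t)"
  show ?thesis
  proof (rule emeasure_mean_variation_measure[OF _ _ _ A])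
    show "mono_on I01 (f \<gamma>)" if "\<gamma> \<in> space \<pi>" for \<gamma>
    proof (cases "\<gamma> \<in> N")
      case False
      then have "\<gamma> \<in> cadlag_BV UNIV dist" using that N(1) by auto
      from var_fun_mono[OF cadlag_BV_finite[OF this]] show ?thesis using False by (simp add: f_def)
    qed (simp add: f_def mono_on_def)
    show "(\<lambda>\<gamma>. f \<gamma> t) \<in> borel_measurable \<pi>" if t: "t \<in> I01" for t
    proof -
      \<comment> \<open>On cadlag curves the essential variation is the plain variation, which is a
        measurable function of the curve.\<close>
      have "(\<lambda>\<gamma>. Var dist \<gamma> {0<..<t}) \<in> borel_measurable \<pi>"
        using t by (intro Var_measurable evaluation_measurable_pi cadlagD(2)) (auto simp: space_pi)
      then have "(\<lambda>\<gamma>. enn2real (Var dist \<gamma> {0<..<t})) \<in> borel_measurable \<pi>" by simp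
      moreover have "N \<in> sets \<pi>" using N(2) by auto
      ultimately have "(\<lambda>\<gamma>. if \<gamma> \<in> N then 0 else enn2real (Var dist \<gamma> {0<..<t})) \<in> borel_measurable \<pi>"
        by (intro measurable_If_set) auto
      then show ?thesis
        by (subst measurable_cong)
           (use t in \<open>auto simp: f_def space_pi cadlag_ess_Var_eq_Var\<close>)
    qed
    show "AE \<gamma> in \<pi>. variation_measure UNIV dist \<gamma> = LS_measure (f \<gamma>)"
      using AE_not_in[OF N(2)] by eventually_elim (simp add: variation_measure_def f_def)
  qed
qed

lemma sets_nu: "sets \<nu> = sets (restrict_space borel I01)"
  by (rule sets_mean_variation_measure)

sublocale nu: finite_measure \<nu>
proof (rule finite_measureI)
  have "space \<nu> = I01" using sets_eq_imp_space_eq[OF sets_nu] by (simp add: space_restrict_space)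
  moreover have "I01 \<in> sets (restrict_space borel I01)" by (simp add: sets_borel_I01)
  ultimately show "emeasure \<nu> (space \<nu>) \<noteq> \<infinity>" using fin emeasure_nu[of I01] by simp
qed

lemma mass_diff: "0 \<le> a \<Longrightarrow> a \<le> b \<Longrightarrow> b \<le> 1 \<Longrightarrow> mass b - mass a = measure \<nu> {a<..b}"
  using measure_Ioc_I01[OF nu.finite_measure_axioms sets_nu] by (simp add: mass_def)

lemma mass_mono: "0 \<le> a \<Longrightarrow> a \<le> b \<Longrightarrow> b \<le> 1 \<Longrightarrow> mass a \<le> mass b"
  using mass_diff[of a b] measure_nonneg[of \<nu> "{a<..b}"] by linarith

lemma mass_nonneg: "0 \<le> mass t"
  by (simp add: mass_def)

lemma mass_right_cont:
  assumes "0 \<le> t" "t < 1"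
  shows "(mass \<longlongrightarrow> mass t) (at_right t)"
proof -
  have "((\<lambda>s. measure \<nu> {t<..s} + mass t) \<longlongrightarrow> 0 + mass t) (at_right t)"
    by (rule tendsto_add[OF measure_Ioc_tendsto_0[OF nu.finite_measure_axioms sets_nu assms] tendsto_const])
  moreover have "\<forall>\<^sub>F s in at_right t. measure \<nu> {t<..s} + mass t = mass s"
    using eventually_at_right_real[OF assms(2)]
  proof eventually_elim
    case (elim s)
    then show ?case using mass_diff[of t s] assms by simp
  qed
  ultimately have "(mass \<longlongrightarrow> 0 + mass t) (at_right t)" by (rule Lim_transform_eventually)
  then show ?thesis by simp
qed

lemma integral_dist_le:
  assumes "0 \<le> s" "s < t" "t < 1"
  shows "(\<integral>\<^sup>+\<gamma>. ennreal (dist (\<gamma> s) (\<gamma> t)) \<partial>\<pi>) \<le> ennreal (mass t - mass s)"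
proof -
  have "(\<integral>\<^sup>+\<gamma>. ennreal (dist (\<gamma> s) (\<gamma> t)) \<partial>\<pi>) \<le> (\<integral>\<^sup>+\<gamma>. emeasure (variation_measure UNIV dist \<gamma>) {s<..t} \<partial>\<pi>)"
    by (intro nn_integral_mono_AE)
       (use BV in eventually_elim, use assms in \<open>auto intro: dist_le_variation_measure\<close>)
  also have "\<dots> = emeasure \<nu> {s<..t}"
    using assms by (intro emeasure_nu[symmetric]) (auto simp: sets_borel_I01)
  also have "\<dots> = ennreal (mass t - mass s)"
    using assms by (simp add: mass_diff nu.emeasure_eq_measure)
  finally show ?thesis .
qed

abbreviation law :: "real \<Rightarrow> 'a measure"
  where "law t \<equiv> distr \<pi> borel (\<lambda>\<gamma>. \<gamma> t)"

lemma marginals_eq: "0 \<le> t \<Longrightarrow> t \<le> 1 \<Longrightarrow> marginals \<pi> t = law t"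
  by (simp add: marginals_def)

lemma W1_law_le:
  assumes "0 \<le> s" "s < t" "t < 1"
  shows "W1 (law s) (law t) \<le> mass t - mass s" "W1 (law t) (law s) \<le> mass t - mass s"
proof -
  have "(\<integral>\<^sup>+\<gamma>. ennreal (dist (\<gamma> t) (\<gamma> s)) \<partial>\<pi>) \<le> ennreal (mass t - mass s)"
    using integral_dist_le[OF assms] by (simp add: dist_commute)
  moreover have "0 \<le> mass t - mass s" using mass_mono[of s t] assms by simp
  ultimately show "W1 (law s) (law t) \<le> mass t - mass s" "W1 (law t) (law s) \<le> mass t - mass s"
    using assms integral_dist_le[OF assms]
    by (intro W1_distr_le[OF prob_space_axioms] evaluation_measurable_pi; simp)+
qed

lemma law_P1:
  assumes t: "0 \<le> t" "t < 1"
  shows "law t \<in> P1"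
proof (cases "t = 0")
  case False
  show ?thesis
  proof (rule P1_distr[OF prob_space_axioms])
    show "(\<integral>\<^sup>+\<gamma>. ennreal (dist (\<gamma> 0) (\<gamma> t)) \<partial>\<pi>) < \<infinity>"
      using integral_dist_le[of 0 t] False t by (simp add: le_less_trans[OF _ ennreal_less_top])
  qed (use t P0 in \<open>auto intro: evaluation_measurable_pi simp: marginals_eq\<close>)
qed (use P0 in \<open>simp add: marginals_eq\<close>)

text \<open>The bound uses the open interval \<open>{s<..<t}\<close> and so tends to 0 as
  \<open>s\<close> increases to \<open>t\<close>, even when \<open>\<nu>\<close> has an atom at
  \<open>t\<close>. At \<open>t = 1\<close> the limit can stand in for the value of the curve, which
  the variation measures do not control.\<close>

lemma left_limit_law:
  assumes t: "0 < t" "t \<le> 1"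
  obtains l where "l \<in> P1" "\<And>s. 0 \<le> s \<Longrightarrow> s < t \<Longrightarrow> W1 (law s) l \<le> measure \<nu> {s<..<t}"
proof -
  define L where "L = (\<lambda>\<gamma>::real \<Rightarrow> 'a. SOME l. (\<gamma> \<longlongrightarrow> l) (at_left t))"
  have L: "(\<gamma> \<longlongrightarrow> L \<gamma>) (at_left t)" if "\<gamma> \<in> cadlag UNIV dist" for \<gamma>
    unfolding L_def using cadlagD(3)[OF that t] by (rule someI_ex)
  \<comment> \<open>Times increasing to \<open>t\<close>, starting at 0; \<open>L\<close> is
    measurable as a limit of the evaluations at them.\<close>
  define r where "r = (\<lambda>n. t - t * inverse (real (Suc n)))"
  have r: "0 \<le> r n" "r n < t" for n
    using t by (simp_all add: r_def field_simps)
  have "r \<longlonglongrightarrow> t - t * 0"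
    unfolding r_def by (intro tendsto_intros LIMSEQ_inverse_real_of_nat)
  then have rlim: "filterlim r (at_left t) sequentially"
    using r(2) by (auto simp: filterlim_at less_imp_neq)
  have L_meas: "L \<in> measurable \<pi> borel"
  proof (rule borel_measurable_LIMSEQ_metric)
    show "(\<lambda>\<gamma>. \<gamma> (r n)) \<in> borel_measurable \<pi>" for n
      using r(1)[of n] r(2)[of n] t by (intro evaluation_measurable_pi) auto
    show "(\<lambda>n. \<gamma> (r n)) \<longlonglongrightarrow> L \<gamma>" if "\<gamma> \<in> space \<pi>" for \<gamma>
      using that unfolding space_pi by (intro filterlim_compose[OF L rlim])
  qed
  have le: "(\<integral>\<^sup>+\<gamma>. ennreal (dist (\<gamma> s) (L \<gamma>)) \<partial>\<pi>) \<le> ennreal (measure \<nu> {s<..<t})" if s: "0 \<le> s" "s < t" for s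
  proof -
    have pt: "ennreal (dist (\<gamma> s) (L \<gamma>)) \<le> emeasure (variation_measure UNIV dist \<gamma>) {s<..<t}"
      if g: "\<gamma> \<in> cadlag_BV UNIV dist" for \<gamma>
    \<comment> \<open>For every \<open>r\<close> in \<open>(s, t)\<close> the distance up to time
      \<open>r\<close> is bounded by the mass of \<open>{s<..<t}\<close>, and this survives the
      limit.\<close>
    proof (rule tendsto_upperbound)
      have "\<gamma> \<in> cadlag UNIV dist" using g by (simp add: cadlag_BV_def)
      then show "((\<lambda>r. ennreal (dist (\<gamma> s) (\<gamma> r))) \<longlongrightarrow> ennreal (dist (\<gamma> s) (L \<gamma>))) (at_left t)"
        by (intro tendsto_ennrealI tendsto_dist tendsto_const L)
      show "\<forall>\<^sub>F r in at_left t. ennreal (dist (\<gamma> s) (\<gamma> r)) \<le> emeasure (variation_measure UNIV dist \<gamma>) {s<..<t}"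
        using eventually_at_left_real[OF s(2)]
      proof eventually_elim
        case (elim r)
        then have "ennreal (dist (\<gamma> s) (\<gamma> r)) \<le> emeasure (variation_measure UNIV dist \<gamma>) {s<..r}"
          using s t by (intro dist_le_variation_measure[OF g]) auto
        also have "\<dots> \<le> emeasure (variation_measure UNIV dist \<gamma>) {s<..<t}"
          using elim s t by (intro emeasure_mono) (auto simp: sets_variation_measure sets_borel_I01)
        finally show ?case .
      qed
    qed simp
    have "(\<integral>\<^sup>+\<gamma>. ennreal (dist (\<gamma> s) (L \<gamma>)) \<partial>\<pi>) \<le> (\<integral>\<^sup>+\<gamma>. emeasure (variation_measure UNIV dist \<gamma>) {s<..<t} \<partial>\<pi>)"
      by (intro nn_integral_mono_AE) (use BV in eventually_elim, rule pt)
    also have "\<dots> = emeasure \<nu> {s<..<t}"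
      using s t by (intro emeasure_nu[symmetric]) (auto simp: sets_borel_I01)
    finally show ?thesis by (simp add: nu.emeasure_eq_measure)
  qed
  show ?thesis
  proof (rule that)
    show "W1 (law s) (distr \<pi> borel L) \<le> measure \<nu> {s<..<t}" if "0 \<le> s" "s < t" for s
      using that t le[OF that] by (intro W1_distr_le[OF prob_space_axioms] evaluation_measurable_pi L_meas) auto
    show "distr \<pi> borel L \<in> P1"
    proof (rule P1_distr[OF prob_space_axioms _ L_meas])
      show "(\<integral>\<^sup>+\<gamma>. ennreal (dist (\<gamma> 0) (L \<gamma>)) \<partial>\<pi>) < \<infinity>"
        using le[of 0] t by (simp add: le_less_trans[OF _ ennreal_less_top])
      show "(\<lambda>\<gamma>. \<gamma> 0) \<in> borel_measurable \<pi>" by (rule evaluation_measurable_pi) auto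
      show "law 0 \<in> P1" by (rule law_P1) auto
    qed
  qed
qed

text \<open>Right continuity before 1 and all left limits depend only on times before 1, so any
  value in \<open>P1\<close> may be taken at 1.\<close>

lemma modified_marginals_cadlag:
  assumes u: "u \<in> I01 \<rightarrow>\<^sub>E P1" "\<And>t. 0 \<le> t \<Longrightarrow> t < 1 \<Longrightarrow> u t = law t"
  shows "u \<in> cadlag P1 W1"
proof -
  have "((\<lambda>s. W1 (u s) (u t)) \<longlongrightarrow> 0) (at_right t)" if t: "0 \<le> t" "t < 1" for t
  proof (rule tendsto_sandwich)
    show "\<forall>\<^sub>F s in at_right t. 0 \<le> W1 (u s) (u t)" by (simp add: W1_def)
    show "\<forall>\<^sub>F s in at_right t. W1 (u s) (u t) \<le> measure \<nu> {t<..s}"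
      using eventually_at_right_real[OF t(2)]
      by eventually_elim (use t W1_law_le(2)[of t] in \<open>auto simp: u(2) mass_diff\<close>)
    show "((\<lambda>s. measure \<nu> {t<..s}) \<longlongrightarrow> 0) (at_right t)"
      by (rule measure_Ioc_tendsto_0[OF nu.finite_measure_axioms sets_nu t])
  qed simp
  moreover have "\<exists>l\<in>P1. ((\<lambda>s. W1 (u s) l) \<longlongrightarrow> 0) (at_left t)" if t: "0 < t" "t \<le> 1" for t
  proof -
    obtain l where l: "l \<in> P1" "\<And>s. 0 \<le> s \<Longrightarrow> s < t \<Longrightarrow> W1 (law s) l \<le> measure \<nu> {s<..<t}"
      using left_limit_law[OF t] by blast
    have "((\<lambda>s. W1 (u s) l) \<longlongrightarrow> 0) (at_left t)"
    proof (rule tendsto_sandwich)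
      show "\<forall>\<^sub>F s in at_left t. 0 \<le> W1 (u s) l" by (simp add: W1_def)
      show "\<forall>\<^sub>F s in at_left t. W1 (u s) l \<le> measure \<nu> {s<..<t}"
        using eventually_at_left_real[OF t(1)]
        by eventually_elim (use t l(2) in \<open>auto simp: u(2)\<close>)
      show "((\<lambda>s. measure \<nu> {s<..<t}) \<longlongrightarrow> 0) (at_left t)"
        by (rule measure_Ioo_tendsto_0[OF nu.finite_measure_axioms sets_nu t])
    qed simp
    then show ?thesis using l(1) by blast
  qed
  ultimately show ?thesis using u(1) by (auto simp: cadlag_def)
qed

lemma modified_marginals_cadlag_BV:
  assumes u: "u \<in> I01 \<rightarrow>\<^sub>E P1" "\<And>t. 0 \<le> t \<Longrightarrow> t < 1 \<Longrightarrow> u t = law t"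
  shows "u \<in> cadlag_BV P1 W1"
proof -
  interpret W: Metric_space "P1 :: 'a measure set" W1 by (rule Metric_space_P1)
  have c: "u \<in> cadlag P1 W1" by (rule modified_marginals_cadlag[OF u])
  have u0: "u 0 \<in> P1" using u(1) by auto
  \<comment> \<open>The end point is bounded separately, as its distance from the start is not
    controlled by \<open>mass\<close>.\<close>
  define B where "B = max (mass 1) (W1 (u 1) (u 0))"
  have B: "W1 (u t) (u 0) \<le> B" if t: "t \<in> I01" for t
  proof -
    consider "t = 0" | "0 < t" "t < 1" | "t = 1" using t by fastforce
    then show ?thesis
    proof cases
      case 1
      then have "W1 (u t) (u 0) = 0" using u0 by simp
      then show ?thesis using mass_nonneg[of 1] by (simp add: B_def)
    next
      case 2
      then have "W1 (u t) (u 0) \<le> mass t - mass 0" using W1_law_le(2)[of 0 t] by (simp add: u(2))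
      also have "\<dots> \<le> B" using mass_mono[of t 1] mass_nonneg[of 0] 2 by (simp add: B_def)
      finally show ?thesis .
    qed (simp add: B_def)
  qed
  have "(\<integral>\<^sup>+t. ennreal (W1 (u t) (u 0)) \<partial>lebesgue_on I01) \<le> (\<integral>\<^sup>+t. ennreal B \<partial>lebesgue_on I01)"
    using B by (intro nn_integral_mono ennreal_leI) auto
  also have "\<dots> < \<infinity>" by (simp add: emeasure_restrict_space ennreal_mult_less_top)
  finally have "u \<in> L1_curves P1 W1"
    using cadlag_measurable[OF Metric_space_P1 c] u0 by (auto simp: L1_curves_def)
  moreover have "ess_Var P1 W1 u I01 < \<infinity>"
  proof -
    obtain l where l: "l \<in> P1" "\<And>s. 0 \<le> s \<Longrightarrow> s < 1 \<Longrightarrow> W1 (law s) l \<le> measure \<nu> {s<..<1}"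
      using left_limit_law[of 1] by auto
    \<comment> \<open>A competitor for \<open>ess_Var\<close> may differ from \<open>u\<close> at
      the single time 1; the left limit as value there removes the jump.\<close>
    define v where "v = u(1 := l)"
    have "ess_Var P1 W1 u I01 \<le> Var W1 v I01"
    proof (rule ess_Var_lower)
      show "v \<in> I01 \<rightarrow> P1" using u(1) l(1) by (auto simp: v_def)
      have "{1::real} \<in> null_sets lebesgue" by simp
      from AE_not_in[OF this] show "AE t in lebesgue. t \<in> I01 \<longrightarrow> v t = u t"
        by eventually_elim (simp add: v_def)
    qed
    also have "\<dots> \<le> ennreal (mass 1)"
    proof (rule Var_telescope[where F = mass])
      fix x y :: real assume xy: "x \<in> I01" "y \<in> I01" "x < y"
      have "W1 (v x) (v y) \<le> mass y - mass x"
      proof (cases "y = 1")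
        case True
        have "W1 (law x) l \<le> measure \<nu> {x<..<1}" using xy True by (intro l) auto
        also have "\<dots> \<le> measure \<nu> {x<..1}"
          using xy by (intro nu.finite_measure_mono) (auto simp: sets_nu sets_borel_I01)
        also have "\<dots> = mass 1 - mass x" using xy by (simp add: mass_diff)
        finally show ?thesis using True xy by (simp add: v_def u(2))
      next
        case False
        then show ?thesis using W1_law_le(1)[of x y] xy by (simp add: v_def u(2))
      qed
      then show "0 \<le> W1 (v x) (v y) \<and> W1 (v x) (v y) \<le> mass y - mass x" by simp
      show "mass y - mass x \<le> mass 1" using mass_mono[of y 1] mass_nonneg[of x] xy by simp
    qed
    also have "\<dots> < \<infinity>" by simp
    finally show ?thesis .
  qed
  ultimately show ?thesis using c by (simp add: cadlag_BV_def BV_curve_def)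
qed

text \<open>By \<open>measure_le_I01\<close> it is enough to dominate the increments of
  \<open>right_lim ?V\<close> by those of \<open>mass\<close> and to exclude an atom at 0. For this
  the essential variation up to \<open>b\<close> has to be compared with that up to an earlier time;
  \<open>ess_Var_extend\<close> does so with an overlap, which is then sent to 0.\<close>

lemma variation_measure_marginals_le: "variation_measure P1 W1 (marginals \<pi>) \<le> \<nu>"
proof -
  let ?u = "marginals \<pi>"
  let ?V = "var_fun P1 W1 ?u"
  have W1_le: "0 \<le> W1 (?u x) (?u y) \<and> W1 (?u x) (?u y) \<le> mass y - mass x" if "0 < x" "x < y" "y < 1" for x y
    using W1_law_le(1)[of x y] that by (simp add: marginals_eq W1_def)
  have ess_le: "ess_Var P1 W1 ?u {0<..<b} \<le> ennreal (mass b - mass 0)" if b: "0 \<le> b" "b \<le> 1" for b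
  proof -
    have "ess_Var P1 W1 ?u {0<..<b} \<le> Var W1 ?u {0<..<b}"
      using b by (intro ess_Var_lower) (auto simp: marginals_eq law_P1)
    also have "\<dots> \<le> ennreal (mass b - mass 0)"
    proof (rule Var_telescope[where F = mass])
      fix x y assume xy: "x \<in> {0<..<b}" "y \<in> {0<..<b}" "x < y"
      then show "0 \<le> W1 (?u x) (?u y) \<and> W1 (?u x) (?u y) \<le> mass y - mass x"
        using b by (intro W1_le) auto
      show "mass y - mass x \<le> mass b - mass 0"
        using mass_mono[of y b] mass_mono[of 0 x] xy b by simp
    qed
    finally show ?thesis .
  qed
  have ess_fin: "ess_Var P1 W1 ?u {0<..<b} < top" if "0 \<le> b" "b \<le> 1" for b
    using ess_le[OF that] by (rule le_less_trans) simp
  have V: "mono_on I01 ?V" by (rule var_fun_mono) (use ess_fin[of 1] in simp)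
  have V_le: "?V b \<le> mass b - mass 0" if b: "0 \<le> b" "b \<le> 1" for b
    using enn2real_mono[OF ess_le[OF b]] mass_mono[of 0 b] b by simp
  \<comment> \<open>The overlap between \<open>r\<close> and \<open>s\<close> leaves room for the
    switching time of the competitor.\<close>
  have V_ext: "?V b \<le> ?V s + (mass b - mass r)" if rsb: "0 \<le> r" "r < s" "s < b" "b \<le> 1" for r s b
  proof -
    have nn: "0 \<le> mass b - mass r" using mass_mono[of r b] rsb by simp
    have "ess_Var P1 W1 ?u {0<..<b} \<le> ess_Var P1 W1 ?u {0<..<s} + ennreal (mass b - mass r)"
    proof (rule ess_Var_extend[OF Metric_space_P1 _ _ rsb(1-3), where F = mass])
      show "?u x \<in> P1" if "0 < x" "x < b" for x
        using that rsb by (simp add: marginals_eq law_P1)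
      show "W1 (?u x) (?u y) \<le> mass y - mass x" if "0 < x" "x < y" "y < b" for x y
        using W1_le[of x y] that rsb by simp
      show "mass y - mass r' \<le> mass b - mass r" if "r < r'" "r' < y" "y < b" for r' y
        using mass_mono[of y b] mass_mono[of r r'] that rsb by simp
    qed
    then have "?V b \<le> enn2real (ess_Var P1 W1 ?u {0<..<s} + ennreal (mass b - mass r))"
      using ess_fin[of s] rsb by (intro enn2real_mono) (auto simp: less_top)
    also have "\<dots> = ?V s + (mass b - mass r)"
      using ess_fin[of s] rsb nn by (subst enn2real_plus) auto
    finally show ?thesis .
  qed
  \<comment> \<open>With \<open>r = a\<close> fixed, \<open>s\<close> decreases to \<open>a\<close>,
    which closes the overlap and turns \<open>?V s\<close> into the right limit.\<close>
  have claim: "?V b \<le> right_lim ?V a + (mass b - mass a)" if ab: "0 \<le> a" "a < b" "b \<le> 1" for a b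
  proof (rule tendsto_lowerbound)
    show "((\<lambda>s. ?V (max 0 (min 1 s)) + (mass b - mass a)) \<longlongrightarrow> right_lim ?V a + (mass b - mass a)) (at_right a)"
      by (intro tendsto_add right_lim_tendsto[OF V] tendsto_const)
    show "\<forall>\<^sub>F s in at_right a. ?V b \<le> ?V (max 0 (min 1 s)) + (mass b - mass a)"
      using eventually_at_right_real[OF ab(2)]
    proof eventually_elim
      case (elim s)
      then have "max 0 (min 1 s) = s" using ab by simp
      then show ?case using V_ext[of a s b] elim ab by simp
    qed
  qed simp
  have main: "right_lim ?V b - right_lim ?V a \<le> mass b - mass a" if ab: "0 \<le> a" "a < b" "b \<le> 1" for a b
  proof (cases "b = 1")
    case True
    then show ?thesis using claim[OF ab] right_lim_1[OF V] by simp
  next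
    case False
    then have b1: "b < 1" using ab by simp
    \<comment> \<open>The bound at times \<open>s > b\<close> is passed to \<open>b\<close> by right
      continuity of \<open>mass\<close>.\<close>
    have "right_lim ?V b \<le> right_lim ?V a + (mass b - mass a)"
    proof (rule tendsto_lowerbound)
      show "((\<lambda>s. right_lim ?V a + (mass s - mass a)) \<longlongrightarrow> right_lim ?V a + (mass b - mass a)) (at_right b)"
        using ab b1 by (intro tendsto_intros mass_right_cont) auto
      show "\<forall>\<^sub>F s in at_right b. right_lim ?V b \<le> right_lim ?V a + (mass s - mass a)"
        using eventually_at_right_real[OF b1]
      proof eventually_elim
        case (elim s)
        then have "max 0 (min 1 s) = s" using ab by simp
        then have "right_lim ?V b \<le> ?V s" using right_lim_le[OF V, of b s] elim by simp
        also have "\<dots> \<le> right_lim ?V a + (mass s - mass a)" using elim ab by (intro claim) auto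
        finally show ?case .
      qed
    qed simp
    then show ?thesis by simp
  qed
  \<comment> \<open>The bound \<open>mass s - mass 0\<close> tends to 0, so the variation measure of
    the marginals has no atom at 0, whatever mass \<open>\<nu>\<close> has there.\<close>
  have zero: "right_lim ?V 0 \<le> 0"
  proof (rule tendsto_lowerbound)
    have "((\<lambda>s. mass s - mass 0) \<longlongrightarrow> mass 0 - mass 0) (at_right 0)"
      by (intro tendsto_intros mass_right_cont) auto
    then show "((\<lambda>s. mass s - mass 0) \<longlongrightarrow> 0) (at_right 0)" by simp
    show "\<forall>\<^sub>F s in at_right 0. right_lim ?V 0 \<le> mass s - mass 0"
      using eventually_at_right_real[OF zero_less_one]
    proof eventually_elim
      case (elim s)
      then have "max 0 (min 1 s) = s" by simp
      then have "right_lim ?V 0 \<le> ?V s" using right_lim_le[OF V, of 0 s] elim by simp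
      also have "\<dots> \<le> mass s - mass 0" using elim by (intro V_le) auto
      finally show ?case .
    qed
  qed simp
  show ?thesis
    unfolding variation_measure_def
  proof (rule measure_le_I01[OF finite_measure_LS_measure[OF V] nu.finite_measure_axioms sets_LS_measure sets_nu])
    show "measure (LS_measure ?V) {0} \<le> measure \<nu> {0}"
    proof -
      have "measure (LS_measure ?V) {0} = right_lim ?V 0 - ?V 0"
        using measure_LS_measure_interval[OF V, of 0] by simp
      also have "\<dots> \<le> 0" using zero by (simp add: ess_Var_empty)
      also have "0 \<le> measure \<nu> {0}" by simp
      finally show ?thesis .
    qed
    show "measure (LS_measure ?V) {a<..b} \<le> measure \<nu> {a<..b}" if "0 \<le> a" "a < b" "b \<le> 1" for a b
      using measure_LS_measure_Ioc[OF V, of a b] main[of a b] mass_diff[of a b] that by simp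
  qed
qed

end

theorem theorem3p1:
  fixes \<pi> :: "(real \<Rightarrow> 'a::polish_space) measure"
  assumes "\<pi> \<in> space (prob_algebra (skorokhod_borel UNIV dist))"
    and "AE \<gamma> in \<pi>. \<gamma> \<in> cadlag_BV UNIV dist"
    and "(\<integral>\<^sup>+\<gamma>. emeasure (variation_measure UNIV dist \<gamma>) I01 \<partial>\<pi>) < \<infinity>"
    and "marginals \<pi> 0 \<in> P1"
  shows "(marginals \<pi> 1 \<in> P1 \<longrightarrow> marginals \<pi> \<in> cadlag_BV P1 W1) \<and>
    (\<forall>\<rho>\<in>P1. (marginals \<pi>)(1 := \<rho>) \<in> cadlag_BV P1 W1) \<and>
    variation_measure P1 W1 (marginals \<pi>) \<le> mean_variation_measure UNIV dist \<pi>"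
proof -
  interpret random_BV_curve \<pi> by unfold_locales (fact assms)+
  have mod: "(marginals \<pi>)(1 := \<rho>) \<in> cadlag_BV P1 W1" if "\<rho> \<in> P1" for \<rho>
  proof (rule modified_marginals_cadlag_BV)
    show "(marginals \<pi>)(1 := \<rho>) \<in> I01 \<rightarrow>\<^sub>E P1"
    proof (rule PiE_I)
      fix t :: real assume "t \<in> I01"
      then show "((marginals \<pi>)(1 := \<rho>)) t \<in> P1" using that by (auto simp: marginals_eq law_P1)
    qed (auto simp: marginals_def)
  qed (simp add: marginals_eq)
  \<comment> \<open>Updating the curve at 1 with its own value changes nothing, so this is an
    instance of \<open>mod\<close>.\<close>
  have "marginals \<pi> \<in> cadlag_BV P1 W1" if "marginals \<pi> 1 \<in> P1"
    using mod[OF that] by simp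
  with mod variation_measure_marginals_le show ?thesis by blast
qed

end
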